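(* The following four problems are NP-hard (under polynomial-time many-one, i.e. Karp, reductions). (1) Given $n$ and a symmetric $n\times n$ rational matrix $\Gamma$, decide whether $\Gamma\in\overline{\mathsf{COR}}(n)$. (2) Given a positive integer $\rho$ and a symmetric $n\times n$ rational matrix $\Gamma$ promised to belong to $\overline{\mathsf{COR}}(n)$, decide whether $\Gamma$ is a convex combination of at most $\rho$ matrices of the form $xx^{\top}$ with $x\in\{0,1\}^n\setminus\{0\}$. (3) Given $n$ and a symmetric $n\times n$ rational matrix $\Gamma$, decide whether $\Gamma\in\overline{\mathsf{CUT}}(n)$. (4) Given a positive integer $\rho$ and a symmetric $n\times n$ rational matrix $\Gamma$ promised to belong to $\overline{\mathsf{CUT}}(n)$, decide whether $\Gamma$ is a convex combination of at most $\rho$ matrices of the form $yy^{\top}$ with $y\in\{-1,1\}^n\setminus\{\mathbf{1},-\mathbf{1}\}$.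
   Context: The normalized correlation polytope $\overline{\mathsf{COR}}(n)$ is the convex hull of $\{xx^{\top} : x\in\{0,1\}^n,\ x\neq 0\}$ (the generators of the correlation polytope without the zero matrix). The normalized cut polytope $\overline{\mathsf{CUT}}(n)$ is the convex hull of $\{yy^{\top} : y\in\{-1,1\}^n,\ y\ne\pm\mathbf{1}\}$ (the generators of the cut polytope without the all-one matrix $\mathbf{1}\mathbf{1}^{\top}$), where $\mathbf{1}$ is the all-one vector. A promise means that every instance satisfies the stated condition (the weights of a decomposition are not part of the input); a promise problem is NP-hard if every language in NP has a polynomial-time many-one reduction to it whose outputs always satisfy the promise. *)

theory Defs
  imports
    "Jordan_Normal_Form.Matrix"
    "HOL-Computational_Algebra.Polynomial"
begin

section \<open>Multi-tape Turing machines\<close>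

text \<open>
  Deterministic machines with finitely many two-way infinite tapes and finitely many states and
  tape symbols, both numbered from 0. Symbol 0 is the blank, symbols 1 and 2 are the bits.
  The machine starts in state 0. The states with a transition are those below \<open>states\<close>; the
  number \<open>states\<close> itself is the halting state. A transition reads the symbols under all heads
  and gives the new state and, for each tape, the symbol written and the head movement.
\<close>

datatype direction = Move_Left | Stay | Move_Right

record tm =
  tapes :: nat
  symbols :: nat
  states :: nat
  delta :: "nat \<Rightarrow> nat list \<Rightarrow> nat \<times> (nat \<times> direction) list"

definition turing_machine :: "tm \<Rightarrow> bool" where
  "turing_machine M \<longleftrightarrow> 1 \<le> tapes M \<and> 3 \<le> symbols M \<and>
     (\<forall>q as. q < states M \<longrightarrow> length as = tapes M \<longrightarrow> (\<forall>a\<in>set as. a < symbols M) \<longrightarrow>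
        fst (delta M q as) \<le> states M \<and>
        length (snd (delta M q as)) = tapes M \<and>
        (\<forall>(b, d)\<in>set (snd (delta M q as)). b < symbols M))"

type_synonym tape = "(int \<Rightarrow> nat) \<times> int"

type_synonym config = "nat \<times> tape list"

fun read_tape :: "tape \<Rightarrow> nat" where
  "read_tape (c, h) = c h"

fun shift_head :: "direction \<Rightarrow> int \<Rightarrow> int" where
  "shift_head Move_Left h = h - 1"
| "shift_head Stay h = h"
| "shift_head Move_Right h = h + 1"

fun act :: "nat \<times> direction \<Rightarrow> tape \<Rightarrow> tape" where
  "act (b, d) (c, h) = (c(h := b), shift_head d h)"

fun step :: "tm \<Rightarrow> config \<Rightarrow> config" where
  "step M (q, ts) =
     (if q = states M then (q, ts)
      else (let (q', as) = delta M q (map read_tape ts) in (q', map2 act as ts)))"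

definition bit_symbol :: "bool \<Rightarrow> nat" where
  "bit_symbol b = (if b then 2 else 1)"

definition input_tape :: "bool list \<Rightarrow> tape" where
  "input_tape x =
     ((\<lambda>i. if 0 \<le> i \<and> i < int (length x) then bit_symbol (x ! nat i) else 0), 0)"

definition initial_config :: "tm \<Rightarrow> bool list list \<Rightarrow> config" where
  "initial_config M xs =
     (0, map (\<lambda>j. input_tape (if j < length xs then xs ! j else [])) [0..<tapes M])"

text \<open>The output is the bit string that starts at the head and ends before the next blank.\<close>

fun holds_output :: "tape \<Rightarrow> bool list \<Rightarrow> bool" where
  "holds_output (c, h) y \<longleftrightarrow>
     (\<forall>i<length y. c (h + int i) = bit_symbol (y ! i)) \<and> c (h + int (length y)) = 0"

text \<open>Argument number \<open>j\<close> is given on tape number \<open>j\<close>; the output is on tape number 0.\<close>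

definition computes_within :: "tm \<Rightarrow> bool list list \<Rightarrow> bool list \<Rightarrow> nat \<Rightarrow> bool" where
  "computes_within M xs y T \<longleftrightarrow> length xs \<le> tapes M \<and>
     (\<exists>t\<le>T. \<exists>ts. (step M ^^ t) (initial_config M xs) = (states M, ts) \<and> holds_output (hd ts) y)"

section \<open>NP and NP-hardness of promise problems\<close>

definition polytime_computable :: "(bool list \<Rightarrow> bool list) \<Rightarrow> bool" where
  "polytime_computable f \<longleftrightarrow>
     (\<exists>M (p :: nat poly). turing_machine M \<and>
        (\<forall>x. computes_within M [x] (f x) (poly p (length x))))"

definition polytime_decidable2 :: "(bool list \<Rightarrow> bool list \<Rightarrow> bool) \<Rightarrow> bool" where
  "polytime_decidable2 V \<longleftrightarrow>
     (\<exists>M (p :: nat poly). turing_machine M \<and>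
        (\<forall>x w. computes_within M [x, w] [V x w] (poly p (length x + length w))))"

definition in_NP :: "bool list set \<Rightarrow> bool" where
  "in_NP L \<longleftrightarrow>
     (\<exists>V (q :: nat poly). polytime_decidable2 V \<and>
        L = {x. \<exists>w. length w \<le> poly q (length x) \<and> V x w})"

text \<open>
  A promise problem is given by a relation \<open>enc\<close> between instances and the bit strings encoding
  them (an instance may have several encodings, a string encodes at most one instance), the set
  \<open>P\<close> of the instances satisfying the promise, and the set \<open>Y\<close> of instances with answer yes.
\<close>

definition NP_hard :: "('i \<Rightarrow> bool list \<Rightarrow> bool) \<Rightarrow> 'i set \<Rightarrow> 'i set \<Rightarrow> bool" where
  "NP_hard enc P Y \<longleftrightarrow>
     (\<forall>L. in_NP L \<longrightarrow>
        (\<exists>f. polytime_computable f \<and>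
           (\<forall>x. \<exists>I\<in>P. enc I (f x) \<and> (x \<in> L \<longleftrightarrow> I \<in> Y))))"

section \<open>Binary encoding of instances\<close>

text \<open>Binary digits, least significant first.\<close>

fun nat_bits :: "nat \<Rightarrow> bool list" where
  "nat_bits n = (if n = 0 then [] else odd n # nat_bits (n div 2))"

declare nat_bits.simps [simp del]

text \<open>Each digit is preceded by \<open>True\<close>, and \<open>False\<close> marks the end of the number.\<close>

definition encode_nat :: "nat \<Rightarrow> bool list" where
  "encode_nat n = concat (map (\<lambda>b. [True, b]) (nat_bits n)) @ [False]"

definition encode_int :: "int \<Rightarrow> bool list" where
  "encode_int a = (a < 0) # encode_nat (nat \<bar>a\<bar>)"

definition encode_fraction :: "int \<times> nat \<Rightarrow> bool list" where
  "encode_fraction = (\<lambda>(a, b). encode_int a @ encode_nat b)"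

text \<open>
  A rational square matrix is encoded by its dimension and its entries, row by row, as fractions
  with positive denominator that need not be in lowest terms.
\<close>

definition encodes_mat :: "rat mat \<Rightarrow> bool list \<Rightarrow> bool" where
  "encodes_mat \<Gamma> s \<longleftrightarrow> square_mat \<Gamma> \<and>
     (\<exists>F :: nat \<Rightarrow> nat \<Rightarrow> int \<times> nat.
        (\<forall>i<dim_row \<Gamma>. \<forall>j<dim_row \<Gamma>. snd (F i j) > 0 \<and>
            \<Gamma> $$ (i, j) = of_int (fst (F i j)) / of_nat (snd (F i j))) \<and>
        s = encode_nat (dim_row \<Gamma>) @
            concat (map (\<lambda>i. concat (map (\<lambda>j. encode_fraction (F i j)) [0..<dim_row \<Gamma>]))
                        [0..<dim_row \<Gamma>]))"

definition encodes_nat_mat :: "nat \<times> rat mat \<Rightarrow> bool list \<Rightarrow> bool" where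
  "encodes_nat_mat = (\<lambda>(r, \<Gamma>) s. \<exists>s'. encodes_mat \<Gamma> s' \<and> s = encode_nat r @ s')"

lemma nat_bits_inject: "nat_bits m = nat_bits n \<Longrightarrow> m = n"
proof (induction m arbitrary: n rule: less_induct)
  case (less m)
  show ?case
  proof (cases "m = 0 \<or> n = 0")
    case True
    then show ?thesis
      using less.prems by (auto simp: nat_bits.simps[of m] nat_bits.simps[of n] split: if_splits)
  next
    case False
    then have "odd m = odd n" "nat_bits (m div 2) = nat_bits (n div 2)"
      using less.prems by (auto simp: nat_bits.simps[of m] nat_bits.simps[of n])
    moreover from this False have "m div 2 = n div 2"
      using less.IH[of "m div 2"] by simp
    ultimately show ?thesis
      by (metis even_two_times_div_two odd_two_times_div_two_succ)
  qed
qed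

lemma encode_nat_append_inject:
  assumes "encode_nat m @ s = encode_nat n @ t"
  shows "m = n \<and> s = t"
proof -
  have "u = v \<and> s = t"
    if "concat (map (\<lambda>b. [True, b]) u) @ False # s = concat (map (\<lambda>b. [True, b]) v) @ False # t"
    for u v
    using that
  proof (induction u arbitrary: v)
    case Nil
    then show ?case by (cases v) auto
  next
    case (Cons a u)
    then show ?case by (cases v) auto
  qed
  from this[of "nat_bits m" "nat_bits n"] show ?thesis
    using assms nat_bits_inject by (auto simp: encode_nat_def)
qed

lemma encode_fraction_append_inject:
  assumes "encode_fraction x @ s = encode_fraction y @ t"
  shows "x = y \<and> s = t"
proof -
  obtain a b c d where xy: "x = (a, b)" "y = (c, d)" by (cases x, cases y)
  have "(a < 0) = (c < 0)"
    and "encode_nat (nat \<bar>a\<bar>) @ encode_nat b @ s = encode_nat (nat \<bar>c\<bar>) @ encode_nat d @ t"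
    using assms by (auto simp: xy encode_fraction_def encode_int_def)
  then show ?thesis
    using encode_nat_append_inject[of "nat \<bar>a\<bar>" _ "nat \<bar>c\<bar>"] encode_nat_append_inject[of b s d t]
    by (auto simp: xy)
qed

lemma concat_map_append_inject:
  assumes "\<And>i s t. i \<in> set is \<Longrightarrow> e i @ s = e' i @ t \<Longrightarrow> Q i \<and> s = t"
  shows "concat (map e is) @ s = concat (map e' is) @ t \<Longrightarrow> (\<forall>i\<in>set is. Q i) \<and> s = t"
  using assms
proof (induction "is")
  case Nil
  then show ?case by simp
next
  case (Cons i "is")
  from Cons.prems(1) have "e i @ (concat (map e is) @ s) = e' i @ (concat (map e' is) @ t)"
    by simp
  then have "Q i \<and> concat (map e is) @ s = concat (map e' is) @ t"
    using Cons.prems(2)[of i] by simp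
  moreover from this have "(\<forall>i\<in>set is. Q i) \<and> s = t"
    using Cons.IH Cons.prems(2) by (meson list.set_intros(2))
  ultimately show ?case by simp
qed

lemma encodes_mat_unique:
  assumes "encodes_mat \<Gamma> s" and "encodes_mat \<Delta> s"
  shows "\<Gamma> = \<Delta>"
proof -
  obtain F where F: "square_mat \<Gamma>"
      "\<forall>i<dim_row \<Gamma>. \<forall>j<dim_row \<Gamma>. \<Gamma> $$ (i, j) = of_int (fst (F i j)) / of_nat (snd (F i j))"
      "s = encode_nat (dim_row \<Gamma>) @ concat (map (\<lambda>i. concat (map (\<lambda>j. encode_fraction (F i j))
              [0..<dim_row \<Gamma>])) [0..<dim_row \<Gamma>])"
    using assms(1) unfolding encodes_mat_def by blast
  obtain G where G: "square_mat \<Delta>"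
      "\<forall>i<dim_row \<Delta>. \<forall>j<dim_row \<Delta>. \<Delta> $$ (i, j) = of_int (fst (G i j)) / of_nat (snd (G i j))"
      "s = encode_nat (dim_row \<Delta>) @ concat (map (\<lambda>i. concat (map (\<lambda>j. encode_fraction (G i j))
              [0..<dim_row \<Delta>])) [0..<dim_row \<Delta>])"
    using assms(2) unfolding encodes_mat_def by blast
  define n where "n = dim_row \<Gamma>"
  have n: "dim_row \<Delta> = n"
    and eq: "concat (map (\<lambda>i. concat (map (\<lambda>j. encode_fraction (F i j)) [0..<n])) [0..<n]) @ [] =
        concat (map (\<lambda>i. concat (map (\<lambda>j. encode_fraction (G i j)) [0..<n])) [0..<n]) @ []"
    using encode_nat_append_inject[OF F(3)[unfolded G(3)]] by (auto simp: n_def)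
  have row: "(\<forall>j\<in>set [0..<n]. F i j = G i j) \<and> u = v"
    if "concat (map (\<lambda>j. encode_fraction (F i j)) [0..<n]) @ u =
        concat (map (\<lambda>j. encode_fraction (G i j)) [0..<n]) @ v" for i u v
    by (rule concat_map_append_inject[OF _ that]) (rule encode_fraction_append_inject)
  have "(\<forall>i\<in>set [0..<n]. \<forall>j\<in>set [0..<n]. F i j = G i j) \<and> ([] :: bool list) = []"
    by (rule concat_map_append_inject[OF _ eq]) (rule row)
  then show ?thesis
    using F G n by (intro eq_matI) (auto simp: n_def)
qed

lemma encodes_nat_mat_unique:
  "encodes_nat_mat I s \<Longrightarrow> encodes_nat_mat J s \<Longrightarrow> I = J"
  unfolding encodes_nat_mat_def
  by (auto dest!: encode_nat_append_inject dest: encodes_mat_unique)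

section \<open>The normalized correlation and cut polytopes\<close>

definition outer :: "real vec \<Rightarrow> real mat" where
  "outer x = mat (dim_vec x) (dim_vec x) (\<lambda>(i, j). x $ i * x $ j)"

definition COR_generators :: "nat \<Rightarrow> real mat set" where
  "COR_generators n = outer ` {x \<in> carrier_vec n. (\<forall>i<n. x $ i \<in> {0, 1}) \<and> x \<noteq> 0\<^sub>v n}"

definition all_one_vec :: "nat \<Rightarrow> real vec" where
  "all_one_vec n = vec n (\<lambda>_. 1)"

definition CUT_generators :: "nat \<Rightarrow> real mat set" where
  "CUT_generators n =
     outer ` {y \<in> carrier_vec n. (\<forall>i<n. y $ i \<in> {-1, 1}) \<and>
                y \<noteq> all_one_vec n \<and> y \<noteq> - all_one_vec n}"

text \<open>
  The type of matrices of all dimensions is not a vector space, so the library's convex hull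
  does not apply to it.
\<close>

definition convex_combination :: "nat \<Rightarrow> real mat set \<Rightarrow> real mat \<Rightarrow> bool" where
  "convex_combination n T A \<longleftrightarrow> finite T \<and>
     (\<exists>u. (\<forall>B\<in>T. 0 \<le> u B) \<and> sum u T = 1 \<and> A = mat n n (\<lambda>(i, j). \<Sum>B\<in>T. u B * B $$ (i, j)))"

definition convex_hull_mat :: "nat \<Rightarrow> real mat set \<Rightarrow> real mat set" where
  "convex_hull_mat n S = {A. \<exists>T\<subseteq>S. convex_combination n T A}"

definition convex_combination_at_most :: "nat \<Rightarrow> nat \<Rightarrow> real mat set \<Rightarrow> real mat \<Rightarrow> bool" where
  "convex_combination_at_most r n S A \<longleftrightarrow> (\<exists>T\<subseteq>S. card T \<le> r \<and> convex_combination n T A)"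

definition nCOR :: "nat \<Rightarrow> real mat set" where
  "nCOR n = convex_hull_mat n (COR_generators n)"

definition nCUT :: "nat \<Rightarrow> real mat set" where
  "nCUT n = convex_hull_mat n (CUT_generators n)"

definition symmetric_rat_mats :: "rat mat set" where
  "symmetric_rat_mats = {\<Gamma>. dim_row \<Gamma> \<ge> 1 \<and> square_mat \<Gamma> \<and> transpose_mat \<Gamma> = \<Gamma>}"

abbreviation real_mat :: "rat mat \<Rightarrow> real mat" where
  "real_mat \<equiv> map_mat real_of_rat"

end

theory Submission
  imports Defs
begin

text \<open>
  By the Cook-Levin argument it suffices to treat satisfiability. A formula is turned into a graph on
  \<open>m\<close> vertices and a number \<open>k\<close> such that the vertices can be partitioned into \<open>k\<close> independent sets if
  the formula is satisfiable, whereas otherwise every independent set has fewer than \<open>m / k\<close> vertices: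
  the colours in a constraint satisfaction problem that is invariant under a common shift of all
  colours give the \<open>k\<close> independent sets.

  A matrix has a coordinate for every vertex, with zeros for adjacent vertices, and a gadget
  coordinate for every pair of vertices. The gadgets use a fixed share of the total weight and
  absorb the unknown correlations of nonadjacent vertices, so that a convex combination amounts to a
  fractional covering of the vertices by independent sets. An additional vertex takes up the
  remaining weight. If it is adjacent to all others, a convex combination exists only if the
  covering has weight \<open>k\<close>. If it is isolated, a convex combination always exists, but since
  every gadget requires two generators, one with few generators uses only \<open>k\<close> independent sets. The map
  \<open>x \<mapsto> 1 - 2 x\<close>, with one more coordinate equal to 1, transfers everything to the cut polytope.

  The reductions are computed by counter programs with polynomially bounded counters, in which a
  head position of a Turing machine serves as a counter; the Cook-Levin clauses follow the tape
  contents relative to the heads and are Horn clauses except for the choice of the witness.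
\<close>

section \<open>Counter programs\<close>

text \<open>Weights are counted in units of \<open>1 / D\<close>. The gadgets take 2 units each; the
  remaining \<open>m\<close> units must cover every original vertex once and the additional vertex
  \<open>m - k\<close> times. If that vertex is adjacent to all others, only \<open>k\<close> units
  are left for sets with original vertices, so one of these sets has at least \<open>m / k\<close>
  vertices. If it is isolated, counting generators takes over: a set with an original vertex weighs
  at most one unit, and \<open>m > k + 1\<close>, so \<open>k + 1\<close> sets cannot all contain
  original vertices; one is spent on the additional vertex, and the other \<open>k\<close> are too
  few unless one has at least \<open>m / k\<close> vertices. Either way only a single large
  independent set is obtained, which is weaker than a colouring. The graph must therefore be such
  that one independent set of size \<open>m / k\<close> already yields a satisfying assignment,
  while an assignment yields \<open>k\<close> disjoint ones; the shifts supply the second half. All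
  numbers in the instances are polynomially bounded in value, not only in length, and this is what
  allows unary counters.\<close>

datatype instr = Inc nat | Dec nat | Push bool | Jump int | Branch nat nat int

type_synonym counters = "nat \<Rightarrow> nat"

type_synonym cstate = "counters \<times> bool list"

text \<open>The marker 3 differs from the blank and from the bits, so reading one symbol serves both
  as test for zero and as access to the input. As the marker occupies cell 0, input bit
  \<open>i - 1\<close> stands in cell \<open>i\<close>.\<close>

definition content :: "bool list \<Rightarrow> nat \<Rightarrow> nat \<Rightarrow> nat" where
  "content x r i =
     (if i = 0 then 3 else if r = 0 \<and> i \<le> length x then bit_symbol (x ! (i - 1)) else 0)"

fun instr_step :: "bool list \<Rightarrow> instr \<Rightarrow> nat \<times> cstate \<Rightarrow> nat \<times> cstate" where
  "instr_step x (Inc r) (pc, s, y) = (Suc pc, s(r := Suc (s r)), y)"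
| "instr_step x (Dec r) (pc, s, y) = (Suc pc, s(r := s r - 1), y)"
| "instr_step x (Push b) (pc, s, y) = (Suc pc, s, b # y)"
| "instr_step x (Jump e) (pc, s, y) = (nat (int pc + e), s, y)"
| "instr_step x (Branch r a e) (pc, s, y) =
     (if content x r (s r) = a then nat (int pc + e) else Suc pc, s, y)"

definition code_step :: "bool list \<Rightarrow> instr list \<Rightarrow> nat \<times> cstate \<Rightarrow> nat \<times> cstate" where
  "code_step x C c = (if fst c < length C then instr_step x (C ! fst c) c else c)"

text \<open>Execution of a code fragment inside an arbitrary program, entered at its first and left
  behind its last instruction.\<close>

definition runs :: "bool list \<Rightarrow> instr list \<Rightarrow> cstate \<Rightarrow> nat \<Rightarrow> cstate \<Rightarrow> bool" where
  "runs x C s T s' \<longleftrightarrow>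
     (\<exists>t\<le>T. \<forall>pre post. (code_step x (pre @ C @ post) ^^ t) (length pre, s) = (length pre + length C, s'))"

lemma runs_mono: "runs x C s T s' \<Longrightarrow> T \<le> T' \<Longrightarrow> runs x C s T' s'"
  unfolding runs_def by (meson order_trans)

lemma runs_Nil: "runs x [] s 0 s"
  by (simp add: runs_def)

lemma runs_append:
  assumes "runs x C s T s'" "runs x D s' U s''"
  shows "runs x (C @ D) s (T + U) s''"
proof -
  obtain t where t: "t \<le> T" "\<And>pre post. (code_step x (pre @ C @ post) ^^ t) (length pre, s) = (length pre + length C, s')"
    using assms(1) unfolding runs_def by blast
  obtain u where u: "u \<le> U" "\<And>pre post. (code_step x (pre @ D @ post) ^^ u) (length pre, s') = (length pre + length D, s'')"
    using assms(2) unfolding runs_def by blast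
  have "(code_step x (pre @ (C @ D) @ post) ^^ (u + t)) (length pre, s) = (length pre + length (C @ D), s'')"
    for pre post
    using t(2)[of pre "D @ post"] u(2)[of "pre @ C" post] by (simp add: funpow_add add.assoc)
  then show ?thesis
    unfolding runs_def using t(1) u(1) by (intro exI[of _ "u + t"]) auto
qed

lemma runs_single:
  assumes "\<And>pc. instr_step x i (pc, s) = (Suc pc, s')"
  shows "runs x [i] s 1 s'"
  unfolding runs_def using assms by (intro exI[of _ 1]) (auto simp: code_step_def nth_append)

lemma runs_Inc: "runs x [Inc r] (s, y) 1 (s(r := Suc (s r)), y)"
  and runs_Dec: "runs x [Dec r] (s, y) 1 (s(r := s r - 1), y)"
  and runs_Push: "runs x [Push b] (s, y) 1 (s, b # y)"
  by (rule runs_single, simp)+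

text \<open>Symbol 3 marks position 0 of the counter tapes, so that a loop runs until its counter is 0.\<close>

definition loop_code :: "nat \<Rightarrow> instr list \<Rightarrow> instr list" where
  "loop_code r C = Branch r 3 (int (length C) + 2) # C @ [Jump (- int (length C) - 1)]"

lemma content_eq_3: "content x r i = 3 \<longleftrightarrow> i = 0"
  by (simp add: content_def bit_symbol_def)

lemma runs_loop_exit:
  assumes "s r = 0"
  shows "runs x (loop_code r C) (s, y) 1 (s, y)"
  unfolding runs_def using assms
  by (intro exI[of _ 1]) (auto simp: code_step_def nth_append loop_code_def content_eq_3)

lemma runs_loop_step:
  assumes "s r \<noteq> 0" and "runs x C (s, y) T (s', y')" and "runs x (loop_code r C) (s', y') U w"
  shows "runs x (loop_code r C) (s, y) (T + 2 + U) w"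
proof -
  obtain t where t: "t \<le> T" "\<And>pre post. (code_step x (pre @ C @ post) ^^ t) (length pre, s, y) = (length pre + length C, s', y')"
    using assms(2) unfolding runs_def by blast
  obtain u where u: "u \<le> U" "\<And>pre post. (code_step x (pre @ loop_code r C @ post) ^^ u) (length pre, s', y') = (length pre + length (loop_code r C), w)"
    using assms(3) unfolding runs_def by blast
  have "(code_step x (pre @ loop_code r C @ post) ^^ (u + (1 + (t + 1)))) (length pre, s, y) = (length pre + length (loop_code r C), w)" (is "(?f ^^ _) _ = _")
    for pre post
  proof -
    let ?f = "code_step x (pre @ loop_code r C @ post)"
    have 1: "(?f ^^ 1) (length pre, s, y) = (Suc (length pre), s, y)"
      using assms(1) by (simp add: code_step_def loop_code_def content_eq_3)
    have 2: "(?f ^^ t) (Suc (length pre), s, y) = (Suc (length pre) + length C, s', y')"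
      using t(2)[of "pre @ [Branch r 3 (int (length C) + 2)]" "Jump (- int (length C) - 1) # post"]
      by (simp add: loop_code_def)
    have 3: "(?f ^^ 1) (Suc (length pre) + length C, s', y') = (length pre, s', y')"
      by (simp add: code_step_def loop_code_def nth_append)
    show ?thesis
      unfolding funpow_add comp_apply 1 2 3 by (rule u(2))
  qed
  then show ?thesis
    unfolding runs_def using t(1) u(1) by (intro exI[of _ "u + (1 + (t + 1))"]) auto
qed

lemma runs_loop:
  assumes "\<And>i. i < n \<Longrightarrow> fst (st i) r \<noteq> 0" and "fst (st n) r = 0"
    and "\<And>i. i < n \<Longrightarrow> runs x C (st i) T (st (Suc i))"
  shows "runs x (loop_code r C) (st 0) (n * (T + 2) + 1) (st n)"
  using assms
proof (induction n arbitrary: st)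
  case 0
  then show ?case using runs_loop_exit by (cases "st 0") auto
next
  case (Suc n)
  have "runs x (loop_code r C) (st (Suc 0)) (n * (T + 2) + 1) (st (Suc n))"
    using Suc.prems by (intro Suc.IH[of "\<lambda>i. st (Suc i)"]) auto
  moreover have "fst (st 0) r \<noteq> 0" "runs x C (st 0) T (st (Suc 0))"
    using Suc.prems by auto
  ultimately have "runs x (loop_code r C) (st 0) (T + 2 + (n * (T + 2) + 1)) (st (Suc n))"
    by (metis prod.collapse runs_loop_step)
  then show ?case by (rule runs_mono) simp
qed

text \<open>The guard is a branch over the fragment, which therefore runs unless the symbol under the
  head is \<open>a\<close>.\<close>

definition unless_code :: "nat \<Rightarrow> nat \<Rightarrow> instr list \<Rightarrow> instr list" where
  "unless_code r a C = Branch r a (int (length C) + 1) # C"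

lemma runs_unless_skip:
  assumes "content x r (s r) = a"
  shows "runs x (unless_code r a C) (s, y) 1 (s, y)"
  unfolding runs_def using assms
  by (intro exI[of _ 1]) (auto simp: code_step_def nth_append unless_code_def)

lemma runs_unless:
  assumes "content x r (s r) \<noteq> a" and "runs x C (s, y) T w"
  shows "runs x (unless_code r a C) (s, y) (T + 1) w"
proof -
  obtain t where t: "t \<le> T" "\<And>pre post. (code_step x (pre @ C @ post) ^^ t) (length pre, s, y) = (length pre + length C, w)"
    using assms(2) unfolding runs_def by blast
  have "(code_step x (pre @ unless_code r a C @ post) ^^ (t + 1)) (length pre, s, y) = (length pre + length (unless_code r a C), w)" 
    for pre post
  proof -
    let ?f = "code_step x (pre @ unless_code r a C @ post)"
    have 1: "(?f ^^ 1) (length pre, s, y) = (Suc (length pre), s, y)"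
      using assms(1) by (simp add: code_step_def unless_code_def)
    have 2: "(?f ^^ t) (Suc (length pre), s, y) = (Suc (length pre) + length C, w)"
      using t(2)[of "pre @ [Branch r a (int (length C) + 1)]" "post"]
      by (simp add: unless_code_def)
    show ?thesis
      unfolding funpow_add comp_apply 1 2 by (simp add: unless_code_def)
  qed
  then show ?thesis
    unfolding runs_def using t(1) by (intro exI[of _ "t + 1"]) auto
qed

section \<open>Functions computed by counter programs in polynomial time\<close>

lemma poly_nat_mono: "a \<le> b \<Longrightarrow> poly (p :: nat poly) a \<le> poly p b"
  by (induction p) (auto intro: add_mono mult_mono)

text \<open>One number bounds the input length and all variables, so that running times are
  polynomials in a single argument; binding a variable enlarges \<open>B\<close>.\<close>

definition fits :: "bool list \<Rightarrow> (nat \<Rightarrow> nat) \<Rightarrow> nat \<Rightarrow> bool" where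
  "fits x \<sigma> B \<longleftrightarrow> length x \<le> B \<and> (\<forall>y. \<sigma> y \<le> B)"

text \<open>A state matches an environment \<open>\<sigma>\<close> if the counter \<open>\<rho> y\<close> holds the value of the variable \<open>y\<close>;
  the counters from \<open>d\<close> on are free, and counter 0, the input pointer, is at rest,
  and counter 1 holds the length of the input.\<close>

definition matches :: "(nat \<Rightarrow> nat) \<Rightarrow> nat \<Rightarrow> bool list \<Rightarrow> (nat \<Rightarrow> nat) \<Rightarrow> counters \<Rightarrow> bool" where
  "matches \<rho> d x \<sigma> s \<longleftrightarrow>
     (\<forall>y. s (\<rho> y) = \<sigma> y) \<and> s 0 = 0 \<and> s 1 = length x \<and> (\<forall>r\<ge>d. s r = 0)"

text \<open>Counter 0 is excluded because the input pointer has to rest at 0. Variables may share a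
  counter: at the start of a program all of them are read from counter 1.\<close>

definition below :: "(nat \<Rightarrow> nat) \<Rightarrow> nat \<Rightarrow> bool" where
  "below \<rho> d \<longleftrightarrow> 1 < d \<and> (\<forall>y. 0 < \<rho> y \<and> \<rho> y < d)"

definition num_code :: "(nat \<Rightarrow> nat) \<Rightarrow> nat \<Rightarrow> (bool list \<Rightarrow> (nat \<Rightarrow> nat) \<Rightarrow> nat) \<Rightarrow> instr list \<Rightarrow> nat poly \<Rightarrow> bool" where
  "num_code \<rho> d f C p \<longleftrightarrow>
     (\<forall>x \<sigma> B s z. fits x \<sigma> B \<longrightarrow> matches \<rho> d x \<sigma> s \<longrightarrow>
        runs x C (s, z) (poly p B) (s(d := f x \<sigma>), z))"

text \<open>The first condition provides fresh variables, the second one bounds the loops over a computed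
  range.\<close>

definition pt_num :: "(bool list \<Rightarrow> (nat \<Rightarrow> nat) \<Rightarrow> nat) \<Rightarrow> bool" where
  "pt_num f \<longleftrightarrow>
     (\<exists>K. \<forall>x \<sigma> y v. K \<le> y \<longrightarrow> f x (\<sigma>(y := v)) = f x \<sigma>) \<and>
     (\<exists>p :: nat poly. \<forall>x \<sigma> B. fits x \<sigma> B \<longrightarrow> f x \<sigma> \<le> poly p B) \<and>
     (\<forall>\<rho> d. below \<rho> d \<longrightarrow> (\<exists>C p. num_code \<rho> d f C p))"

text \<open>Output is produced from its end: concatenations run from right to left and loops count down.\<close>

definition out_code :: "(nat \<Rightarrow> nat) \<Rightarrow> nat \<Rightarrow> (bool list \<Rightarrow> (nat \<Rightarrow> nat) \<Rightarrow> bool list) \<Rightarrow> instr list \<Rightarrow> nat poly \<Rightarrow> bool" where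
  "out_code \<rho> d g C p \<longleftrightarrow>
     (\<forall>x \<sigma> B s z. fits x \<sigma> B \<longrightarrow> matches \<rho> d x \<sigma> s \<longrightarrow>
        runs x C (s, z) (poly p B) (s, g x \<sigma> @ z))"

definition pt_out :: "(bool list \<Rightarrow> (nat \<Rightarrow> nat) \<Rightarrow> bool list) \<Rightarrow> bool" where
  "pt_out g \<longleftrightarrow> (\<forall>\<rho> d. below \<rho> d \<longrightarrow> (\<exists>C p. out_code \<rho> d g C p))"

lemma pt_num_boundD: "pt_num f \<Longrightarrow> \<exists>p :: nat poly. \<forall>x \<sigma> B. fits x \<sigma> B \<longrightarrow> f x \<sigma> \<le> poly p B"
  and pt_num_codeD: "pt_num f \<Longrightarrow> below \<rho> d \<Longrightarrow> \<exists>C p. num_code \<rho> d f C p"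
  and pt_out_codeD: "pt_out g \<Longrightarrow> below \<rho> d \<Longrightarrow> \<exists>C p. out_code \<rho> d g C p"
  by (simp_all add: pt_num_def pt_out_def)

lemma below_pos: "below \<rho> d \<Longrightarrow> 1 < d"
  by (auto simp: below_def)

lemma below_Suc: "below \<rho> d \<Longrightarrow> below \<rho> (Suc d)"
  by (simp add: below_def less_SucI)

lemma below_upd: "below \<rho> d \<Longrightarrow> 0 < r \<Longrightarrow> r < e \<Longrightarrow> d \<le> e \<Longrightarrow> below (\<rho>(y := r)) e"
  unfolding below_def by (auto intro: order_less_le_trans)

lemma matches_above:
  "matches \<rho> d x \<sigma> s \<Longrightarrow> below \<rho> d \<Longrightarrow> matches \<rho> (Suc d) x \<sigma> (s(d := v))"
  using below_pos[of \<rho> d] by (auto simp: matches_def below_def)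

lemma matches_bind:
  "matches \<rho> d x \<sigma> s \<Longrightarrow> below \<rho> d \<Longrightarrow> matches (\<rho>(y := d)) (Suc d) x (\<sigma>(y := v)) (s(d := v))"
  using below_pos[of \<rho> d] by (auto simp: matches_def below_def)

lemma fits_bind: "fits x \<sigma> B \<Longrightarrow> v \<le> C \<Longrightarrow> fits x (\<sigma>(y := v)) (B + C)"
  by (auto simp: fits_def trans_le_add1)

section \<open>Moving, subtracting and clearing counters\<close>

lemma runs_move:
  assumes "r \<noteq> a"
  shows "runs x (loop_code r [Dec r, Inc a]) (s, z) (4 * s r + 1) (s(r := 0, a := s a + s r), z)"
proof -
  let ?st = "\<lambda>i. (s(r := s r - i, a := s a + i), z)"
  have "runs x [Dec r, Inc a] (?st i) (1 + 1) (?st (Suc i))" for i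
    using runs_append[OF runs_Dec[of x r "fst (?st i)" z] runs_Inc[of x a _ z]] assms
    by (simp add: fun_upd_twist)
  then have "runs x (loop_code r [Dec r, Inc a]) (?st 0) (s r * ((1 + 1) + 2) + 1) (?st (s r))"
    using assms by (intro runs_loop[where st = ?st]) auto
  then show ?thesis
    by (simp add: numeral_eq_Suc)
qed

lemma runs_move2:
  assumes "r \<noteq> a" "r \<noteq> b" "a \<noteq> b"
  shows "runs x (loop_code r [Dec r, Inc a, Inc b]) (s, z) (5 * s r + 1)
           (s(r := 0, a := s a + s r, b := s b + s r), z)"
proof -
  let ?st = "\<lambda>i. (s(r := s r - i, a := s a + i, b := s b + i), z)"
  have "runs x [Dec r, Inc a, Inc b] (?st i) (1 + (1 + 1)) (?st (Suc i))" for i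
    using runs_append[OF runs_Dec[of x r "fst (?st i)" z]
        runs_append[OF runs_Inc[of x a _ z] runs_Inc[of x b _ z]]] assms
    by (simp add: fun_upd_twist)
  then have "runs x (loop_code r [Dec r, Inc a, Inc b]) (?st 0) (s r * ((1 + (1 + 1)) + 2) + 1) (?st (s r))"
    using assms by (intro runs_loop[where st = ?st]) auto
  then show ?thesis
    by (simp add: numeral_eq_Suc)
qed

lemma runs_monus:
  assumes "r \<noteq> a"
  shows "runs x (loop_code r [Dec r, Dec a]) (s, z) (4 * s r + 1) (s(r := 0, a := s a - s r), z)"
proof -
  let ?st = "\<lambda>i. (s(r := s r - i, a := s a - i), z)"
  have "runs x [Dec r, Dec a] (?st i) (1 + 1) (?st (Suc i))" for i
    using runs_append[OF runs_Dec[of x r "fst (?st i)" z] runs_Dec[of x a _ z]] assms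
    by (simp add: fun_upd_twist)
  then have "runs x (loop_code r [Dec r, Dec a]) (?st 0) (s r * ((1 + 1) + 2) + 1) (?st (s r))"
    using assms by (intro runs_loop[where st = ?st]) auto
  then show ?thesis
    by (simp add: numeral_eq_Suc)
qed

lemma runs_clear: "runs x (loop_code r [Dec r]) (s, z) (3 * s r + 1) (s(r := 0), z)"
proof -
  let ?st = "\<lambda>i. (s(r := s r - i), z)"
  have "runs x [Dec r] (?st i) 1 (?st (Suc i))" for i
    using runs_Dec[of x r "fst (?st i)" z] by simp
  then have "runs x (loop_code r [Dec r]) (?st 0) (s r * (1 + 2) + 1) (?st (s r))"
    by (intro runs_loop[where st = ?st]) auto
  then show ?thesis
    by (simp add: numeral_eq_Suc)
qed

section \<open>Computable numbers: constants, variables, arithmetic, input bits, bounded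
  sums\<close>

lemma pt_num_const: "pt_num (\<lambda>x \<sigma>. c)"
proof -
  have code: "runs x (replicate c (Inc d)) (s, z) c (s(d := s d + c), z)" for x d s z
  proof (induction c arbitrary: s)
    case 0
    then show ?case using runs_Nil by simp
  next
    case (Suc c)
    then show ?case
      using runs_append[OF runs_Inc[of x d s z] Suc.IH] by (simp add: fun_upd_def cong: if_cong)
  qed
  have "num_code \<rho> d (\<lambda>x \<sigma>. c) (replicate c (Inc d)) [:c:]" for \<rho> d
    unfolding num_code_def
  proof (intro allI impI)
    fix x \<sigma> B s z
    assume "matches \<rho> d x \<sigma> s"
    then show "runs x (replicate c (Inc d)) (s, z) (poly [:c:] B) (s(d := c), z)"
      using code[of x d s z] by (simp add: matches_def)
  qed
  moreover have "\<exists>p :: nat poly. \<forall>x \<sigma> B. fits x \<sigma> B \<longrightarrow> c \<le> poly p B"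
    by (intro exI[of _ "[:c:]"]) simp
  ultimately show ?thesis
    unfolding pt_num_def by blast
qed

text \<open>Moving a counter empties it, so the value is moved to two free counters at once and then
  brought back from one of them.\<close>

definition copy_code :: "nat \<Rightarrow> nat \<Rightarrow> instr list" where
  "copy_code r d = loop_code r [Dec r, Inc d, Inc (Suc d)] @ loop_code (Suc d) [Dec (Suc d), Inc r]"

lemma runs_copy:
  assumes "r < d" "s d = 0" "s (Suc d) = 0" "s r \<le> B"
  shows "runs x (copy_code r d) (s, z) (poly [:2, 9:] B) (s(d := s r), z)"
proof -
  have ne: "r \<noteq> d" "r \<noteq> Suc d"
    using assms by auto
  define s1 where "s1 = s(r := 0, d := s r, Suc d := s r)"
  have "runs x (loop_code r [Dec r, Inc d, Inc (Suc d)]) (s, z) (5 * s r + 1) (s1, z)"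
    using runs_move2[OF ne, of x s z] assms by (simp add: s1_def)
  moreover have "runs x (loop_code (Suc d) [Dec (Suc d), Inc r]) (s1, z) (4 * s r + 1) (s(d := s r), z)"
  proof -
    have "s1(Suc d := 0, r := s1 r + s1 (Suc d)) = s(d := s r)"
      using ne assms by (auto simp: s1_def fun_eq_iff)
    then show ?thesis
      using runs_move[of "Suc d" r x s1 z] ne by (simp add: s1_def)
  qed
  ultimately have "runs x (copy_code r d) (s, z) (5 * s r + 1 + (4 * s r + 1)) (s(d := s r), z)"
    unfolding copy_code_def by (rule runs_append)
  then show ?thesis
    by (rule runs_mono) (use assms in simp)
qed

lemma pt_num_var: "pt_num (\<lambda>x \<sigma>. \<sigma> y)"
  unfolding pt_num_def
proof (intro conjI allI impI)
  show "\<exists>K. \<forall>x \<sigma> y' v. K \<le> y' \<longrightarrow> (\<sigma>(y' := v)) y = \<sigma> y"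
    by (intro exI[of _ "Suc y"]) auto
  show "\<exists>p :: nat poly. \<forall>(x :: bool list) \<sigma> B. fits x \<sigma> B \<longrightarrow> \<sigma> y \<le> poly p B"
    by (intro exI[of _ "[:0, 1:]"]) (auto simp: fits_def)
  fix \<rho> d
  assume d: "below \<rho> d"
  have "runs x (copy_code (\<rho> y) d) (s, z) (poly [:2, 9:] B) (s(d := \<sigma> y), z)"
    if "fits x \<sigma> B" "matches \<rho> d x \<sigma> s" for x \<sigma> B s z
    using runs_copy[of "\<rho> y" d s B x z] that d by (simp add: below_def matches_def fits_def)
  then show "\<exists>C p. num_code \<rho> d (\<lambda>x \<sigma>. \<sigma> y) C p"
    unfolding num_code_def by blast
qed

lemma pt_num_length: "pt_num (\<lambda>x \<sigma>. length x)"
  unfolding pt_num_def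
proof (intro conjI allI impI)
  show "\<exists>p :: nat poly. \<forall>(x :: bool list) \<sigma> B. fits x \<sigma> B \<longrightarrow> length x \<le> poly p B"
    by (intro exI[of _ "[:0, 1:]"]) (auto simp: fits_def)
  fix \<rho> d
  assume d: "below \<rho> d"
  have "runs x (copy_code 1 d) (s, z) (poly [:2, 9:] B) (s(d := length x), z)"
    if "fits x \<sigma> B" "matches \<rho> d x \<sigma> s" for x \<sigma> B s z
    using runs_copy[of 1 d s B x z] that d by (simp add: below_def matches_def fits_def)
  then show "\<exists>C p. num_code \<rho> d (\<lambda>x \<sigma>. length x) C p"
    unfolding num_code_def by blast
qed simp

lemma num_code_two:
  assumes "pt_num f" "pt_num g" "below \<rho> d"
  obtains C p where
    "\<And>x \<sigma> B s z. fits x \<sigma> B \<Longrightarrow> matches \<rho> d x \<sigma> s \<Longrightarrow>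
       runs x C (s, z) (poly p B) (s(d := f x \<sigma>, Suc d := g x \<sigma>), z)"
proof -
  obtain C p D q where C: "num_code \<rho> d f C p" and D: "num_code \<rho> (Suc d) g D q"
    using pt_num_codeD[OF assms(1,3)] pt_num_codeD[OF assms(2) below_Suc[OF assms(3)]] by blast
  have "runs x (C @ D) (s, z) (poly (p + q) B) (s(d := f x \<sigma>, Suc d := g x \<sigma>), z)"
    if "fits x \<sigma> B" "matches \<rho> d x \<sigma> s" for x \<sigma> B s z
  proof -
    have "runs x C (s, z) (poly p B) (s(d := f x \<sigma>), z)"
      "runs x D (s(d := f x \<sigma>), z) (poly q B) (s(d := f x \<sigma>, Suc d := g x \<sigma>), z)"
      using that C D matches_above[OF that(2) assms(3)] by (auto simp: num_code_def)
    then show ?thesis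
      unfolding poly_add by (rule runs_append)
  qed
  then show ?thesis
    by (rule that)
qed

lemma support_two:
  assumes "pt_num f" "pt_num g"
  obtains K where "\<And>x \<sigma> y v. K \<le> y \<Longrightarrow> f x (\<sigma>(y := v)) = f x \<sigma>"
    "\<And>x \<sigma> y v. K \<le> y \<Longrightarrow> g x (\<sigma>(y := v)) = g x \<sigma>"
proof -
  obtain K L where K: "\<And>x \<sigma> y v. K \<le> y \<Longrightarrow> f x (\<sigma>(y := v)) = f x \<sigma>"
    "\<And>x \<sigma> y v. L \<le> y \<Longrightarrow> g x (\<sigma>(y := v)) = g x \<sigma>"
    using assms unfolding pt_num_def by metis
  show ?thesis
    using that[of "max K L"] K by simp
qed

text \<open>Serves addition and truncated subtraction: both use up the second operand unit by unit
  while changing the first one in place, which gives the common time bound.\<close>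

lemma pt_num_binop:
  assumes f: "pt_num f" and g: "pt_num g"
    and op: "\<And>m n. op m n \<le> m + (n :: nat)"
    and run: "\<And>x d s z. runs x (E d) (s, z) (4 * s (Suc d) + 1) (s(d := op (s d) (s (Suc d)), Suc d := 0), z)"
  shows "pt_num (\<lambda>x \<sigma>. op (f x \<sigma>) (g x \<sigma>))"
  unfolding pt_num_def
proof (intro conjI allI impI)
  obtain K where "\<And>x \<sigma> y v. K \<le> y \<Longrightarrow> f x (\<sigma>(y := v)) = f x \<sigma>"
    "\<And>x \<sigma> y v. K \<le> y \<Longrightarrow> g x (\<sigma>(y := v)) = g x \<sigma>"
    using support_two[OF f g] by blast
  then show "\<exists>K. \<forall>x \<sigma> y v. K \<le> y \<longrightarrow> op (f x (\<sigma>(y := v))) (g x (\<sigma>(y := v))) = op (f x \<sigma>) (g x \<sigma>)"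
    by metis
  obtain p q where pq: "\<forall>x \<sigma> B. fits x \<sigma> B \<longrightarrow> f x \<sigma> \<le> poly p B" "\<forall>x \<sigma> B. fits x \<sigma> B \<longrightarrow> g x \<sigma> \<le> poly q B"
    using pt_num_boundD[OF f] pt_num_boundD[OF g] by blast
  then have "\<forall>x \<sigma> B. fits x \<sigma> B \<longrightarrow> op (f x \<sigma>) (g x \<sigma>) \<le> poly (p + q) B"
    unfolding poly_add by (meson add_mono op order_trans)
  then show "\<exists>p :: nat poly. \<forall>x \<sigma> B. fits x \<sigma> B \<longrightarrow> op (f x \<sigma>) (g x \<sigma>) \<le> poly p B"
    by blast
  fix \<rho> d
  assume d: "below \<rho> d"
  obtain C r where C: "\<And>x \<sigma> B s z. fits x \<sigma> B \<Longrightarrow> matches \<rho> d x \<sigma> s \<Longrightarrow>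
       runs x C (s, z) (poly r B) (s(d := f x \<sigma>, Suc d := g x \<sigma>), z)"
    using num_code_two[OF f g d] by blast
  have "runs x (C @ E d) (s, z) (poly (r + smult 4 q + 1) B) (s(d := op (f x \<sigma>) (g x \<sigma>)), z)"
    if B: "fits x \<sigma> B" and s: "matches \<rho> d x \<sigma> s" for x \<sigma> B s z
  proof -
    have eq: "s(d := op (f x \<sigma>) (g x \<sigma>), Suc d := 0) = s(d := op (f x \<sigma>) (g x \<sigma>))"
      using s by (auto simp: matches_def fun_eq_iff)
    have "runs x (C @ E d) (s, z) (poly r B + (4 * g x \<sigma> + 1)) (s(d := op (f x \<sigma>) (g x \<sigma>), Suc d := 0), z)"
      using runs_append[OF C[OF B s, of z] run[of x d "s(d := f x \<sigma>, Suc d := g x \<sigma>)" z]]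
      by (simp add: fun_upd_twist)
    then show ?thesis
      unfolding eq by (rule runs_mono) (use pq(2) B in simp)
  qed
  then show "\<exists>C p. num_code \<rho> d (\<lambda>x \<sigma>. op (f x \<sigma>) (g x \<sigma>)) C p"
    unfolding num_code_def by blast
qed

lemma pt_num_add: "pt_num f \<Longrightarrow> pt_num g \<Longrightarrow> pt_num (\<lambda>x \<sigma>. f x \<sigma> + g x \<sigma>)"
  by (rule pt_num_binop[where E = "\<lambda>d. loop_code (Suc d) [Dec (Suc d), Inc d]"])
     (use runs_move[of "Suc d" d for d] in \<open>auto simp: fun_upd_twist\<close>)

lemma pt_num_sub: "pt_num f \<Longrightarrow> pt_num g \<Longrightarrow> pt_num (\<lambda>x \<sigma>. f x \<sigma> - g x \<sigma>)"
  by (rule pt_num_binop[where E = "\<lambda>d. loop_code (Suc d) [Dec (Suc d), Dec d]"])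
     (use runs_monus[of "Suc d" d for d] in \<open>auto simp: fun_upd_twist\<close>)

text \<open>The argument is moved into the input pointer, which then takes one more step because of
  the marker in cell 0. Counter \<open>d\<close> is set to 1 and decremented unless symbol 2 is
  read; behind the input the blank is read, so the result is 0 there.\<close>

lemma pt_num_bit:
  assumes f: "pt_num f"
  shows "pt_num (\<lambda>x \<sigma>. of_bool (f x \<sigma> < length x \<and> x ! f x \<sigma>))"
  unfolding pt_num_def
proof (intro conjI allI impI)
  show "\<exists>K. \<forall>x \<sigma> y v. K \<le> y \<longrightarrow> of_bool (f x (\<sigma>(y := v)) < length x \<and> x ! f x (\<sigma>(y := v))) = (of_bool (f x \<sigma> < length x \<and> x ! f x \<sigma>) :: nat)"
    using f unfolding pt_num_def by metis
  show "\<exists>p :: nat poly. \<forall>x \<sigma> B. fits x \<sigma> B \<longrightarrow> of_bool (f x \<sigma> < length x \<and> x ! f x \<sigma>) \<le> poly p B"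
    by (intro exI[of _ "1"]) auto
  obtain q where q: "\<forall>x \<sigma> B. fits x \<sigma> B \<longrightarrow> f x \<sigma> \<le> poly q B"
    using pt_num_boundD[OF f] by blast
  fix \<rho> d
  assume d: "below \<rho> d"
  obtain C p where C: "num_code \<rho> d f C p"
    using pt_num_codeD[OF f d] by blast
  let ?test = "unless_code 0 2 [Dec d]"
  define D where "D = C @ loop_code d [Dec d, Inc 0] @ [Inc 0] @ [Inc d] @ ?test @ loop_code 0 [Dec 0]"
  have "runs x D (s, z) (poly (p + smult 7 q + [:9:]) B) (s(d := of_bool (f x \<sigma> < length x \<and> x ! f x \<sigma>)), z)"
    if B: "fits x \<sigma> B" and s: "matches \<rho> d x \<sigma> s" for x \<sigma> B s z
  proof -
    let ?n = "f x \<sigma>"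
    let ?b = "of_bool (?n < length x \<and> x ! ?n) :: nat"
    have d0 [simp]: "d \<noteq> 0" "0 < d" "s d = 0" "s 0 = 0"
      using below_pos[OF d] s by (auto simp: matches_def)
    have 1: "runs x C (s, z) (poly p B) (s(d := ?n), z)"
      using C B s unfolding num_code_def by blast
    have 2: "runs x (loop_code d [Dec d, Inc 0]) (s(d := ?n), z) (4 * ?n + 1) (s(0 := ?n), z)"
      using runs_move[of d 0 x "s(d := ?n)" z] by (simp add: fun_upd_idem)
    have 3: "runs x [Inc 0] (s(0 := ?n), z) 1 (s(0 := Suc ?n), z)"
      using runs_Inc[of x 0 "s(0 := ?n)" z] by simp
    have 4: "runs x [Inc d] (s(0 := Suc ?n), z) 1 (s(0 := Suc ?n, d := 1), z)"
      using runs_Inc[of x d "s(0 := Suc ?n)" z] by simp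
    have 5: "runs x ?test (s(0 := Suc ?n, d := 1), z) 2 (s(0 := Suc ?n, d := ?b), z)"
    proof (cases "?n < length x \<and> x ! ?n")
      case True
      then have "content x 0 (Suc ?n) = 2"
        by (simp add: content_def bit_symbol_def)
      then show ?thesis
        using runs_mono[OF runs_unless_skip[of x 0 "s(0 := Suc ?n, d := 1)" 2 "[Dec d]" z], of 2] True
        by (simp add: numeral_2_eq_2)
    next
      case False
      then have "content x 0 (Suc ?n) \<noteq> 2"
        by (simp add: content_def bit_symbol_def)
      then show ?thesis
        using runs_unless[OF _ runs_Dec, of x 0 "s(0 := Suc ?n, d := 1)" 2 d z] False
        by (auto simp: numeral_2_eq_2)
    qed
    have eq: "s(0 := Suc ?n, d := ?b, 0 := 0) = s(d := ?b)"
      using d0 by (auto simp: fun_eq_iff)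
    have 6: "runs x (loop_code 0 [Dec 0]) (s(0 := Suc ?n, d := ?b), z) (3 * Suc ?n + 1) (s(d := ?b), z)"
      using runs_clear[of x 0 "s(0 := Suc ?n, d := ?b)" z] unfolding eq by simp
    have "runs x D (s, z) (poly p B + (4 * ?n + 1 + (1 + (1 + (2 + (3 * Suc ?n + 1)))))) (s(d := ?b), z)"
      unfolding D_def by (intro runs_append[OF 1] runs_append[OF 2] runs_append[OF 3] runs_append[OF 4] runs_append[OF 5] 6)
    moreover have "?n \<le> poly q B"
      using q B by blast
    ultimately show ?thesis
      by (elim runs_mono) simp
  qed
  then show "\<exists>C p. num_code \<rho> d (\<lambda>x \<sigma>. of_bool (f x \<sigma> < length x \<and> x ! f x \<sigma>)) C p"
    unfolding num_code_def by blast
qed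

text \<open>This is the only form of recursion: products, quotients and bounded quantifiers are all
  expressed as sums. Counter \<open>d\<close> accumulates, \<open>Suc d\<close> is at the same time
  loop counter and bound variable (hence it runs downwards), and the summand is computed in
  \<open>Suc (Suc d)\<close>.\<close>

lemma pt_num_sum:
  assumes f: "pt_num f" and g: "pt_num g"
  shows "pt_num (\<lambda>x \<sigma>. \<Sum>v<f x \<sigma>. g x (\<sigma>(y := v)))"
  unfolding pt_num_def
proof (intro conjI allI impI)
  obtain K where K: "\<And>x \<sigma> y v. K \<le> y \<Longrightarrow> f x (\<sigma>(y := v)) = f x \<sigma>"
    "\<And>x \<sigma> y v. K \<le> y \<Longrightarrow> g x (\<sigma>(y := v)) = g x \<sigma>"
    using support_two[OF f g] by blast
  have "g x (\<sigma>(y' := w, y := v)) = g x (\<sigma>(y := v))" if "K \<le> y'" for x \<sigma> y' w v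
    using K(2)[OF that, of x "\<sigma>(y := v)" w] by (cases "y' = y") (auto simp: fun_upd_twist)
  then have "\<forall>x \<sigma> y' w. K \<le> y' \<longrightarrow> (\<Sum>v<f x (\<sigma>(y' := w)). g x (\<sigma>(y' := w, y := v))) = (\<Sum>v<f x \<sigma>. g x (\<sigma>(y := v)))"
    using K(1) by simp
  then show "\<exists>K. \<forall>x \<sigma> y' w. K \<le> y' \<longrightarrow> (\<Sum>v<f x (\<sigma>(y' := w)). g x (\<sigma>(y' := w, y := v))) = (\<Sum>v<f x \<sigma>. g x (\<sigma>(y := v)))"
    by blast
  obtain pf pg where pf: "\<And>x \<sigma> B. fits x \<sigma> B \<Longrightarrow> f x \<sigma> \<le> poly pf B"
    and pg: "\<And>x \<sigma> B. fits x \<sigma> B \<Longrightarrow> g x \<sigma> \<le> poly pg B"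
    using pt_num_boundD[OF f] pt_num_boundD[OF g] by blast
  have fit: "fits x (\<sigma>(y := v)) (B + poly pf B)" if "fits x \<sigma> B" "v < f x \<sigma>" for x \<sigma> B v
    using that pf[OF that(1)] by (intro fits_bind) auto
  \<comment> \<open>The bound variable can exceed \<open>B\<close> but stays below the range, so
    bounds for the summand are taken at \<open>B + poly pf B\<close>.\<close>
  define R where "R = pcompose pg ([:0, 1:] + pf)"
  have R: "g x (\<sigma>(y := v)) \<le> poly R B" if "fits x \<sigma> B" "v < f x \<sigma>" for x \<sigma> B v
    using pg[OF fit[OF that]] by (simp add: R_def poly_pcompose)
  have "(\<Sum>v<f x \<sigma>. g x (\<sigma>(y := v))) \<le> poly (pf * R) B" if B: "fits x \<sigma> B" for x \<sigma> B
  proof -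
    have "(\<Sum>v<f x \<sigma>. g x (\<sigma>(y := v))) \<le> (\<Sum>v<f x \<sigma>. poly R B)"
      using R[OF B] by (intro sum_mono) auto
    also have "\<dots> \<le> poly pf B * poly R B"
      using pf[OF B] by simp
    finally show ?thesis by simp
  qed
  then show "\<exists>p :: nat poly. \<forall>x \<sigma> B. fits x \<sigma> B \<longrightarrow> (\<Sum>v<f x \<sigma>. g x (\<sigma>(y := v))) \<le> poly p B"
    by blast
  fix \<rho> d
  assume d: "below \<rho> d"
  define \<rho>' where "\<rho>' = \<rho>(y := Suc d)"
  have d': "below \<rho>' (Suc (Suc d))"
    unfolding \<rho>'_def using d by (rule below_upd) auto
  obtain C p D q where C: "num_code \<rho> (Suc d) f C p" and D: "num_code \<rho>' (Suc (Suc d)) g D q"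
    using pt_num_codeD[OF f below_Suc[OF d]] pt_num_codeD[OF g d'] by blast
  let ?add = "loop_code (Suc (Suc d)) [Dec (Suc (Suc d)), Inc d]"
  define E where "E = C @ loop_code (Suc d) ([Dec (Suc d)] @ D @ ?add)"
  define Q where "Q = pcompose q ([:0, 1:] + pf)"
  define W where "W = p + pf * (Q + smult 4 R + [:4:]) + 1"
  have "runs x E (s, z) (poly W B) (s(d := \<Sum>v<f x \<sigma>. g x (\<sigma>(y := v))), z)"
    if B: "fits x \<sigma> B" and s: "matches \<rho> d x \<sigma> s" for x \<sigma> B s z
  proof -
    let ?n = "f x \<sigma>"
    define acc where "acc i = (\<Sum>v\<in>{?n - i..<?n}. g x (\<sigma>(y := v)))" for i
    let ?st = "\<lambda>i. (s(d := acc i, Suc d := ?n - i), z)"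
    have s0: "s(d := u) = s" if "u = 0" for u
      using s that by (auto simp: matches_def)
    have "matches \<rho> (Suc d) x \<sigma> (s(d := 0))"
      using matches_above[OF s d] .
    then have 1: "runs x C (s, z) (poly p B) (?st 0)"
      using C B unfolding num_code_def by (simp add: acc_def s0)
    have 2: "runs x ([Dec (Suc d)] @ D @ ?add) (?st i) (poly Q B + 4 * poly R B + 2) (?st (Suc i))" if "i < ?n" for i
    proof -
      define v where "v = ?n - Suc i"
      have v: "?n - i = Suc v" "v < ?n"
        using that by (auto simp: v_def)
      have "{v..<?n} = insert v {Suc v..<?n}"
        using v by auto
      then have acc: "acc (Suc i) = g x (\<sigma>(y := v)) + acc i"
        unfolding acc_def v_def[symmetric] v(1) by simp
      let ?s = "s(d := acc i, Suc d := v)"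
      have "matches \<rho>' (Suc (Suc d)) x (\<sigma>(y := v)) ?s"
        unfolding \<rho>'_def using matches_bind[OF matches_above[OF s d] below_Suc[OF d]] by blast
      then have "runs x D (?s, z) (poly Q B) (?s(Suc (Suc d) := g x (\<sigma>(y := v))), z)"
        using D fit[OF B v(2)] unfolding num_code_def Q_def by (simp add: poly_pcompose)
      moreover have "runs x [Dec (Suc d)] (?st i) 1 (?s, z)"
        using runs_Dec[of x "Suc d" "fst (?st i)" z] v by simp
      moreover have "runs x ?add (?s(Suc (Suc d) := g x (\<sigma>(y := v))), z) (4 * poly R B + 1) (?st (Suc i))"
      proof -
        have "?s(Suc (Suc d) := 0, d := acc (Suc i)) = s(d := acc (Suc i), Suc d := v)"
          using s by (auto simp: matches_def fun_eq_iff)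
        then have "runs x ?add (?s(Suc (Suc d) := g x (\<sigma>(y := v))), z) (4 * g x (\<sigma>(y := v)) + 1) (?st (Suc i))"
          using runs_move[of "Suc (Suc d)" d x "?s(Suc (Suc d) := g x (\<sigma>(y := v)))" z] acc
          by (simp add: v_def add.commute)
        then show ?thesis
          by (rule runs_mono) (use R[OF B v(2)] in simp)
      qed
      ultimately have "runs x ([Dec (Suc d)] @ D @ ?add) (?st i) (1 + (poly Q B + (4 * poly R B + 1))) (?st (Suc i))"
        by (intro runs_append)
      then show ?thesis by simp
    qed
    have "runs x (loop_code (Suc d) ([Dec (Suc d)] @ D @ ?add)) (?st 0) (?n * (poly Q B + 4 * poly R B + 2 + 2) + 1) (?st ?n)"
      using 2 by (intro runs_loop[where st = ?st]) auto
    moreover have "?st ?n = (s(d := \<Sum>v<?n. g x (\<sigma>(y := v))), z)"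
      using s by (auto simp: acc_def matches_def fun_eq_iff lessThan_atLeast0)
    ultimately have "runs x E (s, z) (poly p B + (?n * (poly Q B + 4 * poly R B + 2 + 2) + 1)) (s(d := \<Sum>v<?n. g x (\<sigma>(y := v))), z)"
      unfolding E_def by (intro runs_append[OF 1]) simp
    then show ?thesis
    proof (rule runs_mono)
      have "?n * (poly Q B + 4 * poly R B + 4) \<le> poly pf B * (poly Q B + 4 * poly R B + 4)"
        by (rule mult_right_mono[OF pf[OF B]]) simp
      then show "poly p B + (?n * (poly Q B + 4 * poly R B + 2 + 2) + 1) \<le> poly W B"
        by (simp add: W_def algebra_simps)
    qed
  qed
  then show "\<exists>C p. num_code \<rho> d (\<lambda>x \<sigma>. \<Sum>v<f x \<sigma>. g x (\<sigma>(y := v))) C p"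
    unfolding num_code_def by blast
qed

section \<open>Computable output: concatenation, conditionals, loops\<close>

lemma pt_out_Nil: "pt_out (\<lambda>x \<sigma>. [])"
proof -
  have "out_code \<rho> d (\<lambda>x \<sigma>. []) [] 0" for \<rho> d
    by (simp add: out_code_def runs_Nil)
  then show ?thesis unfolding pt_out_def by blast
qed

lemma pt_out_append:
  assumes "pt_out g" "pt_out h"
  shows "pt_out (\<lambda>x \<sigma>. g x \<sigma> @ h x \<sigma>)"
  unfolding pt_out_def
proof (intro allI impI)
  fix \<rho> d
  assume d: "below \<rho> d"
  obtain C p D q where C: "out_code \<rho> d g C p" "out_code \<rho> d h D q"
    using pt_out_codeD[OF assms(1) d] pt_out_codeD[OF assms(2) d] by blast
  have "out_code \<rho> d (\<lambda>x \<sigma>. g x \<sigma> @ h x \<sigma>) (D @ C) (q + p)"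
    unfolding out_code_def poly_add
  proof (intro allI impI)
    fix x \<sigma> B s z
    assume "fits x \<sigma> B" "matches \<rho> d x \<sigma> s"
    then have "runs x D (s, z) (poly q B) (s, h x \<sigma> @ z)" "runs x C (s, h x \<sigma> @ z) (poly p B) (s, g x \<sigma> @ h x \<sigma> @ z)"
      using C unfolding out_code_def by auto
    then show "runs x (D @ C) (s, z) (poly q B + poly p B) (s, (g x \<sigma> @ h x \<sigma>) @ z)"
      by (simp add: runs_append)
  qed
  then show "\<exists>C p. out_code \<rho> d (\<lambda>x \<sigma>. g x \<sigma> @ h x \<sigma>) C p"
    by blast
qed

lemma pt_out_Cons:
  assumes "pt_out g"
  shows "pt_out (\<lambda>x \<sigma>. b # g x \<sigma>)"
proof -
  have "out_code \<rho> d (\<lambda>x \<sigma>. [b]) [Push b] 1" for \<rho> d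
    unfolding out_code_def using runs_Push by simp
  then have "pt_out (\<lambda>x \<sigma>. [b])"
    unfolding pt_out_def by blast
  from pt_out_append[OF this assms] show ?thesis by simp
qed

lemma pt_out_when:
  assumes f: "pt_num f" and g: "pt_out g"
  shows "pt_out (\<lambda>x \<sigma>. if f x \<sigma> \<noteq> 0 then g x \<sigma> else [])"
  unfolding pt_out_def
proof (intro allI impI)
  obtain pf where pf: "\<And>x \<sigma> B. fits x \<sigma> B \<Longrightarrow> f x \<sigma> \<le> poly pf B"
    using pt_num_boundD[OF f] by blast
  fix \<rho> d
  assume d: "below \<rho> d"
  obtain C p D q where C: "num_code \<rho> d f C p" and D: "out_code \<rho> d g D q"
    using pt_num_codeD[OF f d] pt_out_codeD[OF g d] by blast
  define E where "E = C @ unless_code d 3 (loop_code d [Dec d] @ D)"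
  have "runs x E (s, z) (poly (p + smult 3 pf + q + [:2:]) B) (s, (if f x \<sigma> \<noteq> 0 then g x \<sigma> else []) @ z)"
    if B: "fits x \<sigma> B" and s: "matches \<rho> d x \<sigma> s" for x \<sigma> B s z
  proof -
    let ?s = "s(d := f x \<sigma>)"
    have s0: "s(d := 0) = s" "s d = 0"
      using s by (auto simp: matches_def)
    have 1: "runs x C (s, z) (poly p B) (?s, z)"
      using C B s unfolding num_code_def by blast
    have 2: "runs x (unless_code d 3 (loop_code d [Dec d] @ D)) (?s, z) (3 * poly pf B + 1 + poly q B + 1) (s, (if f x \<sigma> \<noteq> 0 then g x \<sigma> else []) @ z)"
    proof (cases "f x \<sigma> = 0")
      case True
      then have "runs x (unless_code d 3 (loop_code d [Dec d] @ D)) (?s, z) 1 (s, z)"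
        using runs_unless_skip[of x d ?s 3 "loop_code d [Dec d] @ D" z] by (simp add: content_eq_3 s0)
      then show ?thesis
        using True by (auto elim!: runs_mono)
    next
      case False
      have "runs x (loop_code d [Dec d]) (?s, z) (3 * poly pf B + 1) (s, z)"
        using runs_clear[of x d ?s z] pf[OF B] by (auto simp: s0 elim!: runs_mono)
      moreover have "runs x D (s, z) (poly q B) (s, g x \<sigma> @ z)"
        using D B s unfolding out_code_def by blast
      ultimately have "runs x (loop_code d [Dec d] @ D) (?s, z) (3 * poly pf B + 1 + poly q B) (s, g x \<sigma> @ z)"
        by (rule runs_append)
      from runs_unless[OF _ this] show ?thesis
        using False by (simp add: content_eq_3)
    qed
    show ?thesis
      unfolding E_def by (rule runs_mono[OF runs_append[OF 1 2]]) simp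
  qed
  then show "\<exists>C p. out_code \<rho> d (\<lambda>x \<sigma>. if f x \<sigma> \<noteq> 0 then g x \<sigma> else []) C p"
    unfolding out_code_def by blast
qed

lemma pt_out_for:
  assumes f: "pt_num f" and g: "pt_out g"
  shows "pt_out (\<lambda>x \<sigma>. concat (map (\<lambda>v. g x (\<sigma>(y := v))) [0..<f x \<sigma>]))"
  unfolding pt_out_def
proof (intro allI impI)
  obtain pf where pf: "\<And>x \<sigma> B. fits x \<sigma> B \<Longrightarrow> f x \<sigma> \<le> poly pf B"
    using pt_num_boundD[OF f] by blast
  fix \<rho> d
  assume d: "below \<rho> d"
  define \<rho>' where "\<rho>' = \<rho>(y := d)"
  have d': "below \<rho>' (Suc d)"
    unfolding \<rho>'_def using d by (rule below_upd) (use below_pos[OF d] in auto)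
  obtain C p D q where C: "num_code \<rho> d f C p" and D: "out_code \<rho>' (Suc d) g D q"
    using pt_num_codeD[OF f d] pt_out_codeD[OF g d'] by blast
  define E where "E = C @ loop_code d ([Dec d] @ D)"
  define Q where "Q = pcompose q ([:0, 1:] + pf)"
  have "runs x E (s, z) (poly (p + pf * (Q + [:3:]) + 1) B)
      (s, concat (map (\<lambda>v. g x (\<sigma>(y := v))) [0..<f x \<sigma>]) @ z)"
    if B: "fits x \<sigma> B" and s: "matches \<rho> d x \<sigma> s" for x \<sigma> B s z
  proof -
    let ?n = "f x \<sigma>"
    let ?st = "\<lambda>i. (s(d := ?n - i), concat (map (\<lambda>v. g x (\<sigma>(y := v))) [?n - i..<?n]) @ z)"
    have 1: "runs x C (s, z) (poly p B) (?st 0)"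
      using C B s unfolding num_code_def by simp
    have 2: "runs x ([Dec d] @ D) (?st i) (1 + poly Q B) (?st (Suc i))" if "i < ?n" for i
    proof -
      define v where "v = ?n - Suc i"
      have v: "?n - i = Suc v" "v < ?n"
        using that by (auto simp: v_def)
      have "fits x (\<sigma>(y := v)) (B + poly pf B)"
        using v pf[OF B] by (intro fits_bind B) auto
      moreover have "matches \<rho>' (Suc d) x (\<sigma>(y := v)) (s(d := v))"
        unfolding \<rho>'_def using s d by (rule matches_bind)
      ultimately have "runs x D (s(d := v), w) (poly Q B) (s(d := v), g x (\<sigma>(y := v)) @ w)" for w
        using D unfolding out_code_def Q_def by (simp add: poly_pcompose)
      moreover have "runs x [Dec d] (?st i) 1 (s(d := v), snd (?st i))"
        using runs_Dec[of x d "fst (?st i)" "snd (?st i)"] v by simp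
      moreover have "?st (Suc i) = (s(d := v), g x (\<sigma>(y := v)) @ snd (?st i))"
        using v by (simp add: v_def[symmetric] upt_conv_Cons)
      ultimately show ?thesis
        by (metis runs_append)
    qed
    have "runs x (loop_code d ([Dec d] @ D)) (?st 0) (?n * (1 + poly Q B + 2) + 1) (?st ?n)"
      using 2 by (intro runs_loop[where st = ?st]) auto
    moreover have "?st ?n = (s, concat (map (\<lambda>v. g x (\<sigma>(y := v))) [0..<?n]) @ z)"
      using s by (auto simp: matches_def)
    ultimately have "runs x E (s, z) (poly p B + (?n * (1 + poly Q B + 2) + 1)) (s, concat (map (\<lambda>v. g x (\<sigma>(y := v))) [0..<?n]) @ z)"
      unfolding E_def by (intro runs_append[OF 1]) simp
    then show ?thesis
    proof (rule runs_mono)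
      have "?n * (poly Q B + 3) \<le> poly pf B * (poly Q B + 3)"
        by (rule mult_right_mono[OF pf[OF B]]) simp
      then show "poly p B + (?n * (1 + poly Q B + 2) + 1) \<le> poly (p + pf * (Q + [:3:]) + 1) B"
        by (simp add: algebra_simps)
    qed
  qed
  then show "\<exists>C p. out_code \<rho> d (\<lambda>x \<sigma>. concat (map (\<lambda>v. g x (\<sigma>(y := v))) [0..<f x \<sigma>])) C p"
    unfolding out_code_def by blast
qed

section \<open>Turing machines for counter programs\<close>

definition regs_below :: "nat \<Rightarrow> instr list \<Rightarrow> bool" where
  "regs_below R C \<longleftrightarrow>
     (\<forall>r a e. (Inc r \<in> set C \<longrightarrow> r < R) \<and> (Dec r \<in> set C \<longrightarrow> r < R) \<and> (Branch r a e \<in> set C \<longrightarrow> r < R))"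

lemma regs_below_exists: "\<exists>R\<ge>2. regs_below R C"
proof (induction C)
  case Nil
  then show ?case by (auto simp: regs_below_def)
next
  case (Cons i C)
  then obtain R where R: "2 \<le> R" "regs_below R C" by blast
  define r where "r = (case i of Inc r \<Rightarrow> r | Dec r \<Rightarrow> r | Branch r a e \<Rightarrow> r | _ \<Rightarrow> 0)"
  have "regs_below (max R (Suc r)) (i # C)"
    using R(2) by (auto simp: regs_below_def r_def less_max_iff_disj split: instr.splits)
  then show ?case
    using R(1) by (meson max.coboundedI1)
qed

text \<open>Tape \<open>r + 1\<close> represents the counter \<open>r\<close> by its head position. In states 0, 1, 2 the markers
  are written and the input is copied to tape 1 while tape 2 counts its length. Then state \<open>3 + pc\<close>
  executes instruction \<open>pc\<close>. The head of tape 0 stays one cell to the left of the output.\<close>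

fun instr_delta :: "instr \<Rightarrow> nat \<Rightarrow> nat list \<Rightarrow> nat \<times> (nat \<Rightarrow> nat \<times> direction)" where
  "instr_delta (Inc r) pc as = (Suc pc, \<lambda>j. (as ! j, if j = Suc r then Move_Right else Stay))"
| "instr_delta (Dec r) pc as = (Suc pc, \<lambda>j. (as ! j, if j = Suc r \<and> as ! j \<noteq> 3 then Move_Left else Stay))"
| "instr_delta (Push b) pc as = (Suc pc, \<lambda>j. if j = 0 then (bit_symbol b, Move_Left) else (as ! j, Stay))"
| "instr_delta (Jump e) pc as = (nat (int pc + e), \<lambda>j. (as ! j, Stay))"
| "instr_delta (Branch r a e) pc as =
     (if as ! Suc r = a then nat (int pc + e) else Suc pc, \<lambda>j. (as ! j, Stay))"

text \<open>Jump targets behind the program are cut to \<open>length C\<close>. They lead to state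
  \<open>3 + length C\<close>, whose only step puts the head of tape 0 on the output and
  halts.\<close>

definition machine_delta :: "instr list \<Rightarrow> nat \<Rightarrow> nat list \<Rightarrow> nat \<times> (nat \<Rightarrow> nat \<times> direction)" where
  "machine_delta C q as =
     (if q = 0 then (1, \<lambda>j. (if j = 0 then as ! 0 else 3, if j = 1 then Move_Right else Stay))
      else if q = 1 then
        (if as ! 0 = 0 then (2, \<lambda>j. (as ! j, if j \<le> 1 then Move_Left else Stay))
         else (1, \<lambda>j. (if j = 1 then as ! 0 else as ! j, if j \<le> 2 then Move_Right else Stay)))
      else if q = 2 then
        (if as ! 1 = 3 then (3, \<lambda>j. (as ! j, Stay))
         else (2, \<lambda>j. (as ! j, if j = 1 then Move_Left else Stay)))
      else if q < 3 + length C then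
        (let (pc, f) = instr_delta (C ! (q - 3)) (q - 3) as in (3 + min pc (length C), f))
      else (4 + length C, \<lambda>j. (as ! j, if j = 0 then Move_Right else Stay)))"

definition machine :: "nat \<Rightarrow> instr list \<Rightarrow> tm" where
  "machine R C = \<lparr>tapes = Suc R, symbols = 4, states = 4 + length C,
     delta = (\<lambda>q as. let (q', f) = machine_delta C q as in (q', map f [0..<Suc R]))\<rparr>"

lemma turing_machine_machine:
  assumes "2 \<le> R"
  shows "turing_machine (machine R C)"
proof -
  have "fst (machine_delta C q as) \<le> 4 + length C \<and> (\<forall>j<Suc R. fst (snd (machine_delta C q as) j) < 4)"
    if "length as = Suc R" "\<forall>a\<in>set as. a < 4" for q as
  proof -
    have as: "as ! j < 4" if "j < Suc R" for j
      using that \<open>length as = Suc R\<close> \<open>\<forall>a\<in>set as. a < 4\<close> by simp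
    show ?thesis
    proof (cases "3 \<le> q \<and> q < 3 + length C")
      case True
      then show ?thesis
        using as by (cases "C ! (q - 3)") (auto simp: machine_delta_def bit_symbol_def)
    next
      case False
      then show ?thesis
        using as assms by (auto simp: machine_delta_def)
    qed
  qed
  then show ?thesis
    by (force simp: turing_machine_def machine_def case_prod_beta)
qed

lemma step_machine:
  assumes "q \<noteq> 4 + length C" "machine_delta C q (map (\<lambda>j. read_tape (\<tau> j)) [0..<Suc R]) = (q', f)"
  shows "step (machine R C) (q, map \<tau> [0..<Suc R]) = (q', map (\<lambda>j. act (f j) (\<tau> j)) [0..<Suc R])"
proof -
  have "map2 act (map f xs) (map \<tau> xs) = map (\<lambda>j. act (f j) (\<tau> j)) xs" for xs
    by (induction xs) auto
  then show ?thesis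
    using assms by (simp add: machine_def comp_def del: upt_Suc)
qed

declare step.simps [simp del]

definition counter_tape :: "bool list \<Rightarrow> nat \<Rightarrow> int \<Rightarrow> nat" where
  "counter_tape x r i = (if i < 0 then 0 else content x r (nat i))"

definition represents :: "nat \<Rightarrow> bool list \<Rightarrow> cstate \<Rightarrow> (nat \<Rightarrow> tape) \<Rightarrow> bool" where
  "represents R x c \<tau> \<longleftrightarrow>
     (\<forall>r<R. \<tau> (Suc r) = (counter_tape x r, int (fst c r))) \<and>
     holds_output (fst (\<tau> 0), snd (\<tau> 0) + 1) (snd c)"

lemma act_same [simp]: "act (read_tape t, d) t = (fst t, shift_head d (snd t))"
  by (cases t) simp

lemma simulate_instr:
  assumes R: "regs_below R C" and pc: "pc < length C"
    and nxt: "code_step x C (pc, c) = (pc', c')" and pc': "pc' \<le> length C"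
    and rep: "represents R x c \<tau>"
  shows "\<exists>\<tau>'. step (machine R C) (3 + pc, map \<tau> [0..<Suc R]) = (3 + pc', map \<tau>' [0..<Suc R]) \<and>
    represents R x c' \<tau>'"
proof -
  define as where "as = map (\<lambda>j. read_tape (\<tau> j)) [0..<Suc R]"
  obtain s y where c: "c = (s, y)" by (cases c)
  have as: "as ! j = read_tape (\<tau> j)" if "j < Suc R" for j
    unfolding as_def using that by (simp del: upt_Suc)
  have \<tau>: "\<tau> (Suc r) = (counter_tape x r, int (s r))" and rd: "as ! Suc r = content x r (s r)"
    if "r < R" for r
    using rep that as[of "Suc r"] by (auto simp: represents_def c counter_tape_def)
  have out: "holds_output (fst (\<tau> 0), snd (\<tau> 0) + 1) y"
    using rep by (simp add: represents_def c)
  have goal: "\<exists>f. instr_delta (C ! pc) pc as = (pc', f) \<and>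
      represents R x c' (\<lambda>j. if j < Suc R then act (f j) (\<tau> j) else \<tau> j)"
    if "instr_delta (C ! pc) pc as = (pc', f)" "c' = (s', y')"
      and "\<And>r. r < R \<Longrightarrow> act (f (Suc r)) (\<tau> (Suc r)) = (counter_tape x r, int (s' r))"
      and "holds_output (fst (act (f 0) (\<tau> 0)), snd (act (f 0) (\<tau> 0)) + 1) y'" for f s' y'
    using that by (intro exI[of _ f]) (auto simp: represents_def)
  have "\<exists>f. instr_delta (C ! pc) pc as = (pc', f) \<and>
      represents R x c' (\<lambda>j. if j < Suc R then act (f j) (\<tau> j) else \<tau> j)"
  proof (cases "C ! pc")
    case (Inc r)
    have "c' = (s(r := Suc (s r)), y)" "pc' = Suc pc"
      using nxt pc by (auto simp: code_step_def Inc c)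
    then show ?thesis
      using goal[of "snd (instr_delta (Inc r) pc as)" "s(r := Suc (s r))" y] out \<tau> as
      by (auto simp: Inc)
  next
    case (Dec r)
    have "c' = (s(r := s r - 1), y)" "pc' = Suc pc"
      using nxt pc by (auto simp: code_step_def Dec c)
    then show ?thesis
      using goal[of "snd (instr_delta (Dec r) pc as)" "s(r := s r - 1)" y] out \<tau> as rd
      by (auto simp: Dec content_eq_3)
  next
    case (Push b)
    have "c' = (s, b # y)" "pc' = Suc pc"
      using nxt pc by (auto simp: code_step_def Push c)
    moreover have "holds_output (fst (act (bit_symbol b, Move_Left) (\<tau> 0)), snd (act (bit_symbol b, Move_Left) (\<tau> 0)) + 1) (b # y)"
    proof (cases "\<tau> 0")
      case (Pair t h)
      then have "(t(h := bit_symbol b)) (h + int i) = bit_symbol ((b # y) ! i)" if "i < Suc (length y)" for i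
        using out that by (cases i) (auto simp: algebra_simps)
      then show ?thesis
        using out Pair by (simp add: algebra_simps)
    qed
    ultimately show ?thesis
      using goal[of "snd (instr_delta (Push b) pc as)" s "b # y"] \<tau> as
      by (auto simp: Push)
  next
    case (Jump e)
    have "c' = (s, y)" "pc' = nat (int pc + e)"
      using nxt pc by (auto simp: code_step_def Jump c)
    then show ?thesis
      using goal[of "snd (instr_delta (Jump e) pc as)" s y] out \<tau> as
      by (auto simp: Jump)
  next
    case (Branch r a e)
    then have "Branch r a e \<in> set C"
      using nth_mem[OF pc] by simp
    then have r: "r < R"
      using R unfolding regs_below_def by blast
    have "c' = (s, y)" "pc' = (if as ! Suc r = a then nat (int pc + e) else Suc pc)"
      using nxt pc rd[OF r] by (auto simp: code_step_def Branch c)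
    then show ?thesis
      using goal[of "snd (instr_delta (Branch r a e) pc as)" s y] out \<tau> as
      by (auto simp: Branch)
  qed
  then obtain f where f: "instr_delta (C ! pc) pc as = (pc', f)"
    and rep': "represents R x c' (\<lambda>j. if j < Suc R then act (f j) (\<tau> j) else \<tau> j)"
    by blast
  have "machine_delta C (3 + pc) as = (3 + pc', f)"
    using f pc pc' by (simp add: machine_delta_def)
  then have "step (machine R C) (3 + pc, map \<tau> [0..<Suc R]) = (3 + pc', map (\<lambda>j. act (f j) (\<tau> j)) [0..<Suc R])"
    unfolding as_def using pc by (intro step_machine) auto
  also have "map (\<lambda>j. act (f j) (\<tau> j)) [0..<Suc R] = map (\<lambda>j. if j < Suc R then act (f j) (\<tau> j) else \<tau> j) [0..<Suc R]"
    by (rule map_cong) auto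
  finally show ?thesis
    using rep' by blast
qed

text \<open>A finished counter program stays where it is, whereas the machine moves on to its last
  step. The simulation therefore stops at the first time \<open>t'\<close> at which the program
  counter has left the program.\<close>

lemma simulate_code:
  assumes R: "regs_below R C" and run: "(code_step x C ^^ t) (0, c) = (length C, c')"
    and rep: "represents R x c \<tau>"
  shows "\<exists>t'\<le>t. \<exists>\<tau>'. (step (machine R C) ^^ t') (3, map \<tau> [0..<Suc R]) = (3 + length C, map \<tau>' [0..<Suc R]) \<and>
    represents R x c' \<tau>'"
proof -
  define u where "u i = (code_step x C ^^ i) (0, c)" for i
  define t' where "t' = (LEAST i. length C \<le> fst (u i))"
  have t: "u t = (length C, c')"
    using run by (simp add: u_def)
  have t': "length C \<le> fst (u t')" "t' \<le> t"
    unfolding t'_def by (rule LeastI[of _ t], use t in simp) (rule Least_le, use t in simp)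
  have before: "fst (u i) < length C" if "i < t'" for i
    using not_less_Least[of i "\<lambda>i. length C \<le> fst (u i)"] that by (auto simp: t'_def)
  have "u (t' + i) = u t'" for i
    using t'(1) by (induction i) (auto simp: u_def code_step_def)
  from this[of "t - t'"] have ut': "u t' = (length C, c')"
    using t t'(2) by simp
  have "\<exists>\<tau>'. (step (machine R C) ^^ i) (3, map \<tau> [0..<Suc R]) = (3 + fst (u i), map \<tau>' [0..<Suc R]) \<and>
      represents R x (snd (u i)) \<tau>'" if "i \<le> t'" for i
    using that
  proof (induction i)
    case 0
    then show ?case using rep by (auto simp: u_def)
  next
    case (Suc i)
    then obtain \<tau>' where \<tau>': "(step (machine R C) ^^ i) (3, map \<tau> [0..<Suc R]) = (3 + fst (u i), map \<tau>' [0..<Suc R])"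
      "represents R x (snd (u i)) \<tau>'" by auto
    have "fst (u (Suc i)) \<le> length C"
      using before[of "Suc i"] ut' Suc.prems by (cases "Suc i = t'") auto
    moreover have "code_step x C (fst (u i), snd (u i)) = (fst (u (Suc i)), snd (u (Suc i)))"
      by (simp add: u_def)
    ultimately show ?case
      using simulate_instr[OF R before _ _ \<tau>'(2), of i] \<tau>'(1) Suc.prems by (simp del: upt_Suc)
  qed
  from this[of t'] show ?thesis
    using ut' t'(2) by auto
qed

lemma initial_machine:
  "initial_config (machine R C) [x] =
     (0, map (\<lambda>j. if j = 0 then input_tape x else (\<lambda>_. 0, 0)) [0..<Suc R])"
  by (auto simp: initial_config_def machine_def input_tape_def simp del: upt_Suc)

text \<open>\<open>\<tau>1 i\<close> describes the tapes after \<open>i\<close> copied symbols,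
  \<open>\<tau>2 i\<close> the tapes when the head of tape 1 still has \<open>i\<close> cells to go
  back. The steps are 1 for the markers, \<open>length x\<close> for copying, 1 for turning round,
  \<open>length x\<close> for going back and 1 for finding the marker. The head of tape 0 ends on
  the last input cell: the output grows leftwards over the input, which has been copied, and the
  blank behind the input terminates it.\<close>

lemma simulate_prologue:
  assumes R: "2 \<le> R"
  shows "\<exists>\<tau>. (step (machine R C) ^^ (2 * length x + 3)) (initial_config (machine R C) [x]) = (3, map \<tau> [0..<Suc R]) \<and>
    represents R x ((\<lambda>_. 0)(1 := length x), []) \<tau>"
proof -
  let ?n = "length x" and ?M = "machine R C"
  define cpy where "cpy i p = (if p = 0 then 3 else if 1 \<le> p \<and> p \<le> int i then bit_symbol (x ! nat (p - 1)) else 0)"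
    for i :: nat and p :: int
  define mark :: "int \<Rightarrow> nat" where "mark p = (if p = 0 then 3 else 0)" for p
  have cpy0: "cpy 0 = mark"
    by (auto simp: cpy_def mark_def)
  have cpyn: "cpy ?n = counter_tape x 0"
    by (rule ext) (auto simp: cpy_def counter_tape_def content_def nat_diff_distrib' nat_le_iff)
  have mark: "mark = counter_tape x (Suc r)" for r
    by (auto simp: mark_def counter_tape_def content_def)
  let ?in = "fst (input_tape x)"
  define \<tau>1 where "\<tau>1 i j = (if j = 0 then (?in, int i) else if j = 1 then (cpy i, int i + 1)
     else if j = 2 then (mark, int i) else (mark, 0))" for i j :: nat
  define \<tau>2 where "\<tau>2 i j = (if j = 0 then (?in, int ?n - 1) else if j = 1 then (cpy ?n, int i)
     else if j = 2 then (mark, int ?n) else (mark, 0))" for i j :: nat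
  have nth0: "map f [0..<Suc R] ! 0 = f 0" and nth1: "map f [0..<Suc R] ! Suc 0 = f 1" for f :: "nat \<Rightarrow> nat"
    using R by (simp_all del: upt_Suc)
  have nthj: "map f [0..<Suc R] ! j = f j" if "j < Suc R" for f :: "nat \<Rightarrow> nat" and j
    using that by (simp del: upt_Suc)
  have s0: "step ?M (initial_config ?M [x]) = (1, map (\<tau>1 0) [0..<Suc R])"
  proof -
    let ?\<tau> = "\<lambda>j. if j = 0 then input_tape x else (\<lambda>_. 0, 0)"
    have "step ?M (0, map ?\<tau> [0..<Suc R]) = (1, map (\<lambda>j. act (if j = 0 then map (\<lambda>j. read_tape (?\<tau> j)) [0..<Suc R] ! 0 else 3, if j = 1 then Move_Right else Stay) (?\<tau> j)) [0..<Suc R])"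
      by (rule step_machine) (simp_all add: machine_delta_def del: upt_Suc)
    then show ?thesis
      unfolding initial_machine nth0 by (auto simp: \<tau>1_def input_tape_def cpy0 mark_def fun_eq_iff simp del: upt_Suc)
  qed
  have s1: "step ?M (1, map (\<tau>1 i) [0..<Suc R]) = (1, map (\<tau>1 (Suc i)) [0..<Suc R])" if "i < ?n" for i
  proof -
    let ?as = "map (\<lambda>j. read_tape (\<tau>1 i j)) [0..<Suc R]"
    have in_i: "?in (int i) = bit_symbol (x ! i)" "?in (int i) \<noteq> 0"
      using that by (auto simp: input_tape_def bit_symbol_def)
    have "(cpy i)(int i + 1 := bit_symbol (x ! i)) = cpy (Suc i)"
      by (auto simp: cpy_def fun_eq_iff)
    then have *: "act (if j = 1 then ?as ! 0 else ?as ! j, if j \<le> 2 then Move_Right else Stay) (\<tau>1 i j) = \<tau>1 (Suc i) j"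
      if "j < Suc R" for j
      using that in_i R unfolding nthj[OF that] nth0 by (auto simp: \<tau>1_def)
    have "step ?M (1, map (\<tau>1 i) [0..<Suc R]) = (1, map (\<lambda>j. act (if j = 1 then ?as ! 0 else ?as ! j, if j \<le> 2 then Move_Right else Stay) (\<tau>1 i j)) [0..<Suc R])"
    proof (rule step_machine)
      have "?as ! 0 = ?in (int i)"
        unfolding nth0 by (simp add: \<tau>1_def)
      then show "machine_delta C 1 ?as = (1, \<lambda>j. (if j = 1 then ?as ! 0 else ?as ! j, if j \<le> 2 then Move_Right else Stay))"
        using in_i(2) by (simp add: machine_delta_def del: upt_Suc)
    qed simp
    also have "\<dots> = (1, map (\<tau>1 (Suc i)) [0..<Suc R])"
      using * by (auto simp del: upt_Suc)
    finally show ?thesis .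
  qed
  have s1': "step ?M (1, map (\<tau>1 ?n) [0..<Suc R]) = (2, map (\<tau>2 ?n) [0..<Suc R])"
  proof -
    let ?as = "map (\<lambda>j. read_tape (\<tau>1 ?n j)) [0..<Suc R]"
    have in_n: "?in (int ?n) = 0"
      by (simp add: input_tape_def)
    have *: "act (?as ! j, if j \<le> 1 then Move_Left else Stay) (\<tau>1 ?n j) = \<tau>2 ?n j"
      if "j < Suc R" for j
      using that unfolding nthj[OF that] by (auto simp: \<tau>1_def \<tau>2_def)
    have "step ?M (1, map (\<tau>1 ?n) [0..<Suc R]) = (2, map (\<lambda>j. act (?as ! j, if j \<le> 1 then Move_Left else Stay) (\<tau>1 ?n j)) [0..<Suc R])"
    proof (rule step_machine)
      have "?as ! 0 = ?in (int ?n)"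
        unfolding nth0 by (simp add: \<tau>1_def)
      then show "machine_delta C 1 ?as = (2, \<lambda>j. (?as ! j, if j \<le> 1 then Move_Left else Stay))"
        using in_n by (simp add: machine_delta_def del: upt_Suc)
    qed simp
    also have "\<dots> = (2, map (\<tau>2 ?n) [0..<Suc R])"
      using * by (auto simp del: upt_Suc)
    finally show ?thesis .
  qed
  have s2: "step ?M (2, map (\<tau>2 (Suc i)) [0..<Suc R]) = (2, map (\<tau>2 i) [0..<Suc R])" for i
  proof -
    let ?as = "map (\<lambda>j. read_tape (\<tau>2 (Suc i) j)) [0..<Suc R]"
    have rd: "cpy ?n (int (Suc i)) \<noteq> 3"
      by (auto simp: cpy_def bit_symbol_def)
    have *: "act (?as ! j, if j = 1 then Move_Left else Stay) (\<tau>2 (Suc i) j) = \<tau>2 i j"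
      if "j < Suc R" for j
      using that unfolding nthj[OF that] by (auto simp: \<tau>2_def)
    have "step ?M (2, map (\<tau>2 (Suc i)) [0..<Suc R]) = (2, map (\<lambda>j. act (?as ! j, if j = 1 then Move_Left else Stay) (\<tau>2 (Suc i) j)) [0..<Suc R])"
    proof (rule step_machine)
      have "?as ! Suc 0 \<noteq> 3"
        unfolding nth1 using rd by (simp add: \<tau>2_def)
      then show "machine_delta C 2 ?as = (2, \<lambda>j. (?as ! j, if j = 1 then Move_Left else Stay))"
        by (simp add: machine_delta_def del: upt_Suc)
    qed simp
    also have "\<dots> = (2, map (\<tau>2 i) [0..<Suc R])"
      using * by (auto simp del: upt_Suc)
    finally show ?thesis .
  qed
  have s2': "step ?M (2, map (\<tau>2 0) [0..<Suc R]) = (3, map (\<tau>2 0) [0..<Suc R])"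
  proof -
    let ?as = "map (\<lambda>j. read_tape (\<tau>2 0 j)) [0..<Suc R]"
    have *: "act (?as ! j, Stay) (\<tau>2 0 j) = \<tau>2 0 j" if "j < Suc R" for j
      using that unfolding nthj[OF that] by simp
    have "step ?M (2, map (\<tau>2 0) [0..<Suc R]) = (3, map (\<lambda>j. act (?as ! j, Stay) (\<tau>2 0 j)) [0..<Suc R])"
    proof (rule step_machine)
      have "?as ! Suc 0 = 3"
        unfolding nth1 by (simp add: \<tau>2_def cpy_def)
      then show "machine_delta C 2 ?as = (3, \<lambda>j. (?as ! j, Stay))"
        by (simp add: machine_delta_def del: upt_Suc)
    qed simp
    also have "\<dots> = (3, map (\<tau>2 0) [0..<Suc R])"
      using * by (auto simp del: upt_Suc)
    finally show ?thesis .
  qed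
  have "(step ?M ^^ Suc i) (initial_config ?M [x]) = (1, map (\<tau>1 i) [0..<Suc R])" if "i \<le> ?n" for i
    using that
  proof (induction i)
    case 0
    then show ?case using s0 by simp
  next
    case (Suc i)
    then show ?case using s1[of i] by (simp del: upt_Suc)
  qed
  from this[of ?n] have "(step ?M ^^ Suc (Suc ?n)) (initial_config ?M [x]) = (2, map (\<tau>2 ?n) [0..<Suc R])"
    using s1' by (simp del: upt_Suc)
  moreover have "(step ?M ^^ i) (2, map (\<tau>2 i) [0..<Suc R]) = (2, map (\<tau>2 0) [0..<Suc R])" for i
    by (induction i) (simp_all add: s2 funpow_swap1 del: upt_Suc)
  ultimately have "(step ?M ^^ (?n + Suc (Suc ?n))) (initial_config ?M [x]) = (2, map (\<tau>2 0) [0..<Suc R])"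
    unfolding funpow_add by (simp del: upt_Suc)
  then have "(step ?M ^^ (1 + (?n + Suc (Suc ?n)))) (initial_config ?M [x]) = (3, map (\<tau>2 0) [0..<Suc R])"
    using s2' by (simp del: upt_Suc)
  moreover have "1 + (?n + Suc (Suc ?n)) = 2 * ?n + 3"
    by simp
  ultimately have "(step ?M ^^ (2 * ?n + 3)) (initial_config ?M [x]) = (3, map (\<tau>2 0) [0..<Suc R])"
    by (simp only:)
  moreover have "represents R x ((\<lambda>_. 0)(1 := ?n), []) (\<tau>2 0)"
    unfolding represents_def
  proof (intro conjI allI impI)
    fix r assume "r < R"
    show "\<tau>2 0 (Suc r) = (counter_tape x r, int (fst ((\<lambda>_. 0)(1 := ?n), [] :: bool list) r))"
      using mark[of "r - 1"] by (cases r) (auto simp: \<tau>2_def cpyn)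
  qed (simp add: \<tau>2_def input_tape_def)
  ultimately show ?thesis
    by blast
qed

text \<open>All variables start in counter 1, which holds the input length; this is the origin of
  the constant environment. The summand \<open>[:4, 2:]\<close> pays for the
  \<open>2 * length x + 3\<close> preparatory steps and the final head movement.\<close>

theorem pt_out_polytime_computable:
  assumes "pt_out g"
  shows "polytime_computable (\<lambda>x. g x (\<lambda>_. length x))"
proof -
  have "below (\<lambda>_. 1) 2"
    by (simp add: below_def)
  then obtain C p where C: "out_code (\<lambda>_. 1) 2 g C p"
    using pt_out_codeD[OF assms] by blast
  obtain R where R: "2 \<le> R" "regs_below R C"
    using regs_below_exists by blast
  let ?M = "machine R C"
  have "computes_within ?M [x] (g x (\<lambda>_. length x)) (poly (p + [:4, 2:]) (length x))" for x
  proof -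
    let ?y = "g x (\<lambda>_. length x)" and ?n = "length x"
    let ?s = "(\<lambda>_. 0)(1 := ?n)"
    have "matches (\<lambda>_. 1) 2 x (\<lambda>_. ?n) ?s" "fits x (\<lambda>_. ?n) ?n"
      by (auto simp: matches_def fits_def)
    then have "runs x C (?s, []) (poly p ?n) (?s, ?y)"
      using C unfolding out_code_def by (metis append_Nil2)
    then obtain t where t: "t \<le> poly p ?n" "(code_step x C ^^ t) (0, ?s, []) = (length C, ?s, ?y)"
      unfolding runs_def by (metis append_Nil append_Nil2 list.size(3) plus_nat.add_0)
    obtain \<tau> where \<tau>: "(step ?M ^^ (2 * ?n + 3)) (initial_config ?M [x]) = (3, map \<tau> [0..<Suc R])"
      "represents R x (?s, []) \<tau>"
      using simulate_prologue[OF R(1)] by blast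
    obtain t' \<tau>' where t': "t' \<le> t" "(step ?M ^^ t') (3, map \<tau> [0..<Suc R]) = (3 + length C, map \<tau>' [0..<Suc R])"
      "represents R x (?s, ?y) \<tau>'"
      using simulate_code[OF R(2) t(2) \<tau>(2)] by blast
    let ?as = "map (\<lambda>j. read_tape (\<tau>' j)) [0..<Suc R]"
    define ts where "ts = map (\<lambda>j. act (?as ! j, if j = 0 then Move_Right else Stay) (\<tau>' j)) [0..<Suc R]"
    have last: "step ?M (3 + length C, map \<tau>' [0..<Suc R]) = (4 + length C, ts)"
      unfolding ts_def by (intro step_machine) (simp_all add: machine_delta_def del: upt_Suc)
    have states: "states ?M = 4 + length C"
      by (simp add: machine_def)
    have "(step ?M ^^ (1 + (t' + (2 * ?n + 3)))) (initial_config ?M [x]) = (states ?M, ts)"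
    proof -
      have "(step ?M ^^ (t' + (2 * ?n + 3))) (initial_config ?M [x]) = (3 + length C, map \<tau>' [0..<Suc R])"
        unfolding funpow_add[of t' "2 * ?n + 3"] comp_apply \<tau>(1) by (rule t'(2))
      then show ?thesis
        using last by (simp only: states plus_1_eq_Suc funpow.simps comp_apply)
    qed
    moreover have "hd ts = (fst (\<tau>' 0), snd (\<tau>' 0) + 1)"
    proof -
      have "?as ! 0 = read_tape (\<tau>' 0)"
        by (simp del: upt_Suc)
      then show ?thesis
        by (simp add: ts_def upt_conv_Cons del: upt_Suc)
    qed
    then have "holds_output (hd ts) ?y"
      using t'(3) by (simp add: represents_def)
    moreover have len: "length [x] \<le> tapes ?M"
      by (simp add: machine_def)
    moreover have "1 + (t' + (2 * ?n + 3)) \<le> poly (p + [:4, 2:]) ?n"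
      using t(1) t'(1) by simp
    ultimately show ?thesis
      unfolding computes_within_def using R(1) by (metis len)
  qed
  then show ?thesis
    unfolding polytime_computable_def using turing_machine_machine[OF R(1)] by blast
qed

section \<open>Closure properties and the output of numbers\<close>

lemma pt_num_supportD: "pt_num f \<Longrightarrow> \<exists>K. \<forall>x \<sigma> y v. K \<le> y \<longrightarrow> f x (\<sigma>(y := v)) = f x \<sigma>"
  by (simp add: pt_num_def)

text \<open>The product is a sum with constant summand, bound to a variable on which
  \<open>g\<close> does not depend.\<close>

lemma pt_num_mult:
  assumes f: "pt_num f" and g: "pt_num g"
  shows "pt_num (\<lambda>x \<sigma>. f x \<sigma> * g x \<sigma>)"
proof -
  obtain K where K: "\<forall>x \<sigma> y v. K \<le> y \<longrightarrow> g x (\<sigma>(y := v)) = g x \<sigma>"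
    using pt_num_supportD[OF g] by (elim exE)
  have "(\<Sum>v<f x \<sigma>. g x (\<sigma>(K := v))) = f x \<sigma> * g x \<sigma>" for x \<sigma>
    using K[rule_format, OF order_refl, of x \<sigma>] by simp
  then show ?thesis
    using pt_num_sum[OF f g, of K] by (simp only:)
qed

definition pt_test :: "(bool list \<Rightarrow> (nat \<Rightarrow> nat) \<Rightarrow> bool) \<Rightarrow> bool" where
  "pt_test P \<longleftrightarrow> pt_num (\<lambda>x \<sigma>. of_bool (P x \<sigma>))"

lemma pt_testD: "pt_test P \<Longrightarrow> pt_num (\<lambda>x \<sigma>. of_bool (P x \<sigma>))"
  by (simp add: pt_test_def)

lemma pt_testI: "pt_num f \<Longrightarrow> (\<And>x \<sigma>. of_bool (P x \<sigma>) = f x \<sigma>) \<Longrightarrow> pt_test P"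
  by (simp add: pt_test_def)

lemma pt_test_bit: "pt_num f \<Longrightarrow> pt_test (\<lambda>x \<sigma>. f x \<sigma> < length x \<and> x ! f x \<sigma>)"
  unfolding pt_test_def by (rule pt_num_bit)

lemma pt_test_not: "pt_test P \<Longrightarrow> pt_test (\<lambda>x \<sigma>. \<not> P x \<sigma>)"
  by (rule pt_testI[OF pt_num_sub[OF pt_num_const[of 1] pt_testD[of P]]]) simp_all

lemma pt_test_and: "pt_test P \<Longrightarrow> pt_test Q \<Longrightarrow> pt_test (\<lambda>x \<sigma>. P x \<sigma> \<and> Q x \<sigma>)"
  by (rule pt_testI[OF pt_num_mult[OF pt_testD[of P] pt_testD[of Q]]]) simp_all

lemma pt_test_or: "pt_test P \<Longrightarrow> pt_test Q \<Longrightarrow> pt_test (\<lambda>x \<sigma>. P x \<sigma> \<or> Q x \<sigma>)"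
  by (rule pt_testI[OF pt_testD[OF pt_test_not[OF pt_test_and[OF pt_test_not[of P] pt_test_not[of Q]]]]]) simp_all

lemma pt_test_imp: "pt_test P \<Longrightarrow> pt_test Q \<Longrightarrow> pt_test (\<lambda>x \<sigma>. P x \<sigma> \<longrightarrow> Q x \<sigma>)"
  by (rule pt_testI[OF pt_testD[OF pt_test_or[OF pt_test_not[of P] , of Q]]]) auto

text \<open>With truncated subtraction, \<open>1 - (1 - (g - f))\<close> is 1 if
  \<open>g - f\<close> is positive and 0 otherwise.\<close>

lemma pt_test_less: "pt_num f \<Longrightarrow> pt_num g \<Longrightarrow> pt_test (\<lambda>x \<sigma>. f x \<sigma> < g x \<sigma>)"
  by (rule pt_testI[OF pt_num_sub[OF pt_num_const[of 1] pt_num_sub[OF pt_num_const[of 1] pt_num_sub[of g f]]]]) auto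

lemma pt_test_le: "pt_num f \<Longrightarrow> pt_num g \<Longrightarrow> pt_test (\<lambda>x \<sigma>. f x \<sigma> \<le> g x \<sigma>)"
  by (rule pt_testI[OF pt_testD[OF pt_test_not[OF pt_test_less[of g f]]]]) (auto simp: not_less)

lemma pt_test_eq: "pt_num f \<Longrightarrow> pt_num g \<Longrightarrow> pt_test (\<lambda>x \<sigma>. f x \<sigma> = g x \<sigma>)"
  by (rule pt_testI[OF pt_testD[OF pt_test_and[OF pt_test_le[of f g] pt_test_le[of g f]]]]) auto

lemma pt_test_const: "pt_test (\<lambda>x \<sigma>. b)"
  unfolding pt_test_def by (rule pt_num_const)

lemma pt_num_if:
  assumes "pt_test P" "pt_num f" "pt_num g"
  shows "pt_num (\<lambda>x \<sigma>. if P x \<sigma> then f x \<sigma> else g x \<sigma>)"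
proof -
  have "pt_num (\<lambda>x \<sigma>. of_bool (P x \<sigma>) * f x \<sigma> + of_bool (\<not> P x \<sigma>) * g x \<sigma>)"
    by (intro pt_num_add pt_num_mult pt_testD pt_test_not assms)
  moreover have "of_bool b * m + of_bool (\<not> b) * n = (if b then m else n)" for b and m n :: nat
    by simp
  ultimately show ?thesis by (simp only:)
qed

lemma pt_test_finite_ex:
  assumes "finite A" "\<And>a. a \<in> A \<Longrightarrow> pt_test (P a)"
  shows "pt_test (\<lambda>x \<sigma>. \<exists>a\<in>A. P a x \<sigma>)"
  using assms by induction (simp_all add: pt_test_const pt_test_or)

text \<open>The quotient counts the multiples \<open>Suc v * g \<le> f\<close>; for positive
  \<open>g\<close> all such \<open>v\<close> are below \<open>f\<close>, so the sum sees them all.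
  The test \<open>0 < g\<close> makes the count agree with division by zero.\<close>

lemma pt_num_div:
  assumes f: "pt_num f" and g: "pt_num g"
  shows "pt_num (\<lambda>x \<sigma>. f x \<sigma> div g x \<sigma>)"
proof -
  obtain K L where K: "\<forall>x \<sigma> y v. K \<le> y \<longrightarrow> f x (\<sigma>(y := v)) = f x \<sigma>"
    "\<forall>x \<sigma> y v. L \<le> y \<longrightarrow> g x (\<sigma>(y := v)) = g x \<sigma>"
    using pt_num_supportD[OF f] pt_num_supportD[OF g] by (elim exE)
  let ?y = "max K L"
  have y: "f x (\<sigma>(?y := v)) = f x \<sigma>" "g x (\<sigma>(?y := v)) = g x \<sigma>" for x \<sigma> v
    using K[rule_format, of ?y x \<sigma> v] by simp_all
  have "pt_test (\<lambda>x \<sigma>. 0 < g x \<sigma> \<and> (1 + \<sigma> ?y) * g x \<sigma> \<le> f x \<sigma>)"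
    by (intro pt_test_and pt_test_less pt_test_le pt_num_const pt_num_mult pt_num_add pt_num_var f g)
  from pt_num_sum[OF f this[unfolded pt_test_def], of ?y]
  have *: "pt_num (\<lambda>x \<sigma>. \<Sum>v<f x \<sigma>. of_bool (0 < g x \<sigma> \<and> Suc v * g x \<sigma> \<le> f x \<sigma>))"
    unfolding y fun_upd_same plus_1_eq_Suc .
  have "(\<Sum>v<a. of_bool (0 < b \<and> Suc v * b \<le> a)) = a div b" for a b :: nat
  proof (cases "b = 0")
    case False
    have "{v. v < a \<and> Suc v * b \<le> a} = {..<a div b}"
    proof -
      have "v < a \<and> Suc v * b \<le> a \<longleftrightarrow> v < a div b" for v
      proof -
        have "v < a div b \<longleftrightarrow> Suc v * b \<le> a"
          using False less_eq_div_iff_mult_less_eq[of b "Suc v" a] by (simp add: Suc_le_eq)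
        moreover have "Suc v \<le> Suc v * b"
          using False by (cases b) auto
        ultimately show ?thesis by linarith
      qed
      then show ?thesis by auto
    qed
    moreover have "(\<Sum>v<a. of_bool (Suc v * b \<le> a) :: nat) = card {v. v < a \<and> Suc v * b \<le> a}"
      by (simp add: of_bool_def sum.If_cases lessThan_def Int_def)
    ultimately show ?thesis
      using False by simp
  qed simp
  then show ?thesis
    using * by simp
qed

lemma pt_num_mod:
  assumes "pt_num f" "pt_num g"
  shows "pt_num (\<lambda>x \<sigma>. f x \<sigma> mod g x \<sigma>)"
  using pt_num_sub[OF assms(1) pt_num_mult[OF pt_num_div[OF assms] assms(2)]]
  by (simp only: minus_div_mult_eq_mod)

lemma pt_num_Suc: "pt_num f \<Longrightarrow> pt_num (\<lambda>x \<sigma>. Suc (f x \<sigma>))"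
  using pt_num_add[OF pt_num_const[of 1], of f] by (simp only: plus_1_eq_Suc)

lemma pt_num_poly: "pt_num f \<Longrightarrow> pt_num (\<lambda>x \<sigma>. poly p (f x \<sigma>))"
  by (induction p) (simp_all add: pt_num_const pt_num_add pt_num_mult)

lemma pt_test_ball_less:
  assumes "pt_num f" "pt_test P"
  shows "pt_test (\<lambda>x \<sigma>. \<forall>v<f x \<sigma>. P x (\<sigma>(y := v)))"
proof (rule pt_testI)
  show "pt_num (\<lambda>x \<sigma>. 1 - (\<Sum>v<f x \<sigma>. of_bool (\<not> P x (\<sigma>(y := v)))))"
    by (intro pt_num_sub pt_num_const pt_num_sum[where g = "\<lambda>x \<sigma>. of_bool (\<not> P x \<sigma>)"] pt_testD pt_test_not assms)
  have "of_bool (\<forall>v<n. Q v) = 1 - (\<Sum>v<n. of_bool (\<not> Q v) :: nat)" for n :: nat and Q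
  proof (cases "\<forall>v<n. Q v")
    case False
    then obtain v where "v < n" "\<not> Q v" by blast
    then have "0 < (\<Sum>v<n. of_bool (\<not> Q v) :: nat)"
      by (intro sum_pos2[of "{..<n}" v]) auto
    then show ?thesis using False by auto
  qed auto
  then show "of_bool (\<forall>v<f x \<sigma>. P x (\<sigma>(y := v))) = 1 - (\<Sum>v<f x \<sigma>. of_bool (\<not> P x (\<sigma>(y := v))) :: nat)" for x \<sigma>
    .
qed

lemmas pt_intros = pt_num_const pt_num_var pt_num_length pt_num_add pt_num_sub pt_num_mult pt_num_div pt_num_mod
  pt_num_Suc pt_num_poly pt_num_if pt_test_bit pt_test_not pt_test_and pt_test_or pt_test_imp
  pt_test_less pt_test_le pt_test_eq pt_test_const

text \<open>Powers of two become recognizable by a bounded search, as the positive numbers without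
  an odd divisor other than 1. The value \<open>d = 0\<close> does no harm because
  \<open>p mod 0 = p\<close>.\<close>

lemma is_power_of_2_iff:
  "(\<exists>i. p = 2 ^ i) \<longleftrightarrow> 0 < p \<and> (\<forall>d<Suc p. p mod d = 0 \<longrightarrow> d = 1 \<or> d mod 2 = 0)" for p :: nat
proof
  assume "\<exists>i. p = 2 ^ i"
  then obtain i where i: "p = 2 ^ i" by blast
  have "d = 1 \<or> even d" if "d dvd 2 ^ i" for d :: nat
  proof -
    have "\<exists>j. d = 2 ^ j"
      using that divides_primepow_nat[of 2 d i] by (auto simp: two_is_prime_nat)
    then obtain j where "d = 2 ^ j" by blast
    then show ?thesis by (cases j) auto
  qed
  then show "0 < p \<and> (\<forall>d<Suc p. p mod d = 0 \<longrightarrow> d = 1 \<or> d mod 2 = 0)"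
    unfolding i by (auto simp: mod_eq_0_iff_dvd)
next
  assume "0 < p \<and> (\<forall>d<Suc p. p mod d = 0 \<longrightarrow> d = 1 \<or> d mod 2 = 0)"
  then have p: "0 < p" "\<And>d. d dvd p \<Longrightarrow> d = 1 \<or> even d"
    using dvd_imp_le[of _ p] by (auto simp: mod_eq_0_iff_dvd less_Suc_eq_le)
  then show "\<exists>i. p = 2 ^ i"
  proof (induction p rule: less_induct)
    case (less p)
    show ?case
    proof (cases "p = 1")
      case True
      then show ?thesis by (intro exI[of _ 0]) simp
    next
      case False
      then obtain q where q: "p = 2 * q"
        using less.prems(2)[of p] by auto
      have "\<exists>i. q = 2 ^ i"
        using less.prems q by (intro less.IH) auto
      then show ?thesis
        using q by (metis power_Suc)
    qed
  qed
qed

lemma nat_bits_eq_map: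
  "m < 2 ^ k \<Longrightarrow> k = 0 \<or> 2 ^ (k - 1) \<le> m \<Longrightarrow> nat_bits m = map (\<lambda>i. odd (m div 2 ^ i)) [0..<k]"
proof (induction k arbitrary: m)
  case 0
  then show ?case by (simp add: nat_bits.simps)
next
  case (Suc k)
  have "0 < m"
    using Suc.prems(2) by (metis diff_Suc_1 nat.distinct(1) not_gr_zero not_less zero_less_numeral zero_less_power)
  moreover have "nat_bits (m div 2) = map (\<lambda>i. odd (m div 2 div 2 ^ i)) [0..<k]"
  proof (rule Suc.IH)
    show "m div 2 < 2 ^ k"
      using Suc.prems(1) by auto
    show "k = 0 \<or> 2 ^ (k - 1) \<le> m div 2"
      using Suc.prems(2) by (cases k) auto
  qed
  ultimately show ?case
    by (simp add: nat_bits.simps[of m] upt_conv_Cons map_Suc_upt[symmetric] div_mult2_eq comp_def del: upt_Suc)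
qed

text \<open>A loop over all \<open>p \<le> m\<close> that acts only at the place values replaces
  iterated halving, which bounded sums and loops do not offer directly. The loop is exponential in
  the number of digits but polynomial in the value of \<open>m\<close>.\<close>

lemma nat_bits_eq_concat:
  "nat_bits m = concat (map (\<lambda>p. if \<exists>i. p = 2 ^ i then [odd (m div p)] else []) [0..<Suc m])"
proof -
  obtain k where k: "m < 2 ^ k" "k = 0 \<or> 2 ^ (k - 1) \<le> m"
  proof -
    define k where "k = (LEAST k. m < 2 ^ k)"
    have "m < 2 ^ k"
      unfolding k_def by (rule LeastI[of _ m]) simp
    moreover have "k = 0 \<or> 2 ^ (k - 1) \<le> m"
      using not_less_Least[of "k - 1" "\<lambda>k. m < 2 ^ k"] by (cases k) (auto simp: k_def[symmetric])
    ultimately show thesis by (rule that)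
  qed
  have "filter (\<lambda>p. \<exists>i. p = 2 ^ i) [0..<Suc m] = map (\<lambda>i. 2 ^ i) [0..<k]"
  proof (rule strict_sorted_equal)
    show "sorted_wrt (<) (filter (\<lambda>p. \<exists>i. p = 2 ^ i) [0..<Suc m])"
      by (intro sorted_wrt_filter sorted_wrt_upt)
    show "sorted_wrt (<) (map (\<lambda>i. 2 ^ i :: nat) [0..<k])"
      by (simp add: sorted_wrt_map)
    have iff: "2 ^ i \<le> m \<longleftrightarrow> i < k" for i
    proof
      assume "2 ^ i \<le> m"
      then have "(2::nat) ^ i < 2 ^ k" using k(1) by (rule le_less_trans)
      then show "i < k" by simp
    next
      assume "i < k"
      then have "(2::nat) ^ i \<le> 2 ^ (k - 1)" by (intro power_increasing) auto
      also have "\<dots> \<le> m" using k(2) \<open>i < k\<close> by auto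
      finally show "2 ^ i \<le> m" .
    qed
    have "set (filter (\<lambda>p. \<exists>i. p = 2 ^ i) [0..<Suc m]) = {p. p \<le> m \<and> (\<exists>i. p = 2 ^ i)}"
      by (auto simp del: upt_Suc)
    also have "\<dots> = (\<lambda>i. 2 ^ i) ` {i. i < k}"
      unfolding iff[symmetric] by blast
    also have "\<dots> = set (map (\<lambda>i. 2 ^ i) [0..<k])"
      by (simp add: atLeast0LessThan lessThan_def)
    finally show "set (filter (\<lambda>p. \<exists>i. p = 2 ^ i) [0..<Suc m]) = set (map (\<lambda>i. 2 ^ i) [0..<k])" .
  qed
  then have "map (\<lambda>p. odd (m div p)) (filter (\<lambda>p. \<exists>i. p = 2 ^ i) [0..<Suc m]) = nat_bits m"
    unfolding nat_bits_eq_map[OF k] by (simp only: map_map comp_def)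
  moreover have "concat (map (\<lambda>p. if P p then [f p] else []) ps) = map f (filter P ps)" for P and f :: "nat \<Rightarrow> bool" and ps
    by (induction ps) auto
  ultimately show ?thesis
    by (simp only:)
qed

lemma pt_out_bit: "pt_test P \<Longrightarrow> pt_out (\<lambda>x \<sigma>. [P x \<sigma>])"
proof -
  assume P: "pt_test P"
  have "pt_out (\<lambda>x \<sigma>. (if of_bool (P x \<sigma>) \<noteq> (0::nat) then [True] else []) @ (if of_bool (\<not> P x \<sigma>) \<noteq> (0::nat) then [False] else []))"
    using P pt_test_not[OF P] unfolding pt_test_def
    by (intro pt_out_append pt_out_when pt_out_Cons pt_out_Nil)
  moreover have "(if of_bool b \<noteq> (0::nat) then [True] else []) @ (if of_bool (\<not> b) \<noteq> (0::nat) then [False] else []) = [b]" for b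
    by simp
  ultimately show ?thesis by simp
qed

lemma pt_out_encode_nat:
  assumes f: "pt_num f"
  shows "pt_out (\<lambda>x \<sigma>. encode_nat (f x \<sigma>))"
proof -
  obtain K where "\<forall>x \<sigma> y v. K \<le> y \<longrightarrow> f x (\<sigma>(y := v)) = f x \<sigma>"
    using pt_num_supportD[OF f] by (elim exE)
  then have K: "f x (\<sigma>(K := v)) = f x \<sigma>" for x \<sigma> v
    by blast
  have pow: "pt_test (\<lambda>x \<sigma>. \<exists>i. \<sigma> K = 2 ^ i)"
  proof -
    have "pt_test (\<lambda>x \<sigma>. \<sigma> K mod \<sigma> (Suc K) = 0 \<longrightarrow> \<sigma> (Suc K) = 1 \<or> \<sigma> (Suc K) mod 2 = 0)"
      by (intro pt_intros)
    from pt_test_ball_less[OF pt_num_Suc[OF pt_num_var[of K]] this, of "Suc K"]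
    have "pt_test (\<lambda>x \<sigma>. \<forall>d<Suc (\<sigma> K). \<sigma> K mod d = 0 \<longrightarrow> d = 1 \<or> d mod 2 = 0)"
      by simp
    from pt_test_and[OF pt_test_less[OF pt_num_const[of 0] pt_num_var[of K]] this] show ?thesis
      by (simp add: is_power_of_2_iff)
  qed
  have odd: "pt_test (\<lambda>x \<sigma>. odd (f x \<sigma> div \<sigma> K))"
  proof -
    have "pt_test (\<lambda>x \<sigma>. (f x \<sigma> div \<sigma> K) mod 2 = 1)"
      by (intro pt_intros f)
    then show ?thesis by (simp add: odd_iff_mod_2_eq_one)
  qed
  let ?digit = "\<lambda>x \<sigma>. if of_bool (\<exists>i. \<sigma> K = 2 ^ i) \<noteq> (0::nat) then True # [odd (f x \<sigma> div \<sigma> K)] else []"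
  have "pt_out ?digit"
    using pow unfolding pt_test_def by (intro pt_out_when pt_out_Cons pt_out_bit odd)
  from pt_out_append[OF pt_out_for[OF pt_num_Suc[OF f] this, of K] pt_out_Cons[OF pt_out_Nil, of False]]
  have *: "pt_out (\<lambda>x \<sigma>. concat (map (\<lambda>p. if \<exists>i. p = 2 ^ i then [True, odd (f x \<sigma> div p)] else []) [0..<Suc (f x \<sigma>)]) @ [False])"
    by (simp add: K cong: if_cong del: upt_Suc)
  have "concat (map (\<lambda>b. [True, b]) (concat (map (\<lambda>p. if P p then [q p] else []) ps))) =
      concat (map (\<lambda>p. if P p then [True, q p] else []) ps)" for P q and ps :: "nat list"
    by (induction ps) auto
  then show ?thesis
    using * unfolding encode_nat_def nat_bits_eq_concat by (simp del: upt_Suc)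
qed

lemma pt_out_matrix:
  assumes n: "pt_num (\<lambda>x \<sigma>. n x)" and D: "pt_num (\<lambda>x \<sigma>. D x)"
    and a: "pt_num (\<lambda>x \<sigma>. a x (\<sigma> 0) (\<sigma> 1))"
  shows "pt_out (\<lambda>x \<sigma>. encode_nat (n x) @
    concat (map (\<lambda>i. concat (map (\<lambda>j. encode_fraction (int (a x i j), D x)) [0..<n x])) [0..<n x]))"
proof -
  have "pt_out (\<lambda>x \<sigma>. encode_fraction (int (a x (\<sigma> 0) (\<sigma> 1)), D x))"
    unfolding encode_fraction_def encode_int_def
    using pt_out_Cons[OF pt_out_append[OF pt_out_encode_nat[OF a] pt_out_encode_nat[OF D]], of False] by simp
  from pt_out_for[OF n pt_out_for[OF n this, of 1], of 0]
  have "pt_out (\<lambda>x \<sigma>. concat (map (\<lambda>i. concat (map (\<lambda>j. encode_fraction (int (a x i j), D x)) [0..<n x])) [0..<n x]))"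
    by simp
  then show ?thesis
    by (intro pt_out_append pt_out_encode_nat n)
qed

text \<open>Closure under computable arguments is built in, which takes the place of a substitution
  theorem for functions of an environment.\<close>

definition pt_num2 :: "(bool list \<Rightarrow> nat \<Rightarrow> nat \<Rightarrow> nat) \<Rightarrow> bool" where
  "pt_num2 h \<longleftrightarrow> (\<forall>f g. pt_num f \<longrightarrow> pt_num g \<longrightarrow> pt_num (\<lambda>x \<sigma>. h x (f x \<sigma>) (g x \<sigma>)))"

definition pt_test2 :: "(bool list \<Rightarrow> nat \<Rightarrow> nat \<Rightarrow> bool) \<Rightarrow> bool" where
  "pt_test2 P \<longleftrightarrow> (\<forall>f g. pt_num f \<longrightarrow> pt_num g \<longrightarrow> pt_test (\<lambda>x \<sigma>. P x (f x \<sigma>) (g x \<sigma>)))"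

lemma pt_num2I: "(\<And>f g. pt_num f \<Longrightarrow> pt_num g \<Longrightarrow> pt_num (\<lambda>x \<sigma>. h x (f x \<sigma>) (g x \<sigma>))) \<Longrightarrow> pt_num2 h"
  by (simp add: pt_num2_def)

lemma pt_num2D: "pt_num2 h \<Longrightarrow> pt_num f \<Longrightarrow> pt_num g \<Longrightarrow> pt_num (\<lambda>x \<sigma>. h x (f x \<sigma>) (g x \<sigma>))"
  by (simp add: pt_num2_def)

lemma pt_test2I: "(\<And>f g. pt_num f \<Longrightarrow> pt_num g \<Longrightarrow> pt_test (\<lambda>x \<sigma>. P x (f x \<sigma>) (g x \<sigma>))) \<Longrightarrow> pt_test2 P"
  by (simp add: pt_test2_def)

lemma pt_test2D: "pt_test2 P \<Longrightarrow> pt_num f \<Longrightarrow> pt_num g \<Longrightarrow> pt_test (\<lambda>x \<sigma>. P x (f x \<sigma>) (g x \<sigma>))"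
  by (simp add: pt_test2_def)

section \<open>Uniform clause families\<close>

text \<open>A rule has one clause for every time \<open>t\<close> and position \<open>i\<close> that satisfy its guard. A literal
  consists of its sign, the kind of its variable (out of finitely many) and the time and the position
  of the variable in terms of \<open>t\<close> and \<open>i\<close>.\<close>

type_synonym literal = "bool \<times> nat \<times> (bool list \<Rightarrow> nat \<Rightarrow> nat \<Rightarrow> nat) \<times> (bool list \<Rightarrow> nat \<Rightarrow> nat \<Rightarrow> nat)"

type_synonym rule = "(bool list \<Rightarrow> nat \<Rightarrow> nat \<Rightarrow> bool) \<times> literal list"

definition rules_hold :: "rule list \<Rightarrow> bool list \<Rightarrow> nat \<Rightarrow> nat \<Rightarrow> (nat \<Rightarrow> nat \<Rightarrow> nat \<Rightarrow> bool) \<Rightarrow> bool" where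
  "rules_hold R x S W \<alpha> \<longleftrightarrow>
     (\<forall>r\<in>set R. \<forall>t<S. \<forall>i<W. fst r x t i \<longrightarrow>
        (\<exists>l\<in>set (snd r). case l of (b, \<kappa>, u, v) \<Rightarrow> \<alpha> \<kappa> (u x t i) (v x t i) = b))"

definition rule_in_range :: "bool list \<Rightarrow> nat \<Rightarrow> nat \<Rightarrow> nat \<Rightarrow> rule \<Rightarrow> bool" where
  "rule_in_range x K S W r \<longleftrightarrow>
     (\<forall>t<S. \<forall>i<W. fst r x t i \<longrightarrow>
        (\<forall>l\<in>set (snd r). case l of (b, \<kappa>, u, v) \<Rightarrow> \<kappa> < K \<and> u x t i < S \<and> v x t i < W))"

definition pt_rule :: "rule \<Rightarrow> bool" where
  "pt_rule r \<longleftrightarrow> pt_test2 (fst r) \<and> (\<forall>l\<in>set (snd r). case l of (b, \<kappa>, u, v) \<Rightarrow> pt_num2 u \<and> pt_num2 v)"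

definition var_index :: "nat \<Rightarrow> nat \<Rightarrow> nat \<Rightarrow> nat \<Rightarrow> nat \<Rightarrow> nat" where
  "var_index S W \<kappa> t i = (\<kappa> * S + t) * W + i"

lemma index_less:
  fixes K W :: nat
  shows "a < K \<Longrightarrow> i < W \<Longrightarrow> a * W + i < K * W"
proof -
  assume "a < K" "i < W"
  then have "a * W + i < (a + 1) * W" "(a + 1) * W \<le> K * W"
    using mult_le_mono1[of "a + 1" K W] by auto
  then show ?thesis by linarith
qed

lemma var_index_less: "\<kappa> < K \<Longrightarrow> t < S \<Longrightarrow> i < W \<Longrightarrow> var_index S W \<kappa> t i < K * S * W"
  unfolding var_index_def by (intro index_less)

lemma var_index_decode:
  assumes "t < S" "i < W"
  shows "var_index S W \<kappa> t i mod W = i" "var_index S W \<kappa> t i div W mod S = t"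
    "var_index S W \<kappa> t i div W div S = \<kappa>"
  using assms by (simp_all add: var_index_def)

text \<open>Literal \<open>2 v\<close> is the variable \<open>v\<close> and literal \<open>2 v + 1\<close> its negation. The clause of a violated
  guard contains all literals.\<close>

definition in_clause :: "rule list \<Rightarrow> (bool list \<Rightarrow> nat) \<Rightarrow> (bool list \<Rightarrow> nat) \<Rightarrow> bool list \<Rightarrow> nat \<Rightarrow> nat \<Rightarrow> bool" where
  "in_clause R S W x j l \<longleftrightarrow>
     (\<exists>m\<in>{..<length R}. j div W x div S x = m \<and>
        (\<not> fst (R ! m) x (j div W x mod S x) (j mod W x) \<or>
         (\<exists>(b, \<kappa>, u, v)\<in>set (snd (R ! m)).
            l = 2 * var_index (S x) (W x) \<kappa> (u x (j div W x mod S x) (j mod W x)) (v x (j div W x mod S x) (j mod W x))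
                + of_bool (\<not> b))))"

lemma pt_test_in_clause:
  assumes R: "\<forall>r\<in>set R. pt_rule r" and S: "pt_num (\<lambda>x \<sigma>. S x)" and W: "pt_num (\<lambda>x \<sigma>. W x)"
    and f: "pt_num f" and g: "pt_num g"
  shows "pt_test (\<lambda>x \<sigma>. in_clause R S W x (f x \<sigma>) (g x \<sigma>))"
  unfolding in_clause_def
proof (intro pt_test_finite_ex pt_test_and pt_test_eq pt_test_or pt_test_not pt_num_div f W S pt_num_const)
  fix m assume "m \<in> {..<length R}"
  then have m: "pt_rule (R ! m)"
    using R by simp
  have t: "pt_num (\<lambda>x \<sigma>. f x \<sigma> div W x mod S x)" and i: "pt_num (\<lambda>x \<sigma>. f x \<sigma> mod W x)"
    by (intro pt_num_mod pt_num_div f S W)+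
  show "pt_test (\<lambda>x \<sigma>. fst (R ! m) x (f x \<sigma> div W x mod S x) (f x \<sigma> mod W x))"
    using m unfolding pt_rule_def by (intro pt_test2D[OF _ t i]) auto
  fix l assume l: "l \<in> set (snd (R ! m))"
  obtain b \<kappa> u v where l_eq: "l = (b, \<kappa>, u, v)" by (cases l)
  then have "pt_num2 u" "pt_num2 v"
    using m l unfolding pt_rule_def by auto
  then have "pt_test (\<lambda>x \<sigma>. g x \<sigma> = 2 * ((\<kappa> * S x + u x (f x \<sigma> div W x mod S x) (f x \<sigma> mod W x)) * W x
      + v x (f x \<sigma> div W x mod S x) (f x \<sigma> mod W x)) + of_bool (\<not> b))"
    by (intro pt_test_eq g pt_num_add pt_num_mult pt_num_const S W pt_num2D[OF _ t i])
  then show "pt_test (\<lambda>x \<sigma>. case l of (b, \<kappa>, u, v) \<Rightarrow> g x \<sigma> = 2 * var_index (S x) (W x) \<kappa> (u x (f x \<sigma> div W x mod S x) (f x \<sigma> mod W x))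
      (v x (f x \<sigma> div W x mod S x) (f x \<sigma> mod W x)) + of_bool (\<not> b))"
    by (simp only: l_eq prod.case var_index_def)
qed auto

lemma rules_satisfiable_iff:
  assumes range: "\<forall>r\<in>set R. rule_in_range x K (S x) (W x) r" and pos: "0 < K" "0 < S x" "0 < W x"
  shows "(\<exists>\<alpha>. rules_hold R x (S x) (W x) \<alpha>) \<longleftrightarrow>
    (\<exists>\<beta>. \<forall>j<length R * S x * W x. \<exists>l<2 * (K * S x * W x). in_clause R S W x j l \<and> (\<beta> (l div 2) \<longleftrightarrow> even l))"
    (is "_ \<longleftrightarrow> (\<exists>\<beta>. ?sat \<beta>)")
proof
  assume "\<exists>\<alpha>. rules_hold R x (S x) (W x) \<alpha>"
  then obtain \<alpha> where \<alpha>: "rules_hold R x (S x) (W x) \<alpha>" by blast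
  define \<beta> where "\<beta> v = \<alpha> (v div W x div S x) (v div W x mod S x) (v mod W x)" for v
  have "?sat \<beta>"
  proof (intro allI impI)
    fix j assume j: "j < length R * S x * W x"
    define m t i where "m = j div W x div S x" and "t = j div W x mod S x" and "i = j mod W x"
    have "j div W x < length R * S x"
      using j by (simp add: less_mult_imp_div_less)
    then have m: "m < length R"
      by (simp add: m_def less_mult_imp_div_less)
    have t: "t < S x" and i: "i < W x"
      using pos by (simp_all add: t_def i_def)
    show "\<exists>l<2 * (K * S x * W x). in_clause R S W x j l \<and> (\<beta> (l div 2) \<longleftrightarrow> even l)"
    proof (cases "fst (R ! m) x t i")
      case True
      then obtain l where l: "l \<in> set (snd (R ! m))" "case l of (b, \<kappa>, u, v) \<Rightarrow> \<alpha> \<kappa> (u x t i) (v x t i) = b"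
        using \<alpha> m t i unfolding rules_hold_def by (meson nth_mem)
      obtain b \<kappa> u v where l_eq: "l = (b, \<kappa>, u, v)" by (cases l)
      have *: "\<kappa> < K" "u x t i < S x" "v x t i < W x"
      proof -
        have "rule_in_range x K (S x) (W x) (R ! m)"
          using range m by simp
        then have "case l of (b, \<kappa>, u, v) \<Rightarrow> \<kappa> < K \<and> u x t i < S x \<and> v x t i < W x"
          using t i True l(1) unfolding rule_in_range_def by blast
        then show "\<kappa> < K" "u x t i < S x" "v x t i < W x"
          by (simp_all add: l_eq)
      qed
      let ?v = "var_index (S x) (W x) \<kappa> (u x t i) (v x t i)"
      have "?v < K * S x * W x"
        using * by (rule var_index_less)
      moreover have "in_clause R S W x j (2 * ?v + of_bool (\<not> b))"
        unfolding in_clause_def m_def[symmetric] t_def[symmetric] i_def[symmetric]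
        by (intro bexI[of _ m] conjI refl disjI2 bexI[of _ l]) (use m l(1) in \<open>simp_all add: l_eq\<close>)
      moreover have "\<beta> ?v = b"
        using l(2) var_index_decode[OF *(2,3)] by (simp add: \<beta>_def l_eq)
      ultimately show ?thesis
        by (intro exI[of _ "2 * ?v + of_bool (\<not> b)"]) auto
    next
      case False
      then have "in_clause R S W x j l" for l
        unfolding in_clause_def m_def[symmetric] t_def[symmetric] i_def[symmetric]
        using m by blast
      moreover have "1 < 2 * (K * S x * W x)"
      proof -
        have "0 < K * S x * W x" using pos by simp
        then show ?thesis by linarith
      qed
      \<comment> \<open>The clause of a violated guard contains both literals of variable 0, and one
        of them is true.\<close>
      ultimately show ?thesis
        using pos by (intro exI[of _ "of_bool (\<not> \<beta> 0)"]) auto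
    qed
  qed
  then show "\<exists>\<beta>. ?sat \<beta>" by blast
next
  assume "\<exists>\<beta>. ?sat \<beta>"
  then obtain \<beta> where \<beta>: "?sat \<beta>" by blast
  define \<alpha> where "\<alpha> \<kappa> t i = \<beta> (var_index (S x) (W x) \<kappa> t i)" for \<kappa> t i
  have "rules_hold R x (S x) (W x) \<alpha>"
    unfolding rules_hold_def
  proof (intro ballI allI impI)
    fix r t i assume "r \<in> set R" and t: "t < S x" and i: "i < W x" and r: "fst r x t i"
    then obtain m where m: "m < length R" "R ! m = r"
      by (meson in_set_conv_nth)
    define j where "j = var_index (S x) (W x) m t i"
    note dec = var_index_decode[OF t i, of m, folded j_def]
    have "j < length R * S x * W x"
      unfolding j_def using m(1) t i by (rule var_index_less)
    then obtain l where l: "in_clause R S W x j l" "\<beta> (l div 2) \<longleftrightarrow> even l"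
      using \<beta> by blast
    then obtain b \<kappa> u v where "(b, \<kappa>, u, v) \<in> set (snd r)"
      "l = 2 * var_index (S x) (W x) \<kappa> (u x t i) (v x t i) + of_bool (\<not> b)"
      using r m unfolding in_clause_def dec by auto
    then show "\<exists>l\<in>set (snd r). case l of (b, \<kappa>, u, v) \<Rightarrow> \<alpha> \<kappa> (u x t i) (v x t i) = b"
      using l(2) by (intro bexI[of _ "(b, \<kappa>, u, v)"]) (auto simp: \<alpha>_def)
  qed
  then show "\<exists>\<alpha>. rules_hold R x (S x) (W x) \<alpha>" by blast
qed

section \<open>Clauses describing a computation\<close>

definition literal_holds :: "bool list \<Rightarrow> nat \<Rightarrow> nat \<Rightarrow> (nat \<Rightarrow> nat \<Rightarrow> nat \<Rightarrow> bool) \<Rightarrow> literal \<Rightarrow> bool" where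
  "literal_holds x t i \<alpha> l = (case l of (b, \<kappa>, u, v) \<Rightarrow> \<alpha> \<kappa> (u x t i) (v x t i) = b)"

lemma literal_holds_simp [simp]: "literal_holds x t i \<alpha> (b, \<kappa>, u, v) \<longleftrightarrow> (\<alpha> \<kappa> (u x t i) (v x t i) \<longleftrightarrow> b)"
  by (simp add: literal_holds_def)

definition rule_holds :: "bool list \<Rightarrow> nat \<Rightarrow> nat \<Rightarrow> (nat \<Rightarrow> nat \<Rightarrow> nat \<Rightarrow> bool) \<Rightarrow> rule \<Rightarrow> bool" where
  "rule_holds x S W \<alpha> r \<longleftrightarrow>
     (\<forall>t<S. \<forall>i<W. fst r x t i \<longrightarrow> (\<exists>l\<in>set (snd r). literal_holds x t i \<alpha> l))"

lemma rules_hold_iff: "rules_hold R x S W \<alpha> \<longleftrightarrow> (\<forall>r\<in>set R. rule_holds x S W \<alpha> r)"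
  by (simp add: rules_hold_def rule_holds_def literal_holds_def)

text \<open>Position, relative to the head before the move, of the cell that is at relative position
  \<open>i\<close> after it. Measured this way the head is always in the middle, and a head movement
  shifts all cells by the same amount.\<close>

fun source :: "direction \<Rightarrow> nat \<Rightarrow> nat" where
  "source Move_Left i = i - 1"
| "source Stay i = i"
| "source Move_Right i = Suc i"

lemma pt_num_source: "pt_num f \<Longrightarrow> pt_num (\<lambda>x \<sigma>. source d (f x \<sigma>))"
  by (cases d) (simp_all add: pt_num_sub pt_num_const pt_num_Suc del: One_nat_def)

lemma ball_concat_map: "(\<forall>r\<in>set (concat (map f xs)). P r) \<longleftrightarrow> (\<forall>y\<in>set xs. \<forall>r\<in>set (f y). P r)"
  by auto

locale verifier =
  fixes M :: tm and p q :: "nat poly"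
  assumes tm: "turing_machine M" and two_tapes: "2 \<le> tapes M"
begin

definition T :: "bool list \<Rightarrow> nat" where
  "T x = poly p (length x + poly q (length x))"

text \<open>The computation is unfolded for \<open>T x\<close> steps; position \<open>i\<close> of a tape stands for the cell
  \<open>i - T x\<close> relative to the head.\<close>

definition W :: "bool list \<Rightarrow> nat" where
  "W x = 2 * T x + 1"

text \<open>The halting state repeats its configuration, so that every run can be unfolded for
  exactly \<open>T x\<close> steps.\<close>

definition act_of :: "nat \<Rightarrow> nat list \<Rightarrow> nat \<times> (nat \<times> direction) list" where
  "act_of s as = (if s = states M then (s, map (\<lambda>a. (a, Stay)) as) else delta M s as)"

text \<open>The kinds up to \<open>states M\<close> are the states (with position 0), the others pairs of a tape and a
  symbol.\<close>

definition cell :: "nat \<Rightarrow> nat \<Rightarrow> nat" where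
  "cell j a = Suc (states M) + j * symbols M + a"

definition kinds :: nat where
  "kinds = Suc (states M) + tapes M * symbols M"

text \<open>The bound on the position is repeated next to the bit because the computable bit test
  has this form.\<close>

definition init_symbol :: "nat \<Rightarrow> bool list \<Rightarrow> nat \<Rightarrow> nat" where
  "init_symbol j x i =
     (if j = 0 \<and> T x \<le> i \<and> i - T x < length x
      then (if i - T x < length x \<and> x ! (i - T x) then 2 else 1) else 0)"

definition step_faithful :: "bool list \<Rightarrow> (nat \<Rightarrow> nat \<Rightarrow> nat \<Rightarrow> bool) \<Rightarrow> nat \<Rightarrow> nat \<Rightarrow> nat list \<Rightarrow> bool" where
  "step_faithful x \<alpha> t s as \<longleftrightarrow>
     \<alpha> (fst (act_of s as)) (Suc t) 0 \<and>
     (\<forall>j<tapes M. \<forall>i. 1 \<le> i \<longrightarrow> Suc i < W x \<longrightarrow>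
        (source (snd (snd (act_of s as) ! j)) i = T x \<longrightarrow> \<alpha> (cell j (fst (snd (act_of s as) ! j))) (Suc t) i) \<and>
        (source (snd (snd (act_of s as) ! j)) i \<noteq> T x \<longrightarrow>
           (\<forall>a<symbols M. \<alpha> (cell j a) t (source (snd (snd (act_of s as) ! j)) i) \<longrightarrow> \<alpha> (cell j a) (Suc t) i)))"

text \<open>Apart from the last condition, which excludes every final symbol other than 2, symbols
  are only forced to be true. An assignment may thus contain more than a run; it suffices that it
  contains some run. Blanks on the witness tape propagate to the right, so that the cells before the
  first blank form one string.\<close>

definition faithful :: "bool list \<Rightarrow> (nat \<Rightarrow> nat \<Rightarrow> nat \<Rightarrow> bool) \<Rightarrow> bool" where
  "faithful x \<alpha> \<longleftrightarrow>
     \<alpha> 0 0 0 \<and>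
     (\<forall>j<tapes M. j \<noteq> 1 \<longrightarrow> (\<forall>i<W x. \<alpha> (cell j (init_symbol j x i)) 0 i)) \<and>
     (\<forall>i<W x. \<not> (T x \<le> i \<and> i - T x < poly q (length x)) \<longrightarrow> \<alpha> (cell 1 0) 0 i) \<and>
     (\<forall>i<W x. T x \<le> i \<and> i - T x < poly q (length x) \<longrightarrow> (\<exists>a\<in>{0, 1, 2}. \<alpha> (cell 1 a) 0 i)) \<and>
     (\<forall>i. T x \<le> i \<longrightarrow> Suc i < W x \<longrightarrow> \<alpha> (cell 1 0) 0 i \<longrightarrow> \<alpha> (cell 1 0) 0 (Suc i)) \<and>
     (\<forall>t<T x. \<forall>s\<le>states M. \<forall>as\<in>set (List.n_lists (tapes M) [0..<symbols M]).
        \<alpha> s t 0 \<longrightarrow> (\<forall>j<tapes M. \<alpha> (cell j (as ! j)) t (T x)) \<longrightarrow> step_faithful x \<alpha> t s as) \<and>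
     (\<forall>a<symbols M. a \<noteq> 2 \<longrightarrow> \<not> \<alpha> (cell 0 a) (T x) (T x))"

abbreviation (input) "now \<equiv> \<lambda>x t i. t"
abbreviation (input) "later \<equiv> \<lambda>x t i. Suc t"
abbreviation (input) "here \<equiv> \<lambda>x t i. i"
abbreviation (input) "head \<equiv> \<lambda>x t i. T x"

definition premise :: "nat \<Rightarrow> nat list \<Rightarrow> literal list" where
  "premise s as = (False, s, now, \<lambda>x t i. 0) # map (\<lambda>j. (False, cell j (as ! j), now, head)) [0..<tapes M]"

definition move_rules :: "nat \<Rightarrow> nat list \<Rightarrow> nat \<Rightarrow> nat \<Rightarrow> direction \<Rightarrow> rule list" where
  "move_rules s as j b d =
     (\<lambda>x t i. t < T x \<and> 1 \<le> i \<and> Suc i < W x \<and> source d i = T x, premise s as @ [(True, cell j b, later, here)]) #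
     map (\<lambda>a. (\<lambda>x t i. t < T x \<and> 1 \<le> i \<and> Suc i < W x \<and> source d i \<noteq> T x,
               premise s as @ [(False, cell j a, now, \<lambda>x t i. source d i), (True, cell j a, later, here)]))
         [0..<symbols M]"

definition step_rules :: "nat \<Rightarrow> nat list \<Rightarrow> rule list" where
  "step_rules s as =
     (\<lambda>x t i. t < T x, premise s as @ [(True, fst (act_of s as), later, \<lambda>x t i. 0)]) #
     concat (map (\<lambda>j. move_rules s as j (fst (snd (act_of s as) ! j)) (snd (snd (act_of s as) ! j))) [0..<tapes M])"

definition input_rules :: "rule list" where
  "input_rules = concat (map (\<lambda>j. map (\<lambda>a. (\<lambda>x t i. t = 0 \<and> init_symbol j x i = a, [(True, cell j a, now, here)]))
       [0..<symbols M]) (filter (\<lambda>j. j \<noteq> 1) [0..<tapes M]))"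

definition witness_rules :: "rule list" where
  "witness_rules =
     [(\<lambda>x t i. t = 0 \<and> \<not> (T x \<le> i \<and> i - T x < poly q (length x)), [(True, cell 1 0, now, here)]),
      (\<lambda>x t i. t = 0 \<and> T x \<le> i \<and> i - T x < poly q (length x), map (\<lambda>a. (True, cell 1 a, now, here)) [0, 1, 2]),
      (\<lambda>x t i. t = 0 \<and> T x \<le> i \<and> Suc i < W x, [(False, cell 1 0, now, here), (True, cell 1 0, now, \<lambda>x t i. Suc i)])]"

definition accept_rules :: "rule list" where
  "accept_rules = map (\<lambda>a. (\<lambda>x t i. t = T x, [(False, cell 0 a, now, head)])) (filter (\<lambda>a. a \<noteq> 2) [0..<symbols M])"

definition rules :: "rule list" where
  "rules = (\<lambda>x t i. t = 0, [(True, 0, now, \<lambda>x t i. 0)]) # input_rules @ witness_rules @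
     concat (map (\<lambda>s. concat (map (step_rules s) (List.n_lists (tapes M) [0..<symbols M]))) [0..<Suc (states M)]) @
     accept_rules"

lemma premise_holds:
  "(\<exists>l\<in>set (premise s as @ ls). literal_holds x t i \<alpha> l) \<longleftrightarrow>
     (\<alpha> s t 0 \<longrightarrow> (\<forall>j<tapes M. \<alpha> (cell j (as ! j)) t (T x)) \<longrightarrow> (\<exists>l\<in>set ls. literal_holds x t i \<alpha> l))"
  unfolding premise_def set_append bex_Un list.set bex_simps set_map literal_holds_simp set_upt
  by auto

lemma W_pos: "0 < W x" "T x < W x"
  by (simp_all add: W_def)

lemma symbols_ge_3: "3 \<le> symbols M"
  using tm by (simp add: turing_machine_def)

lemma init_symbol_less: "init_symbol j x i < symbols M"
  using symbols_ge_3 by (simp add: init_symbol_def)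

lemma step_rules_hold:
  "(\<forall>r\<in>set (step_rules s as). rule_holds x (Suc (T x)) (W x) \<alpha> r) \<longleftrightarrow>
     (\<forall>t<T x. \<alpha> s t 0 \<longrightarrow> (\<forall>j<tapes M. \<alpha> (cell j (as ! j)) t (T x)) \<longrightarrow> step_faithful x \<alpha> t s as)"
    (is "?lhs \<longleftrightarrow> (\<forall>t<T x. ?prem t \<longrightarrow> ?all t \<longrightarrow> _)")
proof -
  have state: "rule_holds x (Suc (T x)) (W x) \<alpha> (\<lambda>x t i. t < T x, premise s as @ [(True, fst (act_of s as), later, \<lambda>x t i. 0)])
    \<longleftrightarrow> (\<forall>t<T x. ?prem t \<longrightarrow> ?all t \<longrightarrow> \<alpha> (fst (act_of s as)) (Suc t) 0)"
    unfolding rule_holds_def snd_conv fst_conv premise_holds using W_pos(1)[of x]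
    by (auto simp: less_Suc_eq)
  have move: "(\<forall>r\<in>set (move_rules s as j b d). rule_holds x (Suc (T x)) (W x) \<alpha> r) \<longleftrightarrow>
    (\<forall>t<T x. ?prem t \<longrightarrow> ?all t \<longrightarrow> (\<forall>i. 1 \<le> i \<longrightarrow> Suc i < W x \<longrightarrow>
        (source d i = T x \<longrightarrow> \<alpha> (cell j b) (Suc t) i) \<and>
        (source d i \<noteq> T x \<longrightarrow> (\<forall>a<symbols M. \<alpha> (cell j a) t (source d i) \<longrightarrow> \<alpha> (cell j a) (Suc t) i))))"
    (is "_ \<longleftrightarrow> ?rhs") for j b d
  proof -
    have at_head: "rule_holds x (Suc (T x)) (W x) \<alpha> (\<lambda>x t i. t < T x \<and> 1 \<le> i \<and> Suc i < W x \<and> source d i = T x, premise s as @ [(True, cell j b, later, here)])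
      \<longleftrightarrow> (\<forall>t<T x. \<forall>i. 1 \<le> i \<longrightarrow> Suc i < W x \<longrightarrow> source d i = T x \<longrightarrow> ?prem t \<longrightarrow> ?all t \<longrightarrow> \<alpha> (cell j b) (Suc t) i)"
      unfolding rule_holds_def snd_conv fst_conv premise_holds
      by (auto simp: less_Suc_eq dest: Suc_lessD)
    have keep: "rule_holds x (Suc (T x)) (W x) \<alpha> (\<lambda>x t i. t < T x \<and> 1 \<le> i \<and> Suc i < W x \<and> source d i \<noteq> T x, premise s as @ [(False, cell j a, now, \<lambda>x t i. source d i), (True, cell j a, later, here)])
      \<longleftrightarrow> (\<forall>t<T x. \<forall>i. 1 \<le> i \<longrightarrow> Suc i < W x \<longrightarrow> source d i \<noteq> T x \<longrightarrow> ?prem t \<longrightarrow> ?all t \<longrightarrow> \<alpha> (cell j a) t (source d i) \<longrightarrow> \<alpha> (cell j a) (Suc t) i)" for a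
      unfolding rule_holds_def snd_conv fst_conv premise_holds
      by (auto simp: less_Suc_eq dest: Suc_lessD)
    show ?thesis
      unfolding move_rules_def list.set set_map ball_simps set_upt at_head keep by (auto simp del: One_nat_def)
  qed
  have distrib: "(\<forall>t<n. P t \<longrightarrow> Q t \<longrightarrow> A t) \<and> (\<forall>j\<in>{0..<k}. \<forall>t<n. P t \<longrightarrow> Q t \<longrightarrow> B j t) \<longleftrightarrow>
      (\<forall>t<n. P t \<longrightarrow> Q t \<longrightarrow> A t \<and> (\<forall>j<k. B j t))" for n k :: nat and P Q A B
    by auto
  show ?thesis
    unfolding step_rules_def list.set ball_simps state ball_concat_map move step_faithful_def set_upt
    by (rule distrib)
qed

lemma rules_hold_rules: "rules_hold rules x (Suc (T x)) (W x) \<alpha> \<longleftrightarrow> faithful x \<alpha>"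
proof -
  have init: "rule_holds x (Suc (T x)) (W x) \<alpha> (\<lambda>x t i. t = 0, [(True, 0, now, \<lambda>x t i. 0)]) \<longleftrightarrow> \<alpha> 0 0 0"
    using W_pos(1)[of x] by (auto simp: rule_holds_def)
  have input: "(\<forall>r\<in>set input_rules. rule_holds x (Suc (T x)) (W x) \<alpha> r) \<longleftrightarrow>
      (\<forall>j<tapes M. j \<noteq> 1 \<longrightarrow> (\<forall>i<W x. \<alpha> (cell j (init_symbol j x i)) 0 i))"
  proof -
    have "rule_holds x (Suc (T x)) (W x) \<alpha> (\<lambda>x t i. t = 0 \<and> init_symbol j x i = a, [(True, cell j a, now, here)])
        \<longleftrightarrow> (\<forall>i<W x. init_symbol j x i = a \<longrightarrow> \<alpha> (cell j a) 0 i)" for j a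
      by (auto simp: rule_holds_def)
    then have "(\<forall>r\<in>set input_rules. rule_holds x (Suc (T x)) (W x) \<alpha> r) \<longleftrightarrow>
        (\<forall>j. j < tapes M \<and> j \<noteq> 1 \<longrightarrow> (\<forall>a<symbols M. \<forall>i<W x. init_symbol j x i = a \<longrightarrow> \<alpha> (cell j a) 0 i))"
      unfolding input_rules_def ball_concat_map set_map ball_simps set_filter set_upt by auto
    then show ?thesis
      using init_symbol_less by metis
  qed
  have witness: "(\<forall>r\<in>set witness_rules. rule_holds x (Suc (T x)) (W x) \<alpha> r) \<longleftrightarrow>
     (\<forall>i<W x. \<not> (T x \<le> i \<and> i - T x < poly q (length x)) \<longrightarrow> \<alpha> (cell 1 0) 0 i) \<and>
     (\<forall>i<W x. T x \<le> i \<and> i - T x < poly q (length x) \<longrightarrow> (\<exists>a\<in>{0, 1, 2}. \<alpha> (cell 1 a) 0 i)) \<and>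
     (\<forall>i. T x \<le> i \<longrightarrow> Suc i < W x \<longrightarrow> \<alpha> (cell 1 0) 0 i \<longrightarrow> \<alpha> (cell 1 0) 0 (Suc i))"
    unfolding witness_rules_def list.set ball_simps rule_holds_def fst_conv snd_conv set_map bex_simps
    by (auto dest: Suc_lessD)
  have accept: "(\<forall>r\<in>set accept_rules. rule_holds x (Suc (T x)) (W x) \<alpha> r) \<longleftrightarrow>
     (\<forall>a<symbols M. a \<noteq> 2 \<longrightarrow> \<not> \<alpha> (cell 0 a) (T x) (T x))"
    using W_pos[of x] by (auto simp: accept_rules_def rule_holds_def)
  have steps: "(\<forall>r\<in>set (concat (map (\<lambda>s. concat (map (step_rules s) (List.n_lists (tapes M) [0..<symbols M]))) [0..<Suc (states M)])). rule_holds x (Suc (T x)) (W x) \<alpha> r) \<longleftrightarrow>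
     (\<forall>t<T x. \<forall>s\<le>states M. \<forall>as\<in>set (List.n_lists (tapes M) [0..<symbols M]).
        \<alpha> s t 0 \<longrightarrow> (\<forall>j<tapes M. \<alpha> (cell j (as ! j)) t (T x)) \<longrightarrow> step_faithful x \<alpha> t s as)" (is "?l \<longleftrightarrow> ?r")
  proof -
    have "?l \<longleftrightarrow> (\<forall>s<Suc (states M). \<forall>as\<in>set (List.n_lists (tapes M) [0..<symbols M]).
        \<forall>r\<in>set (step_rules s as). rule_holds x (Suc (T x)) (W x) \<alpha> r)"
      unfolding ball_concat_map set_upt by auto
    also have "\<dots> \<longleftrightarrow> ?r"
      unfolding step_rules_hold less_Suc_eq_le by blast
    finally show ?thesis .
  qed
  show ?thesis
    unfolding rules_hold_iff rules_def list.set set_append ball_simps ball_Un init input witness accept steps faithful_def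
    by blast
qed

end

section \<open>Computability of the clauses\<close>

context verifier
begin

lemma pt_num_T: "pt_num (\<lambda>x \<sigma>. T x)" and pt_num_W: "pt_num (\<lambda>x \<sigma>. W x)"
proof -
  show "pt_num (\<lambda>x \<sigma>. T x)"
    unfolding T_def by (intro pt_num_poly pt_num_add pt_num_length)
  then show "pt_num (\<lambda>x \<sigma>. W x)"
    unfolding W_def by (intro pt_num_mult pt_num_add pt_num_const)
qed

lemma pt_terms:
  "pt_num2 now" "pt_num2 later" "pt_num2 here" "pt_num2 head" "pt_num2 (\<lambda>x t i. 0)"
  "pt_num2 (\<lambda>x t i. Suc i)" "pt_num2 (\<lambda>x t i. source d i)"
  by (intro pt_num2I pt_num_T pt_num_const pt_num_Suc pt_num_source; assumption)+

lemma cell_less: "j < tapes M \<Longrightarrow> a < symbols M \<Longrightarrow> cell j a < kinds"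
  using index_less[of j "tapes M" a "symbols M"] by (simp add: cell_def kinds_def)

lemma act_of:
  assumes "s \<le> states M" "as \<in> set (List.n_lists (tapes M) [0..<symbols M])"
  shows "fst (act_of s as) \<le> states M" "length (snd (act_of s as)) = tapes M"
    "j < tapes M \<Longrightarrow> fst (snd (act_of s as) ! j) < symbols M"
proof -
  have as: "length as = tapes M" "\<forall>a\<in>set as. a < symbols M"
    using assms(2) by (auto simp: set_n_lists)
  show "fst (act_of s as) \<le> states M" and len: "length (snd (act_of s as)) = tapes M"
    using assms(1) as tm by (auto simp: act_of_def turing_machine_def)
  show "fst (snd (act_of s as) ! j) < symbols M" if j: "j < tapes M"
  proof (cases "s = states M")
    case True
    then show ?thesis using as j by (simp add: act_of_def)
  next
    case False
    then have "s < states M"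
      using assms(1) by simp
    then have "\<forall>(b, d)\<in>set (snd (delta M s as)). b < symbols M"
      using tm as unfolding turing_machine_def by blast
    moreover have "snd (act_of s as) ! j \<in> set (snd (delta M s as))"
      using False j len by (simp add: act_of_def)
    ultimately show ?thesis by (auto simp: case_prod_beta)
  qed
qed

lemma n_listsD:
  assumes "as \<in> set (List.n_lists (tapes M) [0..<symbols M])"
  shows "length as = tapes M" "j < tapes M \<Longrightarrow> as ! j < symbols M"
proof -
  have as: "length as = tapes M" "set as \<subseteq> {0..<symbols M}"
    using assms by (auto simp: set_n_lists)
  then show "length as = tapes M" "j < tapes M \<Longrightarrow> as ! j < symbols M"
    using subsetD[OF as(2) nth_mem[of j as]] by auto
qed

definition good_rule :: "rule \<Rightarrow> bool" where
  "good_rule r \<longleftrightarrow> pt_rule r \<and> (\<forall>x. rule_in_range x kinds (Suc (T x)) (W x) r)"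

lemma good_ruleI:
  assumes "pt_test2 g" "\<forall>l\<in>set ls. case l of (b, \<kappa>, u, v) \<Rightarrow> pt_num2 u \<and> pt_num2 v"
    and "\<And>x t i. t \<le> T x \<Longrightarrow> i < W x \<Longrightarrow> g x t i \<Longrightarrow>
      \<forall>l\<in>set ls. case l of (b, \<kappa>, u, v) \<Rightarrow> \<kappa> < kinds \<and> u x t i \<le> T x \<and> v x t i < W x"
  shows "good_rule (g, ls)"
  unfolding good_rule_def pt_rule_def rule_in_range_def using assms by (simp add: less_Suc_eq_le)

lemma state_less: "s \<le> states M \<Longrightarrow> s < kinds"
  by (simp add: kinds_def)

lemma source_less: "1 \<le> i \<Longrightarrow> Suc i < W x \<Longrightarrow> source d i < W x"
  by (cases d) auto

lemma good_premise:
  assumes "s \<le> states M" "as \<in> set (List.n_lists (tapes M) [0..<symbols M])"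
  shows "\<forall>l\<in>set (premise s as). case l of (b, \<kappa>, u, v) \<Rightarrow> pt_num2 u \<and> pt_num2 v"
    and "t \<le> T x \<Longrightarrow> \<forall>l\<in>set (premise s as). case l of (b, \<kappa>, u, v) \<Rightarrow> \<kappa> < kinds \<and> u x t i \<le> T x \<and> v x t i < W x"
proof -
  note as = n_listsD(2)[OF assms(2)]
  show "\<forall>l\<in>set (premise s as). case l of (b, \<kappa>, u, v) \<Rightarrow> pt_num2 u \<and> pt_num2 v"
    unfolding premise_def list.set set_map ball_simps prod.case by (simp add: pt_terms)
  show "\<forall>l\<in>set (premise s as). case l of (b, \<kappa>, u, v) \<Rightarrow> \<kappa> < kinds \<and> u x t i \<le> T x \<and> v x t i < W x" if "t \<le> T x"
    unfolding premise_def list.set set_map ball_simps prod.case set_upt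
    using that W_pos state_less[OF assms(1)] cell_less as by simp
qed

lemma good_rules: "\<forall>r\<in>set rules. good_rule r"
proof -
  note pt = pt_test2I pt_test_and pt_test_not pt_test_eq pt_test_le pt_test_less pt_num_sub pt_num_Suc
    pt_num_const pt_num_length pt_num_poly pt_num_T pt_num_W pt_num_source
  have init: "good_rule (\<lambda>x t i. t = 0, [(True, 0, now, \<lambda>x t i. 0)])"
    by (intro good_ruleI pt; (assumption)?) (auto simp: pt_terms W_pos state_less)
  have "pt_test2 (\<lambda>x t i. t = 0 \<and> init_symbol j x i = a)" for j a
    unfolding init_symbol_def by (intro pt pt_num_if pt_test_bit pt_test_const; assumption)
  then have input: "\<forall>r\<in>set input_rules. good_rule r"
    unfolding input_rules_def ball_concat_map set_map ball_simps
    by (intro ballI good_ruleI) (auto simp: pt_terms cell_less)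
  have one: "1 < tapes M" "0 < symbols M" "Suc 0 < symbols M" "2 < symbols M" "Suc 0 < tapes M" "0 < tapes M"
    using two_tapes symbols_ge_3 by auto
  have witness: "\<forall>r\<in>set witness_rules. good_rule r"
    unfolding witness_rules_def list.set ball_simps
  proof (intro conjI)
    show "good_rule (\<lambda>x t i. t = 0 \<and> \<not> (T x \<le> i \<and> i - T x < poly q (length x)), [(True, cell 1 0, now, here)])"
      by (intro good_ruleI pt; (assumption)?) (simp_all add: pt_terms cell_less one)
    show "good_rule (\<lambda>x t i. t = 0 \<and> T x \<le> i \<and> i - T x < poly q (length x), map (\<lambda>a. (True, cell 1 a, now, here)) [0, 1, 2])"
      by (intro good_ruleI pt; (assumption)?) (simp_all add: pt_terms cell_less one)
    show "good_rule (\<lambda>x t i. t = 0 \<and> T x \<le> i \<and> Suc i < W x, [(False, cell 1 0, now, here), (True, cell 1 0, now, \<lambda>x t i. Suc i)])"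
      by (intro good_ruleI pt; (assumption)?) (simp_all add: pt_terms cell_less one)
  qed simp
  have "good_rule (\<lambda>x t i. t = T x, [(False, cell 0 a, now, head)])" if "a < symbols M" for a
    using that by (intro good_ruleI pt; (assumption)?) (simp_all add: pt_terms cell_less one W_pos)
  then have accept: "\<forall>r\<in>set accept_rules. good_rule r"
    by (auto simp: accept_rules_def)
  have "good_rule r" if s: "s \<le> states M" and as: "as \<in> set (List.n_lists (tapes M) [0..<symbols M])" and r: "r \<in> set (step_rules s as)" for r s as
  proof -
    note prem = good_premise[OF s as]
    have state: "good_rule (\<lambda>x t i. t < T x, premise s as @ [(True, fst (act_of s as), later, \<lambda>x t i. 0)])"
      by (intro good_ruleI pt; (assumption)?)
        (use prem act_of(1)[OF s as] in \<open>simp_all add: ball_Un pt_terms state_less W_pos\<close>)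
    have move: "\<forall>r\<in>set (move_rules s as j b d). good_rule r" if "j < tapes M" "b < symbols M" for j b d
      unfolding move_rules_def list.set set_map ball_simps set_upt
    proof (intro conjI ballI)
      show "good_rule (\<lambda>x t i. t < T x \<and> 1 \<le> i \<and> Suc i < W x \<and> source d i = T x, premise s as @ [(True, cell j b, later, here)])"
        by (intro good_ruleI pt; (assumption)?)
          (use prem that in \<open>simp_all add: ball_Un pt_terms cell_less W_pos\<close>)
      fix a assume "a \<in> {0..<symbols M}"
      then show "good_rule (\<lambda>x t i. t < T x \<and> 1 \<le> i \<and> Suc i < W x \<and> source d i \<noteq> T x,
          premise s as @ [(False, cell j a, now, \<lambda>x t i. source d i), (True, cell j a, later, here)])"
        by (intro good_ruleI pt; (assumption)?)
          (use prem that in \<open>simp_all add: ball_Un pt_terms cell_less W_pos source_less\<close>)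
    qed
    have "\<forall>r\<in>set (step_rules s as). good_rule r"
      unfolding step_rules_def list.set ball_simps ball_concat_map set_upt
      by (intro conjI ballI state bspec[OF move]) (simp_all add: act_of(3)[OF s as])
    then show ?thesis
      using r by blast
  qed
  then show ?thesis
    unfolding rules_def list.set set_append ball_Un ball_simps ball_concat_map set_upt
    using init input witness accept by (auto simp: less_Suc_eq_le simp del: set_n_lists)
qed

subsection \<open>Clauses and computations\<close>

definition well_formed :: "config \<Rightarrow> bool" where
  "well_formed c \<longleftrightarrow> fst c \<le> states M \<and> length (snd c) = tapes M \<and> (\<forall>t\<in>set (snd c). \<forall>z. fst t z < symbols M)"

definition scanned :: "config \<Rightarrow> nat list" where
  "scanned c = map read_tape (snd c)"

definition symbol_at :: "bool list \<Rightarrow> config \<Rightarrow> nat \<Rightarrow> nat \<Rightarrow> nat" where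
  "symbol_at x c j i = fst (snd c ! j) (snd (snd c ! j) + int i - int (T x))"

lemma read_tape_eq: "read_tape t = fst t (snd t)"
  by (cases t) simp

lemma act_eq: "act a t = ((fst t)(snd t := fst a), shift_head (snd a) (snd t))"
  by (cases a; cases t) simp

lemma scanned:
  assumes "well_formed c"
  shows "scanned c \<in> set (List.n_lists (tapes M) [0..<symbols M])"
    "j < tapes M \<Longrightarrow> scanned c ! j = symbol_at x c j (T x)"
  using assms by (auto simp: scanned_def well_formed_def set_n_lists symbol_at_def read_tape_eq)

lemma step_eq:
  "step M c = (fst (act_of (fst c) (scanned c)), map2 act (snd (act_of (fst c) (scanned c))) (snd c))"
proof (cases c)
  case (Pair s ts)
  have "map2 act (map (\<lambda>a. (a, Stay)) (map read_tape ts)) ts = ts"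
    by (induction ts) (simp_all add: act_eq read_tape_eq)
  then show ?thesis
    by (simp add: Pair step.simps act_of_def scanned_def case_prod_beta)
qed

lemma well_formed_step:
  assumes c: "well_formed c"
  shows "well_formed (step M c)"
proof -
  let ?a = "act_of (fst c) (scanned c)"
  have s: "fst c \<le> states M" and len: "length (snd c) = tapes M"
    using c by (simp_all add: well_formed_def)
  note act = act_of[OF s scanned(1)[OF c]]
  have "fst t z < symbols M" if mem: "t \<in> set (map2 act (snd ?a) (snd c))" for t z
  proof -
    obtain j where j: "j < tapes M" "t = act (snd ?a ! j) (snd c ! j)"
      using mem act(2) len by (auto simp: in_set_conv_nth)
    moreover have "fst (snd c ! j) z < symbols M"
      using c j(1) by (simp add: well_formed_def)
    ultimately show ?thesis
      using act(3)[OF j(1)] by (simp add: act_eq)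
  qed
  then show ?thesis
    unfolding well_formed_def step_eq using act(1,2) len by simp
qed

lemma symbol_at_less: "well_formed c \<Longrightarrow> j < tapes M \<Longrightarrow> symbol_at x c j i < symbols M"
  by (simp add: well_formed_def symbol_at_def)

lemma symbol_at_step:
  assumes c: "well_formed c" and j: "j < tapes M" and i: "1 \<le> i"
    and a: "a = snd (act_of (fst c) (scanned c)) ! j"
  shows "symbol_at x (step M c) j i =
    (if source (snd a) i = T x then fst a else symbol_at x c j (source (snd a) i))"
proof -
  have s: "fst c \<le> states M" and len: "length (snd c) = tapes M"
    using c by (simp_all add: well_formed_def)
  have "snd (step M c) ! j = act a (snd c ! j)"
    unfolding step_eq using act_of(2)[OF s scanned(1)[OF c]] len j by (simp add: a)
  then have "symbol_at x (step M c) j i =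
      ((fst (snd c ! j))(snd (snd c ! j) := fst a)) (shift_head (snd a) (snd (snd c ! j)) + int i - int (T x))"
    by (simp add: symbol_at_def act_eq)
  also have "shift_head (snd a) (snd (snd c ! j)) + int i - int (T x) = snd (snd c ! j) + int (source (snd a) i) - int (T x)"
    using i by (cases "snd a") auto
  finally show ?thesis
    by (simp add: symbol_at_def)
qed

definition run :: "bool list \<Rightarrow> bool list \<Rightarrow> nat \<Rightarrow> config" where
  "run x w t = (step M ^^ t) (initial_config M [x, w])"

lemma run_Suc: "run x w (Suc t) = step M (run x w t)"
  by (simp add: run_def)

lemma well_formed_run: "well_formed (run x w t)"
proof (induction t)
  case 0
  have "fst (input_tape y) z < symbols M" for y z
    using symbols_ge_3 by (auto simp: input_tape_def bit_symbol_def)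
  then show ?case
    by (auto simp: run_def well_formed_def initial_config_def)
next
  case (Suc t)
  then show ?case by (simp add: run_Suc well_formed_step)
qed

lemma run_0: "fst (run x w 0) = 0"
  "j < tapes M \<Longrightarrow> j \<noteq> 1 \<Longrightarrow> symbol_at x (run x w 0) j i = init_symbol j x i"
  "symbol_at x (run x w 0) 1 i = (if T x \<le> i \<and> i - T x < length w then bit_symbol (w ! (i - T x)) else 0)"
proof -
  show "fst (run x w 0) = 0"
    by (simp add: run_def initial_config_def)
  have tape: "symbol_at x (run x w 0) j i = fst (input_tape (if j < 2 then [x, w] ! j else [])) (int i - int (T x))"
    if "j < tapes M" for j
    using that by (auto simp: run_def initial_config_def symbol_at_def input_tape_def)
  have input: "fst (input_tape y) (int i - int (T x)) = (if T x \<le> i \<and> i - T x < length y then bit_symbol (y ! (i - T x)) else 0)" for y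
    by (auto simp: input_tape_def nat_diff_distrib')
  show "symbol_at x (run x w 0) j i = init_symbol j x i" if "j < tapes M" "j \<noteq> 1"
    unfolding tape[OF that(1)] input init_symbol_def using that(2) by (auto simp: bit_symbol_def less_2_cases_iff)
  show "symbol_at x (run x w 0) 1 i = (if T x \<le> i \<and> i - T x < length w then bit_symbol (w ! (i - T x)) else 0)"
    using tape[of 1] input[of w] two_tapes by simp
qed

text \<open>A halted configuration persists, so for every admissible witness the configuration at
  the common time \<open>T x\<close> is the final one, and the answer is the symbol under the head
  of tape 0.\<close>

lemma accepts_iff:
  assumes V: "computes_within M [x, w] [b] (poly p (length x + length w))" and w: "length w \<le> poly q (length x)"
  shows "symbol_at x (run x w (T x)) 0 (T x) = 2 \<longleftrightarrow> b"
proof -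
  obtain t ts where t: "t \<le> poly p (length x + length w)" "run x w t = (states M, ts)" "holds_output (hd ts) [b]"
    using V by (auto simp: computes_within_def run_def)
  have "t \<le> T x"
    unfolding T_def using t(1) poly_nat_mono[of "length x + length w" "length x + poly q (length x)" p] w by simp
  moreover have "run x w (t + d) = (states M, ts)" for d
    by (induction d) (simp_all add: t(2) run_Suc step.simps)
  ultimately have "run x w (T x) = (states M, ts)"
    by (metis le_add_diff_inverse)
  moreover have "length ts = tapes M"
    using well_formed_run[of x w t] t(2) by (simp add: well_formed_def)
  then have "hd ts = ts ! 0"
    using two_tapes by (intro hd_conv_nth) auto
  ultimately have "symbol_at x (run x w (T x)) 0 (T x) = bit_symbol b"
    using t(3) by (cases "ts ! 0") (simp add: symbol_at_def)
  then show ?thesis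
    by (simp add: bit_symbol_def)
qed

lemma faithful_complete:
  assumes acc: "symbol_at x (run x w (T x)) 0 (T x) = 2" and w: "length w \<le> poly q (length x)"
  shows "\<exists>\<alpha>. faithful x \<alpha>"
proof -
  define \<alpha> where "\<alpha> \<kappa> t i = (if \<kappa> \<le> states M then fst (run x w t) = \<kappa>
    else symbol_at x (run x w t) ((\<kappa> - Suc (states M)) div symbols M) i = (\<kappa> - Suc (states M)) mod symbols M)" for \<kappa> t i
  have state: "\<alpha> s t 0 \<longleftrightarrow> fst (run x w t) = s" if "s \<le> states M" for s t
    using that by (simp add: \<alpha>_def)
  have cell: "\<alpha> (cell j a) t i \<longleftrightarrow> symbol_at x (run x w t) j i = a" if "a < symbols M" for j a t i
    using that by (simp add: \<alpha>_def cell_def)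
  have sym: "0 < symbols M" "Suc 0 < symbols M" "2 < symbols M"
    using symbols_ge_3 by auto
  have "faithful x \<alpha>"
    unfolding faithful_def
  proof (intro conjI allI ballI impI)
    show "\<alpha> 0 0 0"
      by (simp add: state run_0)
    show "\<alpha> (cell j (init_symbol j x i)) 0 i" if "j < tapes M" "j \<noteq> 1" for j i
      using run_0(2)[OF that] by (simp add: cell init_symbol_less)
    show "\<alpha> (cell 1 0) 0 i" if "\<not> (T x \<le> i \<and> i - T x < poly q (length x))" for i
      using that w run_0(3)[of x w i] by (auto simp: cell sym)
    show "\<exists>a\<in>{0, 1, 2}. \<alpha> (cell 1 a) 0 i" for i
      using run_0(3)[of x w i] by (auto simp: cell sym bit_symbol_def)
    show "\<alpha> (cell 1 0) 0 (Suc i)" if "T x \<le> i" "\<alpha> (cell 1 0) 0 i" for i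
      using that run_0(3)[of x w i] run_0(3)[of x w "Suc i"] by (auto simp: cell sym bit_symbol_def Suc_diff_le split: if_splits)
    show "\<not> \<alpha> (cell 0 a) (T x) (T x)" if "a < symbols M" "a \<noteq> 2" for a
      using that acc by (simp add: cell)
    fix t s as assume "t < T x" and s: "s \<le> states M" and as: "as \<in> set (List.n_lists (tapes M) [0..<symbols M])"
      and "\<alpha> s t 0" and rd: "\<forall>j<tapes M. \<alpha> (cell j (as ! j)) t (T x)"
    let ?c = "run x w t"
    have c: "well_formed ?c" by (rule well_formed_run)
    have fst: "fst ?c = s"
      using \<open>\<alpha> s t 0\<close> s by (simp add: state)
    note as_len = n_listsD[OF as]
    have "scanned ?c = as"
    proof (rule nth_equalityI)
      show "length (scanned ?c) = length as"
        using c as_len by (simp add: scanned_def well_formed_def)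
      fix j assume "j < length (scanned ?c)"
      then have j: "j < tapes M"
        using c by (simp add: scanned_def well_formed_def)
      then show "scanned ?c ! j = as ! j"
        using rd[rule_format, OF j] scanned(2)[OF c j, of x] as_len(2)[OF j] by (simp add: cell)
    qed
    then have step: "fst (run x w (Suc t)) = fst (act_of s as)"
      "\<And>j i. j < tapes M \<Longrightarrow> 1 \<le> i \<Longrightarrow> symbol_at x (run x w (Suc t)) j i =
        (if source (snd (snd (act_of s as) ! j)) i = T x then fst (snd (act_of s as) ! j)
         else symbol_at x ?c j (source (snd (snd (act_of s as) ! j)) i))"
      using symbol_at_step[OF c] by (simp_all add: run_Suc step_eq fst)
    show "step_faithful x \<alpha> t s as"
      unfolding step_faithful_def
    proof (intro conjI allI impI)
      show "\<alpha> (fst (act_of s as)) (Suc t) 0"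
        using step(1) act_of(1)[OF s as] by (simp add: state)
    next
      fix j i assume "j < tapes M" "1 \<le> i" "source (snd (snd (act_of s as) ! j)) i = T x"
      then show "\<alpha> (cell j (fst (snd (act_of s as) ! j))) (Suc t) i"
        using step(2) act_of(3)[OF s as] by (simp add: cell)
    next
      fix j i a assume "j < tapes M" "1 \<le> i" "source (snd (snd (act_of s as) ! j)) i \<noteq> T x"
        "a < symbols M" "\<alpha> (cell j a) t (source (snd (snd (act_of s as) ! j)) i)"
      then show "\<alpha> (cell j a) (Suc t) i"
        using step(2) by (simp add: cell)
    qed
  qed
  then show ?thesis by blast
qed

text \<open>By induction on the time, every symbol of the run is true in \<open>\<alpha>\<close> as
  long as it lies in a window that loses one cell per step at either end. With
  \<open>W x = 2 * T x + 1\<close> exactly the cell under the head is left after \<open>T x\<close>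
  steps, and there all symbols except 2 are excluded.\<close>

lemma faithful_sound:
  assumes "faithful x \<alpha>"
  shows "\<exists>w. length w \<le> poly q (length x) \<and> symbol_at x (run x w (T x)) 0 (T x) = 2"
proof -
  let ?m = "poly q (length x)"
  note F = assms[unfolded faithful_def]
  have F1: "\<alpha> 0 0 0" and F2: "\<And>j i. j < tapes M \<Longrightarrow> j \<noteq> 1 \<Longrightarrow> i < W x \<Longrightarrow> \<alpha> (cell j (init_symbol j x i)) 0 i"
    and F3: "\<And>i. i < W x \<Longrightarrow> \<not> (T x \<le> i \<and> i - T x < ?m) \<Longrightarrow> \<alpha> (cell 1 0) 0 i"
    and F4: "\<And>i. i < W x \<Longrightarrow> T x \<le> i \<Longrightarrow> i - T x < ?m \<Longrightarrow> \<exists>a\<in>{0, 1, 2}. \<alpha> (cell 1 a) 0 i"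
    and F5: "\<And>i. T x \<le> i \<Longrightarrow> Suc i < W x \<Longrightarrow> \<alpha> (cell 1 0) 0 i \<Longrightarrow> \<alpha> (cell 1 0) 0 (Suc i)"
    using F by blast+
  have F6: "\<And>t s as. t < T x \<Longrightarrow> s \<le> states M \<Longrightarrow> as \<in> set (List.n_lists (tapes M) [0..<symbols M]) \<Longrightarrow>
        \<alpha> s t 0 \<Longrightarrow> \<forall>j<tapes M. \<alpha> (cell j (as ! j)) t (T x) \<Longrightarrow> step_faithful x \<alpha> t s as"
    and F7: "\<And>a. a < symbols M \<Longrightarrow> a \<noteq> 2 \<Longrightarrow> \<not> \<alpha> (cell 0 a) (T x) (T x)"
    using F by blast+
  define blank where "blank r \<longleftrightarrow> r = ?m \<or> \<alpha> (cell 1 0) 0 (T x + r)" for r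
  define len where "len = (LEAST r. blank r)"
  \<comment> \<open>A cell may have both bits true. The witness prefers symbol 2; where that is
    false, symbol 1 must be true, since symbol 0 is false before \<open>len\<close>.\<close>
  define w where "w = map (\<lambda>r. \<alpha> (cell 1 2) 0 (T x + r)) [0..<len]"
  have "blank ?m"
    by (simp add: blank_def)
  then have len: "len \<le> ?m" "blank len"
    unfolding len_def by (rule Least_le, rule LeastI)
  have before: "\<not> blank r" if "r < len" for r
    using that not_less_Least[of r blank] by (simp add: len_def)
  have after: "\<alpha> (cell 1 0) 0 (T x + (len + d))" if "T x + (len + d) < W x" for d
    using that
  proof (induction d)
    case 0
    then show ?case
      using len F3[of "T x + len"] by (auto simp: blank_def)
  next
    case (Suc d)
    then show ?case
      using F5[of "T x + (len + d)"] by simp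
  qed
  have w: "length w = len" "\<And>r. r < len \<Longrightarrow> w ! r = \<alpha> (cell 1 2) 0 (T x + r)"
    by (simp_all add: w_def)
  have witness: "\<alpha> (cell 1 (symbol_at x (run x w 0) 1 i)) 0 i" if i: "i < W x" for i
  proof (cases "T x \<le> i \<and> i - T x < len")
    case True
    define r where "r = i - T x"
    have r: "i = T x + r" "r < len"
      using True by (auto simp: r_def)
    have "r < ?m"
      using r(2) len(1) by simp
    then obtain a where "a \<in> {0, 1, 2}" "\<alpha> (cell 1 a) 0 i"
      using F4[of i] i True by (auto simp: r)
    moreover have "\<not> \<alpha> (cell 1 0) 0 i"
      using before[OF r(2)] by (simp add: blank_def r)
    ultimately show ?thesis
      using run_0(3)[of x w i] r by (auto simp: w bit_symbol_def)
  next
    case False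
    then have "symbol_at x (run x w 0) 1 i = 0"
      using run_0(3)[of x w i] by (auto simp: w(1))
    moreover have "\<alpha> (cell 1 0) 0 i"
    proof (cases "T x \<le> i")
      case True
      then show ?thesis
        using after[of "i - T x - len"] False i by simp
    next
      case False
      then show ?thesis
        using F3[OF i] by simp
    qed
    ultimately show ?thesis by simp
  qed
  have "\<alpha> (fst (run x w t)) t 0 \<and> (\<forall>j<tapes M. \<forall>i. t \<le> i \<and> i + t < W x \<longrightarrow> \<alpha> (cell j (symbol_at x (run x w t) j i)) t i)"
    if "t \<le> T x" for t
    using that
  proof (induction t)
    case 0
    have "\<alpha> (cell j (symbol_at x (run x w 0) j i)) 0 i" if "j < tapes M" "i < W x" for j i
      using F2[OF that(1) _ that(2)] witness[OF that(2)] run_0(2)[OF that(1)] by (cases "j = 1") auto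
    then show ?case
      using F1 by (simp add: run_0(1))
  next
    case (Suc t)
    let ?c = "run x w t"
    have c: "well_formed ?c" by (rule well_formed_run)
    have IH: "\<alpha> (fst ?c) t 0" "\<And>j i. j < tapes M \<Longrightarrow> t \<le> i \<Longrightarrow> i + t < W x \<Longrightarrow> \<alpha> (cell j (symbol_at x ?c j i)) t i"
      using Suc by auto
    have "\<forall>j<tapes M. \<alpha> (cell j (scanned ?c ! j)) t (T x)"
      using IH(2)[of _ "T x"] Suc.prems scanned(2)[OF c, of _ x] by (simp add: W_def)
    then have sf: "step_faithful x \<alpha> t (fst ?c) (scanned ?c)"
      using Suc.prems c IH(1) scanned(1)[OF c] by (intro F6) (auto simp: well_formed_def)
    have "\<alpha> (cell j (symbol_at x (run x w (Suc t)) j i)) (Suc t) i"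
      if j: "j < tapes M" and i: "Suc t \<le> i" "i + Suc t < W x" for j i
    proof -
      define a where "a = snd (act_of (fst ?c) (scanned ?c)) ! j"
      have i': "1 \<le> i" "Suc i < W x"
        using i by auto
      have eq: "symbol_at x (run x w (Suc t)) j i = (if source (snd a) i = T x then fst a else symbol_at x ?c j (source (snd a) i))"
        using symbol_at_step[OF c j i'(1) a_def] by (simp add: run_Suc)
      have "t \<le> source (snd a) i" "source (snd a) i + t < W x"
        using i by (cases "snd a"; simp)+
      then have "\<alpha> (cell j (symbol_at x ?c j (source (snd a) i))) t (source (snd a) i)"
        by (rule IH(2)[OF j])
      then show ?thesis
        unfolding eq using sf j i' symbol_at_less[OF c j] unfolding step_faithful_def a_def[symmetric] by (simp add: a_def)
    qed
    moreover have "\<alpha> (fst (run x w (Suc t))) (Suc t) 0"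
      using sf by (simp add: step_faithful_def run_Suc step_eq)
    ultimately show ?case by blast
  qed
  from this[of "T x"] have "\<alpha> (cell 0 (symbol_at x (run x w (T x)) 0 (T x))) (T x) (T x)"
    using two_tapes by (simp add: W_def)
  then have "symbol_at x (run x w (T x)) 0 (T x) = 2"
    using F7 symbol_at_less[OF well_formed_run, of 0] two_tapes by fastforce
  moreover have "length w \<le> ?m"
    using len(1) by (simp add: w_def)
  ultimately show ?thesis by blast
qed

end

theorem NP_satisfiability:
  assumes "in_NP L"
  obtains nv mc :: "bool list \<Rightarrow> nat" and C :: "bool list \<Rightarrow> nat \<Rightarrow> nat \<Rightarrow> bool" where
    "pt_num (\<lambda>x \<sigma>. nv x)" "pt_num (\<lambda>x \<sigma>. mc x)" "pt_test2 C" "\<And>x. 0 < nv x"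
    "\<And>x. x \<in> L \<longleftrightarrow> (\<exists>\<beta>. \<forall>j<mc x. \<exists>l<2 * nv x. C x j l \<and> (\<beta> (l div 2) \<longleftrightarrow> even l))"
proof -
  obtain V and q :: "nat poly" where V: "polytime_decidable2 V" and L: "L = {x. \<exists>w. length w \<le> poly q (length x) \<and> V x w}"
    using assms unfolding in_NP_def by blast
  obtain M and p :: "nat poly" where M: "turing_machine M" "\<And>x w. computes_within M [x, w] [V x w] (poly p (length x + length w))"
    using V unfolding polytime_decidable2_def by blast
  interpret verifier M p q
  proof
    show "turing_machine M" by (rule M)
    show "2 \<le> tapes M"
      using M(2)[of "[]" "[]"] by (simp add: computes_within_def)
  qed
  let ?S = "\<lambda>x. Suc (T x)"
  have S: "pt_num (\<lambda>x \<sigma>. ?S x)"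
    by (intro pt_num_Suc pt_num_T)
  show thesis
  proof (rule that[of "\<lambda>x. kinds * ?S x * W x" "\<lambda>x. length rules * ?S x * W x" "in_clause rules ?S W"])
    show "pt_num (\<lambda>x \<sigma>. kinds * ?S x * W x)" "pt_num (\<lambda>x \<sigma>. length rules * ?S x * W x)"
      by (intro pt_num_mult pt_num_const S pt_num_W)+
    show "pt_test2 (in_clause rules ?S W)"
      using good_rules by (intro pt_test2I pt_test_in_clause S pt_num_W) (auto simp: good_rule_def)
    show "0 < kinds * ?S x * W x" for x
      using W_pos by (simp add: kinds_def)
    fix x
    have "x \<in> L \<longleftrightarrow> (\<exists>w. length w \<le> poly q (length x) \<and> V x w)"
      by (simp add: L)
    also have "\<dots> \<longleftrightarrow> (\<exists>\<alpha>. faithful x \<alpha>)"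
      using faithful_complete faithful_sound accepts_iff[OF M(2)] by blast
    also have "\<dots> \<longleftrightarrow> (\<exists>\<alpha>. rules_hold rules x (?S x) (W x) \<alpha>)"
      by (simp add: rules_hold_rules)
    also have "\<dots> \<longleftrightarrow> (\<exists>\<beta>. \<forall>j<length rules * ?S x * W x. \<exists>l<2 * (kinds * ?S x * W x). in_clause rules ?S W x j l \<and> (\<beta> (l div 2) \<longleftrightarrow> even l))"
      by (rule rules_satisfiable_iff) (use good_rules W_pos in \<open>auto simp: good_rule_def kinds_def\<close>)
    finally show "x \<in> L \<longleftrightarrow> (\<exists>\<beta>. \<forall>j<length rules * ?S x * W x. \<exists>l<2 * (kinds * ?S x * W x). in_clause rules ?S W x j l \<and> (\<beta> (l div 2) \<longleftrightarrow> even l))" .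
  qed
qed

section \<open>Matrices of graphs\<close>

declare sum_mult_of_bool_eq [simp del] sum_of_bool_mult_eq [simp del] sum_of_bool_eq [simp del]

definition decomposes :: "nat \<Rightarrow> nat set set \<Rightarrow> (nat set \<Rightarrow> real) \<Rightarrow> (nat \<Rightarrow> nat \<Rightarrow> real) \<Rightarrow> bool" where
  "decomposes n F w \<Gamma> \<longleftrightarrow> F \<subseteq> Pow {..<n} - {{}} \<and> (\<forall>S\<in>F. 0 \<le> w S) \<and> sum w F = 1 \<and>
     (\<forall>i<n. \<forall>j<n. \<Gamma> i j = (\<Sum>S\<in>F. w S * of_bool (i \<in> S \<and> j \<in> S)))"

lemma decomposes_finite: "decomposes n F w \<Gamma> \<Longrightarrow> finite F"
  unfolding decomposes_def by (meson finite_Diff finite_Pow_iff finite_lessThan finite_subset)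

text \<open>Indices with the same set are merged by adding their weights, so the number of sets
  cannot grow. Constructions can then use families in which sets repeat.\<close>

lemma decomposes_indexed:
  assumes I: "finite I" and S: "\<And>\<iota>. \<iota> \<in> I \<Longrightarrow> S \<iota> \<subseteq> {..<n} \<and> S \<iota> \<noteq> {}" and v: "\<And>\<iota>. \<iota> \<in> I \<Longrightarrow> 0 \<le> v \<iota>"
    and total: "sum v I = 1"
    and entries: "\<And>i j. i < n \<Longrightarrow> j < n \<Longrightarrow> \<Gamma> i j = (\<Sum>\<iota>\<in>I. v \<iota> * of_bool (i \<in> S \<iota> \<and> j \<in> S \<iota>))"
  shows "\<exists>F w. decomposes n F w \<Gamma> \<and> card F \<le> card I"
proof -
  define w where "w A = (\<Sum>\<iota>\<in>{\<iota>\<in>I. S \<iota> = A}. v \<iota>)" for A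
  have regroup: "(\<Sum>A\<in>S ` I. w A * h A) = (\<Sum>\<iota>\<in>I. v \<iota> * h (S \<iota>))" for h :: "nat set \<Rightarrow> real"
  proof -
    have "w A * h A = (\<Sum>\<iota>\<in>{\<iota>\<in>I. S \<iota> = A}. v \<iota> * h (S \<iota>))" for A
      by (simp add: w_def sum_distrib_right)
    then show ?thesis
      using sum.image_gen[OF I, of "\<lambda>\<iota>. v \<iota> * h (S \<iota>)" S] by simp
  qed
  have "decomposes n (S ` I) w \<Gamma>"
    unfolding decomposes_def
  proof (intro conjI allI ballI impI)
    show "S ` I \<subseteq> Pow {..<n} - {{}}"
      using S by blast
    show "0 \<le> w A" for A
      unfolding w_def by (intro sum_nonneg) (simp add: v)
    show "sum w (S ` I) = 1"
      using regroup[of "\<lambda>_. 1"] total by simp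
    show "\<Gamma> i j = (\<Sum>A\<in>S ` I. w A * of_bool (i \<in> A \<and> j \<in> A))" if "i < n" "j < n" for i j
      using entries[OF that] regroup[of "\<lambda>A. of_bool (i \<in> A \<and> j \<in> A)"] by simp
  qed
  moreover have "card (S ` I) \<le> card I"
    using I by (rule card_image_le)
  ultimately show ?thesis by blast
qed

lemma sum_square:
  fixes g :: "nat \<Rightarrow> nat \<Rightarrow> 'a :: comm_monoid_add"
  shows "(\<Sum>p<N * N. g (p div N) (p mod N)) = (\<Sum>a<N. \<Sum>b<N. g a b)"
proof -
  have inner: "(\<Sum>p\<in>{a * N..<a * N + N}. g (p div N) (p mod N)) = (\<Sum>b<N. g a b)" for a
    using sum.atLeastLessThan_shift_0[of "\<lambda>p. g (p div N) (p mod N)" "a * N" "a * N + N"]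
    by (simp add: atLeast0LessThan)
  show ?thesis
    unfolding sum.nat_group[symmetric] inner ..
qed

text \<open>
  The vertices below \<open>m\<close> are those of the graph \<open>adj\<close>; \<open>m\<close> is an additional vertex that is
  adjacent to all others or to none, depending on \<open>e\<close>. Coordinate \<open>N\<^sup>2 + i\<close> stands for the vertex \<open>i\<close>
  and coordinate \<open>p = a N + b < N\<^sup>2\<close> for the pair \<open>(a, b)\<close>. The entries are such that two generators
  contain \<open>p\<close>: either one contains the vertices \<open>a\<close> and \<open>b\<close> and the other none, or each contains
  one of them. Thus the product of the coordinates \<open>a\<close> and \<open>b\<close> can be adjusted without changing
  anything else.
\<close>

locale graph_matrix =
  fixes m k :: nat and adj :: "nat \<Rightarrow> nat \<Rightarrow> bool" and e :: bool
  assumes adj_sym: "adj i j \<Longrightarrow> adj j i" and k_pos: "0 < k" and k_less: "k + 1 < m"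
begin

definition N where "N = Suc m"
text \<open>The common denominator is the total weight in units: 2 for each of the
  \<open>N * N\<close> pairs and \<open>m\<close> for covering the vertices.\<close>

definition D where "D = 2 * (N * N) + m"
definition size where "size = N * N + N"

definition conflict where
  "conflict i j \<longleftrightarrow> (if i = m \<or> j = m then e else adj i j)"

text \<open>The weight, in units, that the sets without pair coordinates must place on vertex
  \<open>i\<close>. Of the \<open>m\<close> units, \<open>m - k\<close> go to the additional vertex,
  so that \<open>k\<close> remain if it is adjacent to all others.\<close>

definition residue where
  "residue i = (if i = m then m - k else 1)"

text \<open>The diagonal entry of a vertex is its residue plus \<open>2 * m + 1\<close>, the number
  of pairs in which it occurs. The value 2 for nonadjacent \<open>i\<close> and \<open>j\<close>
  leaves room for the two pairs \<open>(i, j)\<close> and \<open>(j, i)\<close>, each of which can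
  contribute 0 or 1 to this product.\<close>

definition entry :: "nat \<Rightarrow> nat \<Rightarrow> nat" where
  "entry p q =
     (if p < N * N then
        if q < N * N then (if p = q then 2 else 0)
        else (if q - N * N = p div N \<or> q - N * N = p mod N then 1 else 0)
      else if q < N * N then (if p - N * N = q div N \<or> p - N * N = q mod N then 1 else 0)
      else if p = q then residue (p - N * N) + 2 * m + 1
      else if conflict (p - N * N) (q - N * N) then 0 else 2)"

definition \<Gamma> :: "nat \<Rightarrow> nat \<Rightarrow> real" where
  "\<Gamma> i j = real (entry i j) / real D"

definition independent :: "nat set \<Rightarrow> bool" where
  "independent A \<longleftrightarrow> A \<subseteq> {..<m} \<and> (\<forall>i\<in>A. \<forall>j\<in>A. i \<noteq> j \<longrightarrow> \<not> adj i j)"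

lemma conflict_sym: "conflict i j \<Longrightarrow> conflict j i"
  using adj_sym by (auto simp: conflict_def)

lemma D_pos: "0 < D"
  by (simp add: D_def N_def)

lemma pair_count: "i < N \<Longrightarrow> (\<Sum>p<N * N. of_bool (i = p div N \<or> i = p mod N)) = (2 * real m + 1)"
proof -
  assume i: "i < N"
  have "(\<Sum>p<N * N. of_bool (i = p div N \<or> i = p mod N)) = (\<Sum>a<N. \<Sum>b<N. of_bool (i = a \<or> i = b) :: real)"
    by (rule sum_square[of "\<lambda>a b. of_bool (i = a \<or> i = b)"])
  also have "\<dots> = (\<Sum>a<N. if a = i then real N else 1)"
  proof (rule sum.cong)
    fix a
    have "{..<N} \<inter> {b. i = b} = {i}" using i by auto
    then show "(\<Sum>b<N. of_bool (i = a \<or> i = b)) = (if a = i then real N else 1)"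
      by (simp add: of_bool_def sum.If_cases)
  qed simp
  also have "\<dots> = 2 * real m + 1"
  proof -
    have "(\<Sum>a<N. if a = i then real N else 1) = real N + (\<Sum>a\<in>{..<N} - {i}. 1)"
      using i by (subst sum.remove[of _ i]) auto
    then show ?thesis using i by (simp add: N_def)
  qed
  finally show ?thesis .
qed

section \<open>Consequences of a decomposition\<close>

context
  fixes F w
  assumes dec: "decomposes size F w \<Gamma>"
begin

text \<open>Only sets of positive weight are kept, since zero entries of the matrix say nothing
  about sets of weight 0.\<close>

definition base where "base = {S\<in>F. 0 < w S \<and> S \<inter> {..<N * N} = {}}"

definition vertices :: "nat set \<Rightarrow> nat set" where "vertices S = {i. i < m \<and> N * N + i \<in> S}"

lemma finite_F: "finite F"
  using dec by (rule decomposes_finite)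

lemma w_nonneg: "S \<in> F \<Longrightarrow> 0 \<le> w S"
  using dec by (simp add: decomposes_def)

lemma \<Gamma>_eq: "i < size \<Longrightarrow> j < size \<Longrightarrow> (\<Sum>S\<in>F. w S * of_bool (i \<in> S \<and> j \<in> S)) = real (entry i j) / real D"
  using dec by (simp add: decomposes_def \<Gamma>_def)

text \<open>The entry is a sum of nonnegative terms, so when it vanishes no set of positive weight
  contains both coordinates. This is how adjacency in the graph is enforced.\<close>

lemma entry_0:
  assumes "S \<in> F" "0 < w S" "i \<in> S" "j \<in> S"
  shows "entry i j \<noteq> 0"
proof
  assume 0: "entry i j = 0"
  have "i < size" "j < size"
    using dec assms by (auto simp: decomposes_def)
  then have "(\<Sum>S\<in>F. w S * of_bool (i \<in> S \<and> j \<in> S)) = 0"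
    using \<Gamma>_eq 0 by simp
  then have "w S * of_bool (i \<in> S \<and> j \<in> S) = 0"
    using assms(1) w_nonneg by (simp add: sum_nonneg_eq_0_iff finite_F)
  then show False
    using assms by simp
qed

text \<open>Different pair coordinates have entry 0, so a set of positive weight contains at most
  one of them. Subtracting the contributions of all pairs therefore removes every other set exactly
  once.\<close>

lemma base_sum:
  "(\<Sum>S\<in>base. w S * h S) = (\<Sum>S\<in>F. w S * h S) - (\<Sum>p<N * N. \<Sum>S\<in>F. w S * (of_bool (p \<in> S) * h S))"
proof -
  have *: "w S * h S - (\<Sum>p<N * N. w S * (of_bool (p \<in> S) * h S)) = (if S \<in> base then w S * h S else 0)"
    if S: "S \<in> F" for S
  proof (cases "w S = 0")
    case False
    then have pos: "0 < w S"
      using w_nonneg[OF S] by simp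
    have "(\<Sum>p<N * N. of_bool (p \<in> S)) = (of_bool (S \<inter> {..<N * N} \<noteq> {}) :: real)"
    proof (cases "S \<inter> {..<N * N} = {}")
      case True
      then have "p \<notin> S" if "p < N * N" for p
        using that by blast
      then show ?thesis
        using True by (intro trans[OF sum.neutral]) simp_all
    next
      case False
      then obtain p where p: "p \<in> S" "p < N * N" by auto
      have "q = p" if "q \<in> S" "q < N * N" for q
        using entry_0[OF S pos \<open>p \<in> S\<close> \<open>q \<in> S\<close>] p(2) that(2) by (simp add: entry_def split: if_split_asm)
      then have "{..<N * N} \<inter> {q. q \<in> S} = {p}"
        using p by blast
      then show ?thesis
        using False by (simp add: of_bool_def sum.If_cases)
    qed
    then have "w S * ((\<Sum>p<N * N. of_bool (p \<in> S)) * h S) = w S * (of_bool (S \<inter> {..<N * N} \<noteq> {}) * h S)"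
      by (simp only:)
    then have "(\<Sum>p<N * N. w S * (of_bool (p \<in> S) * h S)) = w S * (of_bool (S \<inter> {..<N * N} \<noteq> {}) * h S)"
      by (simp only: sum_distrib_left sum_distrib_right)
    then show ?thesis
      using S pos by (simp add: base_def)
  qed (auto simp: base_def)
  have "(\<Sum>S\<in>base. w S * h S) = (\<Sum>S\<in>F. if S \<in> base then w S * h S else 0)"
    by (rule sum.mono_neutral_cong_left) (auto simp: finite_F base_def)
  also have "\<dots> = (\<Sum>S\<in>F. w S * h S - (\<Sum>p<N * N. w S * (of_bool (p \<in> S) * h S)))"
    using * by simp
  also have "\<dots> = (\<Sum>S\<in>F. w S * h S) - (\<Sum>p<N * N. \<Sum>S\<in>F. w S * (of_bool (p \<in> S) * h S))"
    unfolding sum_subtractf by (subst sum.swap) simp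
  finally show ?thesis .
qed

lemma base_total: "sum w base = real m / real D"
proof -
  have "(\<Sum>S\<in>F. w S * of_bool (p \<in> S)) = 2 / real D" if "p < N * N" for p
    using \<Gamma>_eq[of p p] that by (simp add: size_def entry_def)
  then have "(\<Sum>p<N * N. \<Sum>S\<in>F. w S * (of_bool (p \<in> S) * 1)) = real (N * N) * (2 / real D)"
    by simp
  moreover have "sum w F = 1"
    using dec by (simp add: decomposes_def)
  ultimately have "sum w base = 1 - real (N * N) * (2 / real D)"
    using base_sum[of "\<lambda>_. 1"] by simp
  then have "sum w base * real D = real D - real (N * N) * 2"
    using D_pos by (simp add: left_diff_distrib)
  also have "\<dots> = real m"
    by (simp add: D_def)
  finally show ?thesis
    using D_pos by (simp add: nonzero_eq_divide_eq)
qed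

lemma base_vertex:
  assumes i: "i < N"
  shows "(\<Sum>S\<in>base. w S * of_bool (N * N + i \<in> S)) = real (residue i) / real D"
proof -
  have "(\<Sum>S\<in>F. w S * (of_bool (p \<in> S) * of_bool (N * N + i \<in> S))) = of_bool (i = p div N \<or> i = p mod N) / real D"
    if "p < N * N" for p
    using \<Gamma>_eq[of p "N * N + i"] that i by (simp add: size_def entry_def of_bool_conj)
  then have "(\<Sum>p<N * N. \<Sum>S\<in>F. w S * (of_bool (p \<in> S) * of_bool (N * N + i \<in> S))) = (2 * real m + 1) / real D"
    using pair_count[OF i] by (simp add: sum_divide_distrib[symmetric])
  moreover have "(\<Sum>S\<in>F. w S * of_bool (N * N + i \<in> S)) = (real (residue i) + 2 * real m + 1) / real D"
    using \<Gamma>_eq[of "N * N + i" "N * N + i"] i by (simp add: size_def entry_def)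
  ultimately show ?thesis
    unfolding base_sum by (simp add: diff_divide_distrib[symmetric])
qed

lemma base_independent:
  assumes "S \<in> base"
  shows "independent (vertices S)"
  unfolding independent_def
proof (intro conjI ballI impI)
  show "vertices S \<subseteq> {..<m}"
    by (auto simp: vertices_def)
  fix i j assume ij: "i \<in> vertices S" "j \<in> vertices S" "i \<noteq> j"
  then have "entry (N * N + i) (N * N + j) \<noteq> 0"
    using assms by (intro entry_0[of S]) (auto simp: base_def vertices_def)
  then show "\<not> adj i j"
    using ij by (auto simp: entry_def conflict_def vertices_def split: if_splits)
qed

lemma base_vertices_total: "(\<Sum>S\<in>base. w S * real (card (vertices S))) = real m / real D"
proof -
  have "real (card (vertices S)) = (\<Sum>i<m. of_bool (N * N + i \<in> S))" for S
    by (simp add: vertices_def of_bool_def sum.If_cases Int_def lessThan_def)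
  then have "(\<Sum>S\<in>base. w S * real (card (vertices S))) = (\<Sum>i<m. \<Sum>S\<in>base. w S * of_bool (N * N + i \<in> S))"
    by (simp only: sum_distrib_left sum.swap[of _ base])
  also have "\<dots> = (\<Sum>i<m. 1 / real D)"
    using base_vertex by (intro sum.cong) (auto simp: N_def residue_def)
  finally show ?thesis by simp
qed

text \<open>A base set with the additional vertex contains no other vertex, and such sets weigh
  \<open>m - k\<close> of \<open>m\<close> units. The remaining \<open>k\<close> units cover
  \<open>m\<close> vertices once; if \<open>k * card A \<le> m - 1\<close> held for every
  independent set, \<open>k * m \<le> (m - 1) * k\<close> would follow.\<close>

lemma large_independent_if_adjacent:
  assumes e: e
  shows "\<exists>A. independent A \<and> m \<le> k * card A"
proof (rule ccontr)
  assume "\<not> ?thesis"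
  then have small: "k * card (vertices S) < m" if "S \<in> base" for S
    using base_independent[OF that] by (meson not_less)
  have bound: "w S * (real k * real (card (vertices S))) \<le> w S * (real (m - 1) * (1 - of_bool (N * N + m \<in> S)))"
    if S: "S \<in> base" for S
  proof (cases "N * N + m \<in> S")
    case True
    have "i \<notin> vertices S" for i
    proof
      assume i: "i \<in> vertices S"
      then have "entry (N * N + i) (N * N + m) \<noteq> 0"
        using S True by (intro entry_0[of S]) (auto simp: base_def vertices_def)
      moreover have "conflict i m" and "i \<noteq> m"
        using e i unfolding conflict_def vertices_def by auto
      ultimately show False
        by (simp add: entry_def)
    qed
    then have "vertices S = {}" by blast
    then show ?thesis using True by simp
  next
    case False
    have "real (k * card (vertices S)) \<le> real (m - 1)"
      using small[OF S] unfolding of_nat_le_iff by linarith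
    then show ?thesis
      using False S by (intro mult_left_mono) (auto simp: base_def)
  qed
  have "real k * (real m / real D) = (\<Sum>S\<in>base. w S * (real k * real (card (vertices S))))"
    unfolding base_vertices_total[symmetric] by (simp add: sum_distrib_left mult.left_commute)
  also have "\<dots> \<le> (\<Sum>S\<in>base. w S * (real (m - 1) * (1 - of_bool (N * N + m \<in> S))))"
    using bound by (rule sum_mono)
  also have "\<dots> = real (m - 1) * (sum w base - (\<Sum>S\<in>base. w S * of_bool (N * N + m \<in> S)))"
    by (simp add: sum_distrib_left sum_subtractf[symmetric] algebra_simps)
  also have "\<dots> = real (m - 1) * (real k / real D)"
    using base_vertex[of m] k_less by (simp add: base_total N_def residue_def of_nat_diff diff_divide_distrib[symmetric])
  finally have "real k * real m \<le> real (m - 1) * real k"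
    using D_pos by (simp add: field_simps)
  then have "k * m \<le> (m - 1) * k"
    by (simp only: of_nat_mult[symmetric] of_nat_le_iff)
  then show False
    using k_pos k_less by (cases m) auto
qed

text \<open>The entry of \<open>p\<close> with itself is 2, but with the vertex
  \<open>p div N\<close> it is only 1, so \<open>p\<close> occurs both with and without that
  vertex.\<close>

lemma two_terms_per_pair:
  assumes p: "p < N * N"
  shows "2 \<le> card {S\<in>F. 0 < w S \<and> p \<in> S}"
proof -
  define v where "v = N * N + p div N"
  have a: "p div N < N"
    using p by (simp add: less_mult_imp_div_less)
  have pv: "p < size" "v < size"
    using p a by (auto simp: size_def v_def)
  have pp: "(\<Sum>S\<in>F. w S * of_bool (p \<in> S)) = 2 / real D"
    using \<Gamma>_eq[of p p] pv p by (simp add: entry_def)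
  have pv': "(\<Sum>S\<in>F. w S * of_bool (p \<in> S \<and> v \<in> S)) = 1 / real D"
    using \<Gamma>_eq[OF pv] p a by (simp add: entry_def v_def)
  have pn: "(\<Sum>S\<in>F. w S * of_bool (p \<in> S \<and> v \<notin> S)) = 1 / real D"
  proof -
    have "(\<Sum>S\<in>F. w S * of_bool (p \<in> S \<and> v \<notin> S)) = (\<Sum>S\<in>F. w S * of_bool (p \<in> S) - w S * of_bool (p \<in> S \<and> v \<in> S))"
      by (rule sum.cong) auto
    then show ?thesis
      using pp pv' by (simp add: sum_subtractf)
  qed
  have ex: "\<exists>S\<in>F. 0 < w S \<and> P S" if sum: "(\<Sum>S\<in>F. w S * of_bool (P S)) = 1 / real D" for P
  proof (rule ccontr)
    assume "\<not> ?thesis"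
    then have "w S * of_bool (P S) = 0" if "S \<in> F" for S
      using that w_nonneg[of S] by (auto simp: less_le)
    then have "(\<Sum>S\<in>F. w S * of_bool (P S)) = 0"
      by (rule sum.neutral[OF ballI])
    then show False
      using sum D_pos by simp
  qed
  obtain S S' where "S \<in> F" "0 < w S" "p \<in> S" "v \<in> S" "S' \<in> F" "0 < w S'" "p \<in> S'" "v \<notin> S'"
    using ex[OF pv'] ex[OF pn] by blast
  then have "{S, S'} \<subseteq> {S\<in>F. 0 < w S \<and> p \<in> S}" "S \<noteq> S'"
    by auto
  then show ?thesis
    using card_mono[of "{S\<in>F. 0 < w S \<and> p \<in> S}" "{S, S'}"] finite_F by simp
qed

lemma card_base: "card base + 2 * (N * N) \<le> card F"
proof -
  let ?P = "\<lambda>p. {S\<in>F. 0 < w S \<and> p \<in> S}"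
  have "p = q" if "S \<in> F" "0 < w S" "p \<in> S" "q \<in> S" "p < N * N" "q < N * N" for S p q
    using entry_0[OF that(1-4)] that(5,6) by (simp add: entry_def split: if_split_asm)
  then have "card (\<Union>p<N * N. ?P p) = (\<Sum>p<N * N. card (?P p))"
    by (intro card_UN_disjoint) (auto simp: finite_F)
  also have "\<dots> \<ge> (\<Sum>p<N * N. 2)"
    by (intro sum_mono two_terms_per_pair) simp
  finally have "2 * (N * N) \<le> card (\<Union>p<N * N. ?P p)"
    by simp
  moreover have "card base + card (\<Union>p<N * N. ?P p) = card (base \<union> (\<Union>p<N * N. ?P p))"
    by (intro card_Un_disjoint[symmetric]) (auto simp: base_def finite_F)
  moreover have "\<dots> \<le> card F"
    by (intro card_mono) (auto simp: base_def finite_F)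
  ultimately show ?thesis by linarith
qed

text \<open>The gadgets use up all but \<open>k + 1\<close> sets. Each base set with an original
  vertex weighs at most one unit and the total is \<open>m > k + 1\<close> units, so some base set
  has no original vertex; the other sets, at most \<open>k\<close>, then cover \<open>m\<close>
  vertices with weights of at most one unit.\<close>

lemma large_independent_if_sparse:
  assumes card: "card F \<le> 2 * (N * N) + k + 1"
  shows "\<exists>A. independent A \<and> m \<le> k * card A"
proof (rule ccontr)
  assume "\<not> ?thesis"
  then have small: "k * card (vertices S) < m" if "S \<in> base" for S
    using base_independent[OF that] by (meson not_less)
  have fin: "finite base"
    by (simp add: base_def finite_F)
  have card_base': "card base \<le> k + 1"
    using card card_base by simp
  have w_le: "w S \<le> 1 / real D" if S: "S \<in> base" "vertices S \<noteq> {}" for S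
  proof -
    obtain i where i: "i < m" "N * N + i \<in> S"
      using S(2) by (auto simp: vertices_def)
    have "w S * of_bool (N * N + i \<in> S) \<le> (\<Sum>S\<in>base. w S * of_bool (N * N + i \<in> S))"
      using S(1) fin by (intro member_le_sum) (auto simp: base_def)
    then show ?thesis
      using base_vertex[of i] i by (simp add: N_def residue_def)
  qed
  have "\<exists>S\<in>base. vertices S = {}"
  proof (rule ccontr)
    assume "\<not> ?thesis"
    then have "sum w base \<le> real (card base) * (1 / real D)"
      using w_le by (intro sum_bounded_above) auto
    also have "\<dots> \<le> real (k + 1) * (1 / real D)"
      using card_base' by (intro mult_right_mono) auto
    finally have "real m \<le> real (k + 1)"
      using D_pos by (simp add: base_total field_simps)
    then show False
      using k_less by linarith
  qed
  then obtain S where S: "S \<in> base" "vertices S = {}" by blast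
  have "real k * (real m / real D) = (\<Sum>S\<in>base. w S * (real k * real (card (vertices S))))"
    unfolding base_vertices_total[symmetric] by (simp add: sum_distrib_left mult.left_commute)
  also have "\<dots> = (\<Sum>S\<in>base - {S}. w S * (real k * real (card (vertices S))))"
    using S fin by (simp add: sum.remove)
  also have "\<dots> \<le> (\<Sum>S\<in>base - {S}. 1 / real D * real (m - 1))"
  proof (rule sum_mono)
    fix A assume A: "A \<in> base - {S}"
    then have A': "A \<in> base" by blast
    have le: "real (k * card (vertices A)) \<le> real (m - 1)"
      using small[OF A'] unfolding of_nat_le_iff by simp
    show "w A * (real k * real (card (vertices A))) \<le> 1 / real D * real (m - 1)"
    proof (cases "vertices A = {}")
      case False
      then show ?thesis
        using le w_le[OF A'] by (intro mult_mono) simp_all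
    qed simp
  qed
  also have "\<dots> = real (card (base - {S})) * (real (m - 1) / real D)"
    by simp
  also have "\<dots> \<le> real k * (real (m - 1) / real D)"
    using card_base' S(1) fin by (intro mult_right_mono) auto
  finally have "real k * real m \<le> real k * real (m - 1)"
    using D_pos by (simp add: field_simps)
  then have "real m \<le> real (m - 1)"
    using k_pos by simp
  then show False
    using k_less by linarith
qed

end

end

section \<open>Construction of decompositions\<close>

context graph_matrix
begin

text \<open>The sets \<open>V \<kappa>\<close> form the part without pair coordinates, with
  correlations \<open>t\<close>. Each pair \<open>p\<close> adds two sets \<open>A p\<close> and
  \<open>B p\<close> of one unit, which together contain each vertex of the pair once, either
  jointly in \<open>A p\<close> or separately. Only the product of the two vertices depends on this
  choice, which corrects \<open>t i j\<close> to 2 for nonadjacent vertices; hence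
  \<open>t i j\<close> has to be 0 or 1.\<close>

lemma decomposes_exists:
  fixes K :: "'a set" and V :: "'a \<Rightarrow> nat set" and \<mu> :: "'a \<Rightarrow> real"
  defines "t i j \<equiv> \<Sum>\<kappa>\<in>K. \<mu> \<kappa> * of_bool (i \<in> V \<kappa> \<and> j \<in> V \<kappa>)"
  assumes K: "finite K" and V: "\<And>\<kappa>. \<kappa> \<in> K \<Longrightarrow> V \<kappa> \<subseteq> {..<N} \<and> V \<kappa> \<noteq> {}"
    and \<mu>: "\<And>\<kappa>. \<kappa> \<in> K \<Longrightarrow> 0 \<le> \<mu> \<kappa>" and total: "sum \<mu> K = real m"
    and diag: "\<And>i. i < N \<Longrightarrow> t i i = real (residue i)"
    and clash: "\<And>i j. i < N \<Longrightarrow> j < N \<Longrightarrow> i \<noteq> j \<Longrightarrow> conflict i j \<Longrightarrow> t i j = 0"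
    and pair: "\<And>i j. i < N \<Longrightarrow> j < N \<Longrightarrow> i \<noteq> j \<Longrightarrow> t i j \<in> {0, 1}"
  shows "\<exists>F w. decomposes size F w \<Gamma> \<and> card F \<le> card K + 2 * (N * N)"
proof -
  \<comment> \<open>If \<open>t a b\<close> is 0, the pairs \<open>(a, b)\<close> and
    \<open>(b, a)\<close> both contribute 1; if it is 1, only the ordered one does. A pair
    \<open>(a, a)\<close> counts as joined so that its vertex is not put into both sets.\<close>
  define joined where "joined a b \<longleftrightarrow> a = b \<or> \<not> conflict a b \<and> (a < b \<or> t a b = 0)" for a b
  define A where "A p = (if joined (p div N) (p mod N) then {p, N * N + p div N, N * N + p mod N}
    else {p, N * N + p div N})" for p
  define B where "B p = (if joined (p div N) (p mod N) then {p} else {p, N * N + p mod N})" for p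
  define S where "S \<iota> = (case \<iota> of Inl \<kappa> \<Rightarrow> (\<lambda>i. N * N + i) ` V \<kappa> | Inr (Inl p) \<Rightarrow> A p | Inr (Inr p) \<Rightarrow> B p)" for \<iota>
  define v where "v \<iota> = (case \<iota> of Inl \<kappa> \<Rightarrow> \<mu> \<kappa> / real D | Inr _ \<Rightarrow> 1 / real D)" for \<iota> :: "'a + nat + nat"
  let ?I = "K <+> {..<N * N} <+> {..<N * N}"
  have sum_I: "(\<Sum>\<iota>\<in>?I. v \<iota> * h (S \<iota>)) =
      ((\<Sum>\<kappa>\<in>K. \<mu> \<kappa> * h ((\<lambda>i. N * N + i) ` V \<kappa>)) + (\<Sum>p<N * N. h (A p) + h (B p))) / real D" for h :: "nat set \<Rightarrow> real"
    by (simp add: sum.Plus K S_def v_def comp_def sum_divide_distrib sum.distrib add_divide_distrib)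
  have N0: "0 < N"
    by (simp add: N_def)
  have div: "p div N < N" "p mod N < N" if "p < N * N" for p
    using that N0 by (simp_all add: less_mult_imp_div_less)
  have mem: "q \<in> A p \<longleftrightarrow> q = p" "q \<in> B p \<longleftrightarrow> q = p" "q \<notin> (\<lambda>i. N * N + i) ` U"
    if "q < N * N" for p q U
    using that by (auto simp: A_def B_def)
  have memX: "N * N + i \<in> A p \<longleftrightarrow> i = p div N \<or> joined (p div N) (p mod N) \<and> i = p mod N"
    "N * N + i \<in> B p \<longleftrightarrow> \<not> joined (p div N) (p mod N) \<and> i = p mod N" if "p < N * N" for p i
    using that by (auto simp: A_def B_def)
  have memV: "N * N + i \<in> (\<lambda>i. N * N + i) ` U \<longleftrightarrow> i \<in> U" for i U
    by auto
  have once: "(of_bool (i = a \<or> joined a b \<and> i = b) + of_bool (\<not> joined a b \<and> i = b) :: real) = of_bool (i = a \<or> i = b)"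
    for i a b
    by (auto simp: joined_def)
  have t_sym: "t i j = t j i" for i j
    by (simp add: t_def conj_commute)
  \<comment> \<open>The entries of the combination, multiplied by \<open>D\<close>.\<close>
  define E where "E i j = (\<Sum>\<kappa>\<in>K. \<mu> \<kappa> * of_bool (i \<in> (\<lambda>i. N * N + i) ` V \<kappa> \<and> j \<in> (\<lambda>i. N * N + i) ` V \<kappa>)) +
    (\<Sum>p<N * N. of_bool (i \<in> A p \<and> j \<in> A p) + of_bool (i \<in> B p \<and> j \<in> B p))" for i j
  have E_sym: "E i j = E j i" for i j
    by (simp add: E_def conj_commute)
  have entry_sym: "entry i j = entry j i" for i j
    using conflict_sym by (auto simp: entry_def)
  have E_pq: "E p q = real (entry p q)" if "p < N * N" "q < N * N" for p q
  proof -
    have "E p q = 0 + (\<Sum>r<N * N. if r = p then 2 * of_bool (p = q) else 0)"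
      unfolding E_def using that mem by (intro arg_cong2[of _ _ _ _ "(+)"] sum.neutral sum.cong) auto
    then show ?thesis
      using that by (simp add: entry_def)
  qed
  have E_pX: "E p (N * N + i) = real (entry p (N * N + i))" if "p < N * N" for p i
  proof -
    have "E p (N * N + i) = 0 + (\<Sum>r<N * N. if r = p then of_bool (i = p div N \<or> i = p mod N) else 0)"
      unfolding E_def
    proof (intro arg_cong2[of _ _ _ _ "(+)"] sum.neutral sum.cong ballI)
      show "\<mu> \<kappa> * of_bool (p \<in> (\<lambda>i. N * N + i) ` V \<kappa> \<and> N * N + i \<in> (\<lambda>i. N * N + i) ` V \<kappa>) = 0" for \<kappa>
        using mem(3)[OF that] by simp
      show "of_bool (p \<in> A r \<and> N * N + i \<in> A r) + of_bool (p \<in> B r \<and> N * N + i \<in> B r) =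
          (if r = p then of_bool (i = p div N \<or> i = p mod N) else 0 :: real)" for r
        using mem(1,2)[OF that, of r] memX[OF that, of i] once[of i "p div N" "p mod N"] by auto
    qed simp
    then show ?thesis
      using that by (simp add: entry_def)
  qed
  have E_X: "E (N * N + i) (N * N + j) = t i j +
     (\<Sum>p<N * N. of_bool (i = p div N \<or> joined (p div N) (p mod N) \<and> i = p mod N) * of_bool (j = p div N \<or> joined (p div N) (p mod N) \<and> j = p mod N) +
       of_bool (\<not> joined (p div N) (p mod N) \<and> i = p mod N) * of_bool (j = p mod N))" for i j
    unfolding E_def memV t_def by (intro arg_cong2[of _ _ _ _ "(+)"] sum.cong) (auto simp: memX)
  have E_ii: "E (N * N + i) (N * N + i) = real (entry (N * N + i) (N * N + i))" if "i < N" for i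
  proof -
    have "E (N * N + i) (N * N + i) = t i i + (\<Sum>p<N * N. of_bool (i = p div N \<or> i = p mod N))"
      unfolding E_X by (rule arg_cong2[of _ _ _ _ "(+)"], rule refl, rule sum.cong) (auto simp: joined_def)
    then show ?thesis
      using diag[OF that] pair_count[OF that] by (simp add: entry_def)
  qed
  have E_ij: "E (N * N + i) (N * N + j) = real (entry (N * N + i) (N * N + j))" if ij: "i < N" "j < N" "i \<noteq> j" for i j
  proof -
    have "E (N * N + i) (N * N + j) = t i j + (\<Sum>p<N * N. (\<lambda>a b. of_bool (a = i) * of_bool (b = j) * of_bool (joined i j) + of_bool (a = j) * of_bool (b = i) * of_bool (joined j i)) (p div N) (p mod N))"
      unfolding E_X by (rule arg_cong2[of _ _ _ _ "(+)"], rule refl, rule sum.cong) (use ij in auto)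
    also have "\<dots> = t i j + (\<Sum>a<N. \<Sum>b<N. of_bool (a = i) * of_bool (b = j) * of_bool (joined i j) + of_bool (a = j) * of_bool (b = i) * of_bool (joined j i))"
      using sum_square[of "\<lambda>a b. of_bool (a = i) * of_bool (b = j) * of_bool (joined i j) + of_bool (a = j) * of_bool (b = i) * of_bool (joined j i) :: real"]
      by (simp only:)
    also have "\<dots> = t i j + of_bool (joined i j) + of_bool (joined j i)"
    proof -
      have "(\<Sum>a<N. \<Sum>b<N. of_bool (a = i) * of_bool (b = j) * c) = (c :: real)" if "i < N" "j < N" for i j c
      proof -
        have delta: "(\<Sum>b<N. of_bool (b = i) * c) = (c :: real)" if "i < N" for i c
        proof -
          have "(\<Sum>b<N. of_bool (b = i) * c) = (\<Sum>b<N. if b = i then c else 0)"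
            by (rule sum.cong) auto
          then show ?thesis using that by simp
        qed
        show ?thesis
          using delta[OF that(2), of c] delta[OF that(1), of c]
          by (simp only: mult.assoc sum_distrib_left[symmetric])
      qed
      then show ?thesis
        using ij by (simp add: sum.distrib)
    qed
    also have "\<dots> = real (entry (N * N + i) (N * N + j))"
    proof (cases "conflict i j")
      case True
      then show ?thesis
        using clash[OF ij] conflict_sym ij(3) by (auto simp: entry_def joined_def)
    next
      case False
      then have "\<not> conflict j i"
        using conflict_sym by blast
      then have "of_bool (joined i j) + of_bool (joined j i) = 2 - t i j"
        using False pair[OF ij] t_sym[of j i] ij(3) by (auto simp: joined_def)
      then show ?thesis
        using False ij(3) by (simp add: entry_def)
    qed
    finally show ?thesis .
  qed
  have E: "E i j = real (entry i j)" if "i < size" "j < size" for i j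
  proof (cases "i < N * N")
    case i: True
    show ?thesis
    proof (cases "j < N * N")
      case True
      then show ?thesis using E_pq i by simp
    next
      case False
      then show ?thesis
        using E_pX[OF i, of "j - N * N"] by simp
    qed
  next
    case i: False
    show ?thesis
    proof (cases "j < N * N")
      case True
      then show ?thesis
        using E_pX[OF True, of "i - N * N"] i E_sym[of i j] entry_sym[of i j] by simp
    next
      case False
      then show ?thesis
        using E_ii[of "i - N * N"] E_ij[of "i - N * N" "j - N * N"] i that
        by (cases "i = j") (auto simp: size_def)
    qed
  qed
  have "\<exists>F w. decomposes size F w \<Gamma> \<and> card F \<le> card ?I"
  proof (rule decomposes_indexed[where S = S and v = v])
    show "finite ?I"
      using K by simp
    have AB: "A p \<subseteq> {..<size} \<and> A p \<noteq> {}" "B p \<subseteq> {..<size} \<and> B p \<noteq> {}" if "p < N * N" for p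
      using that div[OF that] by (auto simp: A_def B_def size_def)
    have VX: "(\<lambda>i. N * N + i) ` V \<kappa> \<subseteq> {..<size} \<and> (\<lambda>i. N * N + i) ` V \<kappa> \<noteq> {}" if "\<kappa> \<in> K" for \<kappa>
      using V[OF that] by (auto simp: size_def)
    show "S \<iota> \<subseteq> {..<size} \<and> S \<iota> \<noteq> {}" if "\<iota> \<in> ?I" for \<iota>
      using that AB VX by (elim PlusE) (simp_all add: S_def)
    show "0 \<le> v \<iota>" if "\<iota> \<in> ?I" for \<iota>
      using that \<mu> by (auto simp: v_def)
    show "sum v ?I = 1"
    proof -
      have "real m + (\<Sum>p<N * N. 1 + 1) = real D"
        by (simp add: D_def)
      then show ?thesis
        using sum_I[of "\<lambda>_. 1"] total D_pos by simp
    qed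
    show "\<Gamma> i j = (\<Sum>\<iota>\<in>?I. v \<iota> * of_bool (i \<in> S \<iota> \<and> j \<in> S \<iota>))" if "i < size" "j < size" for i j
      unfolding sum_I[of "\<lambda>A. of_bool (i \<in> A \<and> j \<in> A)"] E_def[symmetric] E[OF that] \<Gamma>_def ..
  qed
  moreover have "card ?I = card K + 2 * (N * N)"
    using K by (simp add: card_Plus)
  ultimately show ?thesis by simp
qed

text \<open>The colour classes receive one unit each and the additional vertex alone receives
  \<open>m - k\<close> units. As it shares no set with other vertices, this works for both values of
  \<open>e\<close>; surjectivity of the colouring keeps the sets nonempty.\<close>

lemma decomposes_if_colorable:
  fixes color :: "nat \<Rightarrow> nat"
  assumes color: "\<And>i. i < m \<Longrightarrow> color i < k" and onto: "\<And>c. c < k \<Longrightarrow> \<exists>i<m. color i = c"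
    and proper: "\<And>i j. i < m \<Longrightarrow> j < m \<Longrightarrow> i \<noteq> j \<Longrightarrow> adj i j \<Longrightarrow> color i \<noteq> color j"
  shows "\<exists>F w. decomposes size F w \<Gamma> \<and> card F \<le> 2 * (N * N) + k + 1"
proof -
  define V where "V c = (if c = k then {m} else {i. i < m \<and> color i = c})" for c
  define \<mu> where "\<mu> c = (if c = k then real (m - k) else 1)" for c
  have t: "(\<Sum>c<Suc k. \<mu> c * of_bool (i \<in> V c \<and> j \<in> V c)) =
    (if i = m \<and> j = m then real (m - k) else of_bool (i < m \<and> j < m \<and> color i = color j))" for i j
  proof -
    have "(\<Sum>c<k. \<mu> c * of_bool (i \<in> V c \<and> j \<in> V c)) = (\<Sum>c<k. if c = color i then of_bool (i < m \<and> j < m \<and> color i = color j) else 0)"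
      by (rule sum.cong) (auto simp: V_def \<mu>_def)
    also have "\<dots> = of_bool (i < m \<and> j < m \<and> color i = color j)"
      using color by auto
    finally show ?thesis
      by (auto simp: V_def \<mu>_def)
  qed
  have "\<exists>F w. decomposes size F w \<Gamma> \<and> card F \<le> card {..<Suc k} + 2 * (N * N)"
  proof (rule decomposes_exists[where V = V and \<mu> = \<mu>], unfold t)
    show "V c \<subseteq> {..<N} \<and> V c \<noteq> {}" if "c \<in> {..<Suc k}" for c
      using that onto[of c] by (auto simp: V_def N_def)
    show "sum \<mu> {..<Suc k} = real m"
      using k_less by (simp add: \<mu>_def)
    show "(if i = m \<and> i = m then real (m - k) else of_bool (i < m \<and> i < m \<and> color i = color i)) = real (residue i)" if "i < N" for i
      using that by (auto simp: residue_def N_def)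
    show "(if i = m \<and> j = m then real (m - k) else of_bool (i < m \<and> j < m \<and> color i = color j)) = 0"
      if "i < N" "j < N" "i \<noteq> j" "conflict i j" for i j
      using that proper[of i j] by (auto simp: conflict_def)
  qed (auto simp: \<mu>_def)
  then show ?thesis by (simp add: add.commute)
qed

text \<open>Singletons of one unit cover any graph, whatever its edges are, and the isolated vertex
  can be added to \<open>m - k\<close> of them.\<close>

lemma decomposes_if_isolated:
  assumes "\<not> e"
  shows "\<exists>F w. decomposes size F w \<Gamma>"
proof -
  define V where "V i = (if i < m - k then {i, m} else {i})" for i
  have km: "{..<m} \<inter> {i. i < m - k} = {..<m - k}"
    by auto
  have t: "(\<Sum>c<m. 1 * of_bool (i \<in> V c \<and> j \<in> V c)) =
    (if i = m \<and> j = m then real (m - k) else if i = m then of_bool (j < m - k) else if j = m then of_bool (i < m - k)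
     else of_bool (i < m \<and> i = j))" for i j
  proof (cases "i = m \<and> j = m")
    case True
    have "(\<Sum>c<m. 1 * of_bool (i \<in> V c \<and> j \<in> V c)) = (\<Sum>c<m. of_bool (c < m - k) :: real)"
      using True by (intro sum.cong) (auto simp: V_def)
    then show ?thesis
      using True by (simp add: sum_of_bool_eq km)
  next
    case False
    define i' where "i' = (if i = m then j else i)"
    have "(\<Sum>c<m. 1 * of_bool (i \<in> V c \<and> j \<in> V c)) = (\<Sum>c<m. if c = i' then of_bool (i' \<in> V i' \<and> i \<in> V i' \<and> j \<in> V i') else 0 :: real)"
      using False by (intro sum.cong) (auto simp: V_def i'_def)
    also have "\<dots> = of_bool (i' < m \<and> i \<in> V i' \<and> j \<in> V i')"
      by (auto simp: V_def)
    finally show ?thesis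
      using False by (auto simp: V_def i'_def)
  qed
  have "\<exists>F w. decomposes size F w \<Gamma> \<and> card F \<le> card {..<m} + 2 * (N * N)"
  proof (rule decomposes_exists[where V = V and \<mu> = "\<lambda>_. 1"], unfold t)
    show "(if i = m \<and> j = m then real (m - k) else if i = m then of_bool (j < m - k) else if j = m then of_bool (i < m - k)
     else of_bool (i < m \<and> i = j)) = 0" if "i < N" "j < N" "i \<noteq> j" "conflict i j" for i j
      using that assms unfolding conflict_def by (auto split: if_splits)
  qed (auto simp: V_def N_def residue_def)
  then show ?thesis by blast
qed

end

section \<open>Convex combinations of the generators\<close>

definition cor_generator :: "nat \<Rightarrow> nat set \<Rightarrow> real mat" where
  "cor_generator n S = outer (vec n (\<lambda>i. of_bool (i \<in> S)))"

text \<open>The sign of the last coordinate is normalized to 1.\<close>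

definition cut_generator :: "nat \<Rightarrow> nat set \<Rightarrow> real mat" where
  "cut_generator n S = outer (vec (Suc n) (\<lambda>i. if i \<in> S then -1 else 1))"

lemma cor_generator_entry: "i < n \<Longrightarrow> j < n \<Longrightarrow> cor_generator n S $$ (i, j) = of_bool (i \<in> S \<and> j \<in> S)"
  by (simp add: cor_generator_def outer_def)

lemma cut_generator_entry:
  "i < Suc n \<Longrightarrow> j < Suc n \<Longrightarrow> cut_generator n S $$ (i, j) =
     1 - 2 * of_bool (i \<in> S) - 2 * of_bool (j \<in> S) + 4 * of_bool (i \<in> S \<and> j \<in> S)"
  by (auto simp: cut_generator_def outer_def)

lemma inj_cor_generator: "inj_on (cor_generator n) (Pow {..<n} - {{}})"
proof (rule inj_onI)
  fix S S' assume S: "S \<in> Pow {..<n} - {{}}" "S' \<in> Pow {..<n} - {{}}" and eq: "cor_generator n S = cor_generator n S'"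
  have "i \<in> S \<longleftrightarrow> i \<in> S'" if "i < n" for i
    using arg_cong[OF eq, of "\<lambda>A. A $$ (i, i)"] that by (auto simp: cor_generator_entry split: if_splits)
  then show "S = S'"
    using S by blast
qed

text \<open>Column \<open>n\<close> reveals the set, because coordinate \<open>n\<close> has sign
  1.\<close>

lemma inj_cut_generator: "inj_on (cut_generator n) (Pow {..<n} - {{}})"
proof (rule inj_onI)
  fix S S' assume S: "S \<in> Pow {..<n} - {{}}" "S' \<in> Pow {..<n} - {{}}" and eq: "cut_generator n S = cut_generator n S'"
  then have n: "n \<notin> S" "n \<notin> S'"
    by auto
  have "i \<in> S \<longleftrightarrow> i \<in> S'" if "i < n" for i
    using arg_cong[OF eq, of "\<lambda>A. A $$ (i, n)"] that n by (auto simp: cut_generator_entry of_bool_def split: if_splits)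
  then show "S = S'"
    using S by blast
qed

lemma COR_generators_eq: "COR_generators n = cor_generator n ` (Pow {..<n} - {{}})"
proof
  show "COR_generators n \<subseteq> cor_generator n ` (Pow {..<n} - {{}})"
  proof
    fix A assume "A \<in> COR_generators n"
    then obtain x where x: "x \<in> carrier_vec n" "\<forall>i<n. x $ i \<in> {0, 1}" "x \<noteq> 0\<^sub>v n" and A: "A = outer x"
      by (auto simp: COR_generators_def)
    define S where "S = {i. i < n \<and> x $ i = 1}"
    have x_eq: "x = vec n (\<lambda>i. of_bool (i \<in> S))"
      using x by (intro eq_vecI) (auto simp: S_def)
    have "S \<noteq> {}"
      using x(3) unfolding x_eq by (auto simp: zero_vec_def)
    then have "S \<in> Pow {..<n} - {{}}"
      by (auto simp: S_def)
    moreover have "A = cor_generator n S"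
      unfolding A cor_generator_def using x_eq by simp
    ultimately show "A \<in> cor_generator n ` (Pow {..<n} - {{}})"
      by blast
  qed
  show "cor_generator n ` (Pow {..<n} - {{}}) \<subseteq> COR_generators n"
  proof (rule image_subsetI)
    fix S assume S: "S \<in> Pow {..<n} - {{}}"
    then obtain i where i: "i \<in> S" "i < n" by auto
    let ?x = "vec n (\<lambda>i. of_bool (i \<in> S)) :: real vec"
    have "?x $ i \<noteq> 0\<^sub>v n $ i"
      using i by simp
    then have "?x \<noteq> 0\<^sub>v n"
      by metis
    then show "cor_generator n S \<in> COR_generators n"
      unfolding COR_generators_def cor_generator_def by (intro imageI) auto
  qed
qed

text \<open>A vector and its negative have the same outer product, so only the set \<open>S\<close>
  of coordinates whose sign differs from the last one matters. It is empty exactly for the two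
  excluded constant vectors.\<close>

lemma CUT_generators_eq: "CUT_generators (Suc n) = cut_generator n ` (Pow {..<n} - {{}})"
proof
  show "CUT_generators (Suc n) \<subseteq> cut_generator n ` (Pow {..<n} - {{}})"
  proof
    fix A assume "A \<in> CUT_generators (Suc n)"
    then obtain y where y: "y \<in> carrier_vec (Suc n)" "\<forall>i<Suc n. y $ i \<in> {-1, 1}" "y \<noteq> all_one_vec (Suc n)" "y \<noteq> - all_one_vec (Suc n)"
      and A: "A = outer y"
      by (auto simp: CUT_generators_def)
    define S where "S = {i. i < n \<and> y $ i \<noteq> y $ n}"
    have sq: "y $ n = 1 \<or> y $ n = -1"
      using y(2) by auto
    have entry: "y $ i = (if i \<in> S then - (y $ n) else y $ n)" if "i < Suc n" for i
      using that y(2) sq by (cases "i = n") (auto simp: S_def)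
    have "S \<noteq> {}"
    proof
      assume "S = {}"
      then have const: "y $ i = y $ n" if "i < Suc n" for i
        using entry[OF that] by simp
      have dim: "dim_vec y = Suc n"
        using y(1) by simp
      show False
        using sq
      proof
        assume "y $ n = 1"
        then have "y $ i = 1" if "i < Suc n" for i
          using const[OF that] by simp
        then have "y = all_one_vec (Suc n)"
          by (intro eq_vecI) (simp_all add: all_one_vec_def dim)
        then show False using y(3) by blast
      next
        assume "y $ n = -1"
        then have "y $ i = -1" if "i < Suc n" for i
          using const[OF that] by simp
        then have "y = - all_one_vec (Suc n)"
          by (intro eq_vecI) (simp_all add: all_one_vec_def dim)
        then show False using y(4) by blast
      qed
    qed
    then have "S \<in> Pow {..<n} - {{}}"
      by (auto simp: S_def)
    moreover have "A = cut_generator n S"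
    proof (rule eq_matI)
      fix i j assume "i < dim_row (cut_generator n S)" "j < dim_col (cut_generator n S)"
      then have ij: "i < Suc n" "j < Suc n"
        by (simp_all add: cut_generator_def outer_def)
      then show "A $$ (i, j) = cut_generator n S $$ (i, j)"
        using sq y(1) entry[OF ij(1)] entry[OF ij(2)] by (auto simp: A outer_def cut_generator_def)
    qed (use y in \<open>auto simp: A outer_def cut_generator_def\<close>)
    ultimately show "A \<in> cut_generator n ` (Pow {..<n} - {{}})"
      by blast
  qed
  show "cut_generator n ` (Pow {..<n} - {{}}) \<subseteq> CUT_generators (Suc n)"
  proof (rule image_subsetI)
    fix S assume S: "S \<in> Pow {..<n} - {{}}"
    then obtain i where i: "i \<in> S" "i < n" and n: "n \<notin> S" by auto
    let ?y = "vec (Suc n) (\<lambda>i. if i \<in> S then -1 else 1) :: real vec"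
    have "?y $ i \<noteq> all_one_vec (Suc n) $ i" "?y $ n \<noteq> (- all_one_vec (Suc n)) $ n"
      using i n by (simp_all add: all_one_vec_def)
    then have "?y \<noteq> all_one_vec (Suc n)" "?y \<noteq> - all_one_vec (Suc n)"
      by metis+
    then show "cut_generator n S \<in> CUT_generators (Suc n)"
      unfolding CUT_generators_def cut_generator_def by (intro imageI) auto
  qed
qed

text \<open>The predicate \<open>Q\<close> treats membership in the hull and the bounded number of
  generators at once. Injectivity of \<open>gen\<close> makes the number of matrices equal to the
  number of sets.\<close>

lemma convex_combination_image:
  assumes inj: "inj_on gen X" and A: "A \<in> carrier_mat n n"
  shows "(\<exists>T\<subseteq>gen ` X. Q (card T) \<and> convex_combination n T A) \<longleftrightarrow>
    (\<exists>F w. F \<subseteq> X \<and> finite F \<and> Q (card F) \<and> (\<forall>S\<in>F. 0 \<le> w S) \<and> sum w F = 1 \<and>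
       (\<forall>i<n. \<forall>j<n. A $$ (i, j) = (\<Sum>S\<in>F. w S * gen S $$ (i, j))))"
    (is "?lhs \<longleftrightarrow> ?rhs")
proof
  assume ?lhs
  then obtain T u where T: "T \<subseteq> gen ` X" "Q (card T)" "finite T" "\<forall>B\<in>T. 0 \<le> u B" "sum u T = 1"
    "A = mat n n (\<lambda>(i, j). \<Sum>B\<in>T. u B * B $$ (i, j))"
    by (auto simp: convex_combination_def)
  then obtain F where F: "F \<subseteq> X" "T = gen ` F"
    by (meson subset_imageE)
  then have inj': "inj_on gen F"
    using inj inj_on_subset by blast
  show ?rhs
  proof (intro exI[of _ F] exI[of _ "u \<circ> gen"] conjI)
    show "finite F"
      using F(2) T(3) inj' finite_imageD by blast
    show "Q (card F)"
      using T(2) F(2) card_image[OF inj'] by simp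
    show "sum (u \<circ> gen) F = 1"
      using T(5) F(2) sum.reindex[OF inj'] by metis
    show "\<forall>i<n. \<forall>j<n. A $$ (i, j) = (\<Sum>S\<in>F. (u \<circ> gen) S * gen S $$ (i, j))"
      using T(6) F(2) by (simp add: sum.reindex[OF inj'])
  qed (use F T in auto)
next
  assume ?rhs
  then obtain F w where F: "F \<subseteq> X" "finite F" "Q (card F)" "\<forall>S\<in>F. 0 \<le> w S" "sum w F = 1"
    "\<forall>i<n. \<forall>j<n. A $$ (i, j) = (\<Sum>S\<in>F. w S * gen S $$ (i, j))"
    by blast
  have inj': "inj_on gen F"
    using F(1) inj inj_on_subset by blast
  define u where "u = w \<circ> inv_into F gen"
  have u: "u (gen S) = w S" if "S \<in> F" for S
    using that inj' by (simp add: u_def)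
  have "convex_combination n (gen ` F) A"
    unfolding convex_combination_def
  proof (intro conjI exI[of _ u])
    show "A = mat n n (\<lambda>(i, j). \<Sum>B\<in>gen ` F. u B * B $$ (i, j))"
      using A F(6) by (intro eq_matI) (auto simp: sum.reindex[OF inj'] u)
    show "sum u (gen ` F) = 1"
      using F(5) by (simp add: sum.reindex[OF inj'] u)
  qed (use F u in auto)
  then show ?lhs
    using F(1,3) card_image[OF inj'] by (intro exI[of _ "gen ` F"]) auto
qed

lemma COR_combination_iff:
  assumes "A \<in> carrier_mat n n" and "\<And>i j. i < n \<Longrightarrow> j < n \<Longrightarrow> A $$ (i, j) = \<Gamma> i j"
  shows "(\<exists>T\<subseteq>COR_generators n. Q (card T) \<and> convex_combination n T A) \<longleftrightarrow> (\<exists>F w. Q (card F) \<and> decomposes n F w \<Gamma>)"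
proof -
  have "F \<subseteq> Pow {..<n} - {{}} \<and> finite F \<and> Q (card F) \<and> (\<forall>S\<in>F. 0 \<le> w S) \<and> sum w F = 1 \<and>
       (\<forall>i<n. \<forall>j<n. A $$ (i, j) = (\<Sum>S\<in>F. w S * cor_generator n S $$ (i, j))) \<longleftrightarrow> Q (card F) \<and> decomposes n F w \<Gamma>" for F w
  proof -
    have "(\<forall>i<n. \<forall>j<n. A $$ (i, j) = (\<Sum>S\<in>F. w S * cor_generator n S $$ (i, j))) \<longleftrightarrow>
        (\<forall>i<n. \<forall>j<n. \<Gamma> i j = (\<Sum>S\<in>F. w S * of_bool (i \<in> S \<and> j \<in> S)))"
      by (simp only: assms(2) cor_generator_entry cong: imp_cong)
    then show ?thesis
      using decomposes_finite[of n F w \<Gamma>] unfolding decomposes_def by blast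
  qed
  then show ?thesis
    unfolding COR_generators_eq convex_combination_image[OF inj_cor_generator assms(1)] by simp
qed

text \<open>The matrix \<open>g\<close> extends \<open>\<Gamma>\<close> by a zero row and column, as
  \<open>n\<close> belongs to no set. The affine map can be undone: the last column determines the
  diagonal, and then every entry determines that of \<open>\<Gamma>\<close>. Its constant term comes
  out right because the weights sum to 1.\<close>

lemma CUT_combination_iff:
  assumes A: "A \<in> carrier_mat (Suc n) (Suc n)"
    and g: "\<And>i j. g i j = (if i < n \<and> j < n then \<Gamma> i j else 0)"
    and entries: "\<And>i j. i < Suc n \<Longrightarrow> j < Suc n \<Longrightarrow> A $$ (i, j) = 1 - 2 * g i i - 2 * g j j + 4 * g i j"
  shows "(\<exists>T\<subseteq>CUT_generators (Suc n). Q (card T) \<and> convex_combination (Suc n) T A) \<longleftrightarrow> (\<exists>F w. Q (card F) \<and> decomposes n F w \<Gamma>)"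
proof -
  have eq: "(\<forall>i<Suc n. \<forall>j<Suc n. A $$ (i, j) = (\<Sum>S\<in>F. w S * cut_generator n S $$ (i, j))) \<longleftrightarrow>
      (\<forall>i<n. \<forall>j<n. \<Gamma> i j = (\<Sum>S\<in>F. w S * of_bool (i \<in> S \<and> j \<in> S)))" (is "?l \<longleftrightarrow> ?r")
    if F: "F \<subseteq> Pow {..<n} - {{}}" and w: "sum w F = 1" for F w
  proof -
    define s where "s i j = (\<Sum>S\<in>F. w S * of_bool (i \<in> S \<and> j \<in> S))" for i j
    have cut: "(\<Sum>S\<in>F. w S * cut_generator n S $$ (i, j)) = 1 - 2 * s i i - 2 * s j j + 4 * s i j"
      if "i < Suc n" "j < Suc n" for i j
    proof -
      have "(\<Sum>S\<in>F. w S * cut_generator n S $$ (i, j)) =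
          (\<Sum>S\<in>F. w S - 2 * (w S * of_bool (i \<in> S \<and> i \<in> S)) - 2 * (w S * of_bool (j \<in> S \<and> j \<in> S)) + 4 * (w S * of_bool (i \<in> S \<and> j \<in> S)))"
        using that by (intro sum.cong) (auto simp: cut_generator_entry)
      then show ?thesis
        unfolding s_def sum.distrib sum_subtractf sum_distrib_left[symmetric] w .
    qed
    have s_n: "s i j = 0" if "\<not> (i < n \<and> j < n)" for i j
      unfolding s_def using that F by (intro sum.neutral) auto
    have "?l \<longleftrightarrow> (\<forall>i<Suc n. \<forall>j<Suc n. 1 - 2 * g i i - 2 * g j j + 4 * g i j = 1 - 2 * s i i - 2 * s j j + 4 * s i j)"
      using cut entries by auto
    also have "\<dots> \<longleftrightarrow> (\<forall>i<n. \<forall>j<n. \<Gamma> i j = s i j)"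
    proof
      assume *: "\<forall>i<Suc n. \<forall>j<Suc n. 1 - 2 * g i i - 2 * g j j + 4 * g i j = 1 - 2 * s i i - 2 * s j j + 4 * s i j"
      have diag: "g i i = s i i" if "i < n" for i
        using *[rule_format, of i n] that s_n[of i n] s_n[of n n] g[of i n] g[of n n] by simp
      show "\<forall>i<n. \<forall>j<n. \<Gamma> i j = s i j"
      proof (intro allI impI)
        fix i j assume ij: "i < n" "j < n"
        show "\<Gamma> i j = s i j"
          using *[rule_format, of i j] ij diag[OF ij(1)] diag[OF ij(2)] g[of i j] by simp
      qed
    next
      assume "\<forall>i<n. \<forall>j<n. \<Gamma> i j = s i j"
      then have "g i j = s i j" for i j
        using g[of i j] s_n[of i j] by auto
      then show "\<forall>i<Suc n. \<forall>j<Suc n. 1 - 2 * g i i - 2 * g j j + 4 * g i j = 1 - 2 * s i i - 2 * s j j + 4 * s i j"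
        by simp
    qed
    finally show ?thesis
      unfolding s_def .
  qed
  have "F \<subseteq> Pow {..<n} - {{}} \<and> finite F \<and> Q (card F) \<and> (\<forall>S\<in>F. 0 \<le> w S) \<and> sum w F = 1 \<and>
       (\<forall>i<Suc n. \<forall>j<Suc n. A $$ (i, j) = (\<Sum>S\<in>F. w S * cut_generator n S $$ (i, j))) \<longleftrightarrow> Q (card F) \<and> decomposes n F w \<Gamma>" for F w
  proof (cases "F \<subseteq> Pow {..<n} - {{}} \<and> sum w F = 1")
    case True
    then have "finite F"
      using finite_subset[of F "Pow {..<n}"] by auto
    with True show ?thesis
      unfolding decomposes_def eq[OF conjunct1[OF True] conjunct2[OF True]] by blast
  next
    case False
    then show ?thesis
      unfolding decomposes_def by blast
  qed
  then show ?thesis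
    unfolding CUT_generators_eq convex_combination_image[OF inj_cut_generator A] by simp
qed

section \<open>From satisfiability to graphs\<close>

text \<open>
  The graph has a vertex \<open>(u, c)\<close> for every unknown \<open>u\<close> and every colour \<open>c\<close> modulo \<open>2 n\<close>. Unknown 0
  is the origin of the colours; relative to it, unknown \<open>1 + v\<close> is the false literal of the variable
  \<open>v\<close>, and unknown \<open>1 + n + j\<close> is a true literal of clause \<open>j\<close>. The constraints between unknowns are invariant
  under a common shift of the colours, so that the shifts of one solution partition the vertices
  into independent sets.
\<close>

definition clash :: "nat \<Rightarrow> (nat \<Rightarrow> nat \<Rightarrow> bool) \<Rightarrow> nat \<Rightarrow> nat \<Rightarrow> nat \<Rightarrow> nat \<Rightarrow> bool" where
  "clash n C u c u' c' \<longleftrightarrow>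
     u = 0 \<and> 1 \<le> u' \<and> u' \<le> n \<and> (c' + 2 * n - c) mod (2 * n) div 2 \<noteq> u' - 1 \<or>
     u = 0 \<and> n < u' \<and> \<not> C (u' - 1 - n) ((c' + 2 * n - c) mod (2 * n)) \<or>
     1 \<le> u \<and> u \<le> n \<and> n < u' \<and> c = c'"

text \<open>The vertices of one unknown are mutually adjacent, so an independent set has at most one
  colour per unknown, that is, at most \<open>m / k\<close> vertices for
  \<open>k = 2 * n\<close>.\<close>

definition sat_adj :: "nat \<Rightarrow> (nat \<Rightarrow> nat \<Rightarrow> bool) \<Rightarrow> nat \<Rightarrow> nat \<Rightarrow> bool" where
  "sat_adj n C i j \<longleftrightarrow> i div (2 * n) = j div (2 * n) \<or>
     clash n C (i div (2 * n)) (i mod (2 * n)) (j div (2 * n)) (j mod (2 * n)) \<or>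
     clash n C (j div (2 * n)) (j mod (2 * n)) (i div (2 * n)) (i mod (2 * n))"

definition satisfiable :: "nat \<Rightarrow> nat \<Rightarrow> (nat \<Rightarrow> nat \<Rightarrow> bool) \<Rightarrow> bool" where
  "satisfiable n l C \<longleftrightarrow> (\<exists>\<beta>. \<forall>j<l. \<exists>a<2 * n. C j a \<and> (\<beta> (a div 2) \<longleftrightarrow> even a))"

lemma sat_graph_matrix:
  assumes "0 < n"
  shows "graph_matrix ((1 + n + l) * (2 * n)) (2 * n) (sat_adj n C)"
proof
  show "sat_adj n C i j \<Longrightarrow> sat_adj n C j i" for i j
    by (auto simp: sat_adj_def)
  have "2 * (2 * n) \<le> (1 + n + l) * (2 * n)"
    using assms by (intro mult_right_mono) auto
  then show "2 * n + 1 < (1 + n + l) * (2 * n)"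
    using assms by linarith
qed (use assms in simp)

lemma mod_double: "x < 2 * k \<Longrightarrow> x mod k = (if x < k then x else x - k)" for x k :: nat
  by (simp add: mod_if[of x])

lemma shift_cancel: "a < k \<Longrightarrow> b < k \<Longrightarrow> c < k \<Longrightarrow> ((b + c) mod k + k - (a + c) mod k) mod k = (b + k - a) mod k" for a b c k :: nat
  by (simp add: mod_double)

lemma shift_back:
  fixes a c k :: nat
  assumes "a < k" "c < k"
  shows "(a + (c + k - a) mod k) mod k = c"
proof (cases "a \<le> c")
  case True
  then have "c + k - a = (c - a) + k" by simp
  then have "(c + k - a) mod k = (c - a) mod k" by (simp only: mod_add_self2)
  also have "\<dots> = c - a" using assms by simp
  finally show ?thesis using True assms by simp
next
  case False
  then have "(c + k - a) mod k = c + k - a" using assms by simp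
  then show ?thesis using False assms by simp
qed

lemma shift_inj: "a < k \<Longrightarrow> b < k \<Longrightarrow> c < k \<Longrightarrow> (a + k - c) mod k = (b + k - c) mod k \<Longrightarrow> a = b" for a b c k :: nat
  by (auto simp: mod_double split: if_splits)

text \<open>\<open>sol\<close> is the solution with origin 0. Vertex \<open>(u, c)\<close> receives
  the colour \<open>c - sol u\<close> modulo \<open>k\<close>, so class \<open>s\<close> consists of
  the vertices \<open>(u, sol u + s)\<close>, the solution shifted by \<open>s\<close>.\<close>

lemma sat_colorable:
  assumes sat: "satisfiable n l C" and n: "0 < n"
  defines "k \<equiv> 2 * n"
  obtains color :: "nat \<Rightarrow> nat" where "\<And>i. i < (1 + n + l) * k \<Longrightarrow> color i < k"
    "\<And>c. c < k \<Longrightarrow> \<exists>i<(1 + n + l) * k. color i = c"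
    "\<And>i j. i < (1 + n + l) * k \<Longrightarrow> j < (1 + n + l) * k \<Longrightarrow> i \<noteq> j \<Longrightarrow> sat_adj n C i j \<Longrightarrow> color i \<noteq> color j"
proof -
  have k: "0 < k"
    using n by (simp add: k_def)
  obtain \<beta> where "\<forall>j<l. \<exists>a<k. C j a \<and> (\<beta> (a div 2) \<longleftrightarrow> even a)"
    using sat unfolding satisfiable_def k_def by blast
  then obtain a where a: "\<And>j. j < l \<Longrightarrow> a j < k \<and> C j (a j) \<and> (\<beta> (a j div 2) \<longleftrightarrow> even (a j))"
    by metis
  define sol where "sol u = (if u = 0 then 0 else if u \<le> n then 2 * (u - 1) + of_bool (\<beta> (u - 1)) else a (u - 1 - n))" for u
  have sol_less: "sol u < k" if "u < 1 + n + l" for u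
    using that a[of "u - 1 - n"] n by (auto simp: sol_def k_def)
  define color where "color i = (i mod k + k - sol (i div k)) mod k" for i
  have no_clash: "\<not> clash n C u ((sol u + s) mod k) u' ((sol u' + s) mod k)"
    if "u < 1 + n + l" "u' < 1 + n + l" "s < k" for u u' s
  proof
    assume clash: "clash n C u ((sol u + s) mod k) u' ((sol u' + s) mod k)"
    have cancel: "((sol u' + s) mod k + k - (sol u + s) mod k) mod k = (sol u' + k - sol u) mod k"
      using shift_cancel sol_less that by blast
    have shift: "((sol u' + s) mod k + k - (sol u + s) mod k) mod k = sol u'" if "u = 0"
    proof -
      have "sol u = 0"
        using that by (simp add: sol_def)
      then show ?thesis
        using sol_less[OF \<open>u' < 1 + n + l\<close>] unfolding cancel by (simp only: diff_zero mod_add_self2 mod_less)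
    qed
    have "sol u' div 2 = u' - 1" if "1 \<le> u'" "u' \<le> n"
      using that by (simp add: sol_def)
    moreover have "C (u' - 1 - n) (sol u')" if "n < u'"
      using that a[of "u' - 1 - n"] \<open>u' < 1 + n + l\<close> by (simp add: sol_def)
    ultimately have u: "1 \<le> u" "u \<le> n" "n < u'" and eq: "(sol u + s) mod k = (sol u' + s) mod k"
      using clash shift unfolding clash_def k_def[symmetric] by auto
    have "((sol u' + s) mod k + k - (sol u' + s) mod k) mod k = (sol u' + k - sol u) mod k"
      using cancel unfolding eq .
    then have "(sol u' + k - sol u) mod k = (sol u + k - sol u) mod k"
      by (simp only: add_diff_cancel_left' mod_self)
    then have "sol u' = sol u"
      using shift_inj sol_less that(1,2) by blast
    then have "a (u' - 1 - n) = 2 * (u - 1) + of_bool (\<beta> (u - 1))"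
      using u by (simp add: sol_def)
    moreover from this have "a (u' - 1 - n) div 2 = u - 1"
      by simp
    moreover have "u' - 1 - n < l"
      using u that by simp
    ultimately show False
      using a[of "u' - 1 - n"] by (cases "\<beta> (u - 1)") auto
  qed
  show thesis
  proof (rule that[of color])
    show "color i < k" for i
      using k by (simp add: color_def)
    show "\<exists>i<(1 + n + l) * k. color i = c" if "c < k" for c
      using that by (intro exI[of _ c]) (simp add: color_def sol_def)
    fix i j assume ij: "i < (1 + n + l) * k" "j < (1 + n + l) * k" "i \<noteq> j" "sat_adj n C i j"
    have u: "i div k < 1 + n + l" "j div k < 1 + n + l"
      using ij by (simp_all only: less_mult_imp_div_less)
    show "color i \<noteq> color j"
    proof
      assume same: "color i = color j"
      have s: "color i < k"
        using k by (simp add: color_def)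
      have c: "i mod k = (sol (i div k) + color i) mod k" "j mod k = (sol (j div k) + color i) mod k"
        using shift_back[OF sol_less[OF u(1)], of "i mod k"] shift_back[OF sol_less[OF u(2)], of "j mod k"] k
        unfolding color_def[symmetric] same[symmetric] by auto
      have "i div k = j div k"
        using ij(4) no_clash[OF u s] no_clash[OF u(2,1) s] unfolding sat_adj_def k_def[symmetric] c by blast
      then have "i div k * k + i mod k = j div k * k + j mod k"
        using c by simp
      then show False
        using ij(3) by simp
    qed
  qed
qed

text \<open>The size forces exactly one vertex per unknown; \<open>d\<close> is its colour relative
  to unknown 0. A variable is true if its chosen false literal \<open>d (Suc v)\<close> is the odd
  one, the negation. The literal chosen for a clause has the same variable as some
  \<open>d (Suc v)\<close> but differs from it, hence is true.\<close>

lemma sat_if_large_independent: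
  assumes n: "0 < n" and A: "A \<subseteq> {..<(1 + n + l) * (2 * n)}" "\<forall>i\<in>A. \<forall>j\<in>A. i \<noteq> j \<longrightarrow> \<not> sat_adj n C i j"
    and large: "(1 + n + l) * (2 * n) \<le> 2 * n * card A"
  shows "satisfiable n l C"
proof -
  define k where "k = 2 * n"
  have k: "0 < k"
    using n by (simp add: k_def)
  have inj: "inj_on (\<lambda>i. i div k) A"
    using A(2) unfolding inj_on_def sat_adj_def k_def by blast
  have fin: "finite A"
    using A(1) finite_subset by blast
  have "k * (1 + n + l) \<le> k * card A"
    using large by (simp add: k_def mult.commute)
  then have "1 + n + l \<le> card A"
    using k nat_mult_le_cancel1 by blast
  then have "card {..<1 + n + l} \<le> card ((\<lambda>i. i div k) ` A)"
    by (simp add: card_image[OF inj])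
  moreover have "(\<lambda>i. i div k) ` A \<subseteq> {..<1 + n + l}"
  proof (rule image_subsetI)
    fix i assume "i \<in> A"
    then have "i < (1 + n + l) * k"
      using A(1) by (auto simp: k_def)
    then show "i div k \<in> {..<1 + n + l}"
      by (simp only: less_mult_imp_div_less lessThan_iff)
  qed
  ultimately have onto: "(\<lambda>i. i div k) ` A = {..<1 + n + l}"
    by (intro card_seteq) auto
  have "\<exists>i\<in>A. i div k = u" if "u < 1 + n + l" for u
    using onto that by (metis imageE lessThan_iff)
  then obtain f where f: "\<And>u. u < 1 + n + l \<Longrightarrow> f u \<in> A \<and> f u div k = u"
    by metis
  define d where "d u = (f u mod k + k - f 0 mod k) mod k" for u
  have no_clash: "\<not> clash n C u (f u mod k) u' (f u' mod k)" if "u < 1 + n + l" "u' < 1 + n + l" "u \<noteq> u'" for u u'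
  proof -
    have "f u \<noteq> f u'"
      using f[OF that(1)] f[OF that(2)] that(3) by metis
    then have "\<not> sat_adj n C (f u) (f u')"
      using A(2) f that by blast
    then show ?thesis
      using f[OF that(1)] f[OF that(2)] by (simp add: sat_adj_def k_def)
  qed
  have var: "d (Suc v) div 2 = v" if "v < n" for v
    using no_clash[of 0 "Suc v"] that by (simp add: clash_def d_def k_def)
  have clause: "C j (d (1 + n + j))" if "j < l" for j
    using no_clash[of 0 "1 + n + j"] that by (simp add: clash_def d_def k_def)
  show ?thesis
    unfolding satisfiable_def
  proof (intro exI[of _ "\<lambda>v. odd (d (Suc v))"] allI impI)
    fix j assume j: "j < l"
    let ?a = "d (1 + n + j)"
    have a: "?a < 2 * n"
      using k by (simp add: d_def k_def)
    define v where "v = ?a div 2"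
    have v: "v < n"
      using a by (simp add: v_def)
    have "f (Suc v) mod k \<noteq> f (1 + n + j) mod k"
      using no_clash[of "Suc v" "1 + n + j"] v j by (simp add: clash_def)
    then have "d (Suc v) \<noteq> ?a"
      unfolding d_def using shift_inj[of "f (Suc v) mod k" k "f (1 + n + j) mod k" "f 0 mod k"] k by auto
    moreover have "d (Suc v) div 2 = ?a div 2"
      using var[OF v] by (simp add: v_def)
    ultimately have "odd (d (Suc v)) \<longleftrightarrow> even ?a"
      by (metis even_two_times_div_two odd_two_times_div_two_succ)
    then show "\<exists>a<2 * n. C j a \<and> odd (d (Suc (a div 2))) = even a"
      using a clause[OF j] by (auto simp: v_def)
  qed
qed

section \<open>Hardness\<close>

definition frac_mat :: "nat \<Rightarrow> (nat \<Rightarrow> nat \<Rightarrow> nat) \<Rightarrow> nat \<Rightarrow> rat mat" where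
  "frac_mat n a d = mat n n (\<lambda>(i, j). of_nat (a i j) / of_nat d)"

definition matrix_bits :: "nat \<Rightarrow> (nat \<Rightarrow> nat \<Rightarrow> nat) \<Rightarrow> nat \<Rightarrow> bool list" where
  "matrix_bits n a d = encode_nat n @
     concat (map (\<lambda>i. concat (map (\<lambda>j. encode_fraction (int (a i j), d)) [0..<n])) [0..<n])"

lemma encodes_frac_mat: "0 < d \<Longrightarrow> encodes_mat (frac_mat n a d) (matrix_bits n a d)"
  unfolding encodes_mat_def matrix_bits_def
  by (intro conjI exI[of _ "\<lambda>i j. (int (a i j), d)"]) (auto simp: frac_mat_def)

lemma dim_frac_mat [simp]: "dim_row (frac_mat n a d) = n"
  by (simp add: frac_mat_def)

lemma real_frac_mat:
  "real_mat (frac_mat n a d) \<in> carrier_mat n n"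
  "i < n \<Longrightarrow> j < n \<Longrightarrow> real_mat (frac_mat n a d) $$ (i, j) = real (a i j) / real d"
  by (simp_all add: frac_mat_def of_rat_divide)

lemma symmetric_frac_mat:
  "1 \<le> n \<Longrightarrow> (\<And>i j. a i j = a j i) \<Longrightarrow> frac_mat n a d \<in> symmetric_rat_mats"
  unfolding symmetric_rat_mats_def by (auto simp: frac_mat_def intro!: eq_matI)

lemma pt_out_matrix_bits:
  "pt_num (\<lambda>x \<sigma>. n x) \<Longrightarrow> pt_num (\<lambda>x \<sigma>. d x) \<Longrightarrow> pt_num2 a \<Longrightarrow> pt_out (\<lambda>x \<sigma>. matrix_bits (n x) (a x) (d x))"
  unfolding matrix_bits_def by (rule pt_out_matrix) (auto intro: pt_num2D pt_num_var)

section \<open>Matrices with natural numerators for both polytopes\<close>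

context graph_matrix
begin

text \<open>Numerator over \<open>D\<close> of the image under \<open>x \<mapsto> 1 - 2 x\<close>,
  where coordinate \<open>size\<close> is the additional one and contributes zeros. The positive
  terms come first because the subtraction is that of natural numbers, shown below to be
  exact.\<close>

definition cut_entry :: "nat \<Rightarrow> nat \<Rightarrow> nat" where
  "cut_entry i j = D + 4 * (if i < size \<and> j < size then entry i j else 0)
     - (2 * (if i < size then entry i i else 0) + 2 * (if j < size then entry j j else 0))"

lemma entry_sym: "entry i j = entry j i"
  using conflict_sym by (auto simp: entry_def)

lemma cut_entry_sym: "cut_entry i j = cut_entry j i"
  unfolding cut_entry_def entry_sym[of i j] by (simp add: add.commute conj_commute)

lemma N_le_D: "10 * m + 6 \<le> D + 2 * k"
proof -
  have m: "3 \<le> m"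
    using k_pos k_less by simp
  have "3 * m \<le> m * m"
    using m by (rule mult_le_mono1)
  moreover have "D = 2 * (m * m) + 5 * m + 2"
    by (simp add: D_def N_def algebra_simps)
  ultimately show ?thesis
    using k_pos m by linarith
qed

text \<open>The added term credits \<open>m - k\<close> to every coordinate except the additional
  vertex. Summed over two distinct coordinates, it records that the large residue
  \<open>m - k\<close> can occur only once.\<close>

lemma entry_diag_le:
  assumes "i < size"
  shows "entry i i + (if i = N * N + m then 1 else m - k) \<le> (m - k) + 2 * m + 2"
proof -
  have "i - N * N = m \<longleftrightarrow> i = N * N + m" if "\<not> i < N * N"
    using that by auto
  then show ?thesis
    using k_less by (auto simp: entry_def residue_def)
qed

lemma cut_entry_nonneg:
  assumes "i \<noteq> j"
  shows "2 * (if i < size then entry i i else 0) + 2 * (if j < size then entry j j else 0) \<le> D"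
proof -
  have bound: "(if i < size then entry i i else 0) + (if i = N * N + m then 1 else m - k) \<le> (m - k) + 2 * m + 2" for i
    using entry_diag_le[of i] k_less by auto
  have other: "(m - k) + 1 \<le> (if i = N * N + m then 1 else m - k) + (if j = N * N + m then 1 else m - k)"
    using assms k_less by auto
  have "2 * (if i < size then entry i i else 0) + 2 * (if j < size then entry j j else 0) \<le> 2 * ((m - k) + 4 * m + 3)"
  proof -
    have "2 * A + 2 * B \<le> 2 * (M + 4 * m + 3)"
      if "A + I \<le> M + 2 * m + 2" "B + J \<le> M + 2 * m + 2" "M + 1 \<le> I + J" for A B I J M :: nat
    proof -
      have "A + B \<le> M + 4 * m + 3"
        using that by linarith
      then show ?thesis by simp
    qed
    then show ?thesis
      using bound[of i] bound[of j] other by blast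
  qed
  also have "2 * ((m - k) + 4 * m + 3) \<le> D"
  proof -
    have "2 * ((m - k) + 4 * m + 3) + 2 * k = 10 * m + 6"
      using k_less by simp
    then show ?thesis
      using N_le_D by linarith
  qed
  finally show ?thesis .
qed

lemma real_cut_entry:
  "real (cut_entry i j) / real D = 1 - 2 * (if i < size \<and> i < size then \<Gamma> i i else 0)
     - 2 * (if j < size \<and> j < size then \<Gamma> j j else 0) + 4 * (if i < size \<and> j < size then \<Gamma> i j else 0)"
proof -
  have "2 * (if i < size then entry i i else 0) + 2 * (if j < size then entry j j else 0)
      \<le> D + 4 * (if i < size \<and> j < size then entry i j else 0)"
  \<comment> \<open>Off the diagonal \<open>D\<close> alone is large enough; on the diagonal the two
    sides differ by exactly \<open>D\<close>.\<close>
  proof (cases "i = j")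
    case False
    then show ?thesis
      using cut_entry_nonneg[of i j] by linarith
  qed simp
  then have "real (cut_entry i j) = real D + 4 * real (if i < size \<and> j < size then entry i j else 0)
     - (2 * real (if i < size then entry i i else 0) + 2 * real (if j < size then entry j j else 0))"
    unfolding cut_entry_def by (subst of_nat_diff) simp_all
  moreover have "(real D + 4 * u - (2 * v + 2 * w)) / real D = 1 - 2 * (v / real D) - 2 * (w / real D) + 4 * (u / real D)" for u v w
    using D_pos by (simp add: add_divide_distrib diff_divide_distrib)
  ultimately show ?thesis
    by (simp add: \<Gamma>_def)
qed

lemma COR_iff:
  "(\<exists>T\<subseteq>COR_generators size. Q (card T) \<and> convex_combination size T (real_mat (frac_mat size entry D))) \<longleftrightarrow>
   (\<exists>F w. Q (card F) \<and> decomposes size F w \<Gamma>)"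
  by (rule COR_combination_iff[OF real_frac_mat(1)]) (simp only: real_frac_mat(2) \<Gamma>_def)

lemma CUT_iff:
  "(\<exists>T\<subseteq>CUT_generators (Suc size). Q (card T) \<and> convex_combination (Suc size) T (real_mat (frac_mat (Suc size) cut_entry D))) \<longleftrightarrow>
   (\<exists>F w. Q (card F) \<and> decomposes size F w \<Gamma>)"
proof (rule CUT_combination_iff[OF real_frac_mat(1)])
  show "real_mat (frac_mat (Suc size) cut_entry D) $$ (i, j) =
      1 - 2 * (if i < size \<and> i < size then \<Gamma> i i else 0)
     - 2 * (if j < size \<and> j < size then \<Gamma> j j else 0) + 4 * (if i < size \<and> j < size then \<Gamma> i j else 0)"
    if "i < Suc size" "j < Suc size" for i j
    unfolding real_frac_mat(2)[OF that] by (rule real_cut_entry)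
qed (rule refl)

lemma nCOR_iff: "real_mat (frac_mat size entry D) \<in> nCOR size \<longleftrightarrow> (\<exists>F w. decomposes size F w \<Gamma>)"
  and sparse_COR_iff: "convex_combination_at_most r size (COR_generators size) (real_mat (frac_mat size entry D)) \<longleftrightarrow>
    (\<exists>F w. card F \<le> r \<and> decomposes size F w \<Gamma>)"
  and nCUT_iff: "real_mat (frac_mat (Suc size) cut_entry D) \<in> nCUT (Suc size) \<longleftrightarrow> (\<exists>F w. decomposes size F w \<Gamma>)"
  and sparse_CUT_iff: "convex_combination_at_most r (Suc size) (CUT_generators (Suc size)) (real_mat (frac_mat (Suc size) cut_entry D)) \<longleftrightarrow>
    (\<exists>F w. card F \<le> r \<and> decomposes size F w \<Gamma>)"
  using COR_iff[of "\<lambda>_. True"] COR_iff[of "\<lambda>c. c \<le> r"] CUT_iff[of "\<lambda>_. True"] CUT_iff[of "\<lambda>c. c \<le> r"]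
  by (simp_all add: nCOR_def nCUT_def convex_hull_mat_def convex_combination_at_most_def)

lemma symmetric_mats:
  "frac_mat size entry D \<in> symmetric_rat_mats" "frac_mat (Suc size) cut_entry D \<in> symmetric_rat_mats"
  by (intro symmetric_frac_mat entry_sym cut_entry_sym; simp add: size_def N_def)+

end

text \<open>A satisfying assignment gives one sparse decomposition for either value of
  \<open>e\<close>. The converse rests on the total weight for \<open>True\<close> and on the number
  of generators for \<open>False\<close>.\<close>

theorem NP_sat_matrices:
  assumes "in_NP L"
  obtains m k :: "bool list \<Rightarrow> nat" and adj :: "bool list \<Rightarrow> nat \<Rightarrow> nat \<Rightarrow> bool" where
    "pt_num (\<lambda>x \<sigma>. m x)" "pt_num (\<lambda>x \<sigma>. k x)" "pt_test2 adj"
    "\<And>x. graph_matrix (m x) (k x) (adj x)"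
    "\<And>x. x \<in> L \<longleftrightarrow> (\<exists>F w. decomposes (graph_matrix.size (m x)) F w (graph_matrix.\<Gamma> (m x) (k x) (adj x) True))"
    "\<And>x. x \<in> L \<longleftrightarrow> (\<exists>F w. card F \<le> 2 * (graph_matrix.N (m x) * graph_matrix.N (m x)) + k x + 1 \<and>
        decomposes (graph_matrix.size (m x)) F w (graph_matrix.\<Gamma> (m x) (k x) (adj x) False))"
proof -
  obtain nv mc :: "bool list \<Rightarrow> nat" and C :: "bool list \<Rightarrow> nat \<Rightarrow> nat \<Rightarrow> bool" where
    nv: "pt_num (\<lambda>x \<sigma>. nv x)" and mc: "pt_num (\<lambda>x \<sigma>. mc x)" and C: "pt_test2 C" and pos: "\<And>x. 0 < nv x"
    and L: "\<And>x. x \<in> L \<longleftrightarrow> satisfiable (nv x) (mc x) (C x)"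
    using NP_satisfiability[OF assms] unfolding satisfiable_def by metis
  define k where "k x = 2 * nv x" for x
  define m where "m x = (1 + nv x + mc x) * k x" for x
  define adj where "adj x = sat_adj (nv x) (C x)" for x
  have gm: "graph_matrix (m x) (k x) (adj x)" for x
    unfolding m_def k_def adj_def using pos by (rule sat_graph_matrix)
  have complete: "\<exists>F w. decomposes (graph_matrix.size (m x)) F w (graph_matrix.\<Gamma> (m x) (k x) (adj x) e) \<and>
      card F \<le> 2 * (graph_matrix.N (m x) * graph_matrix.N (m x)) + k x + 1" if x: "x \<in> L" for x e
  proof -
    obtain color :: "nat \<Rightarrow> nat" where "\<And>i. i < m x \<Longrightarrow> color i < k x" "\<And>c. c < k x \<Longrightarrow> \<exists>i<m x. color i = c"
      "\<And>i j. i < m x \<Longrightarrow> j < m x \<Longrightarrow> i \<noteq> j \<Longrightarrow> adj x i j \<Longrightarrow> color i \<noteq> color j"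
      using sat_colorable[OF x[unfolded L] pos] unfolding m_def k_def adj_def by blast
    then show ?thesis
      by (rule graph_matrix.decomposes_if_colorable[OF gm])
  qed
  have sound: "x \<in> L" if large: "\<exists>A. graph_matrix.independent (m x) (adj x) A \<and> m x \<le> k x * card A" for x
  proof -
    obtain A where A: "graph_matrix.independent (m x) (adj x) A" "m x \<le> k x * card A"
      using large by (elim exE conjE)
    have "A \<subseteq> {..<m x}" "\<forall>i\<in>A. \<forall>j\<in>A. i \<noteq> j \<longrightarrow> \<not> adj x i j"
      using A(1) unfolding graph_matrix.independent_def[OF gm] by simp_all
    then show ?thesis
      unfolding L using A(2) unfolding m_def k_def adj_def by (rule sat_if_large_independent[OF pos])
  qed
  show thesis
  proof (rule that[of m k adj])
    show k_pt: "pt_num (\<lambda>x \<sigma>. k x)"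
      unfolding k_def by (intro pt_intros nv)
    show "pt_num (\<lambda>x \<sigma>. m x)"
      unfolding m_def by (intro pt_intros nv mc k_pt)
    show "pt_test2 adj"
      unfolding adj_def sat_adj_def clash_def
      by (intro pt_test2I pt_intros pt_test2D[OF C] nv; assumption)
    show "graph_matrix (m x) (k x) (adj x)" for x
      by (rule gm)
    show "x \<in> L \<longleftrightarrow> (\<exists>F w. decomposes (graph_matrix.size (m x)) F w (graph_matrix.\<Gamma> (m x) (k x) (adj x) True))" for x
      using complete[of x True] sound[of x] graph_matrix.large_independent_if_adjacent[OF gm, of x _ _ True] by blast
    show "x \<in> L \<longleftrightarrow> (\<exists>F w. card F \<le> 2 * (graph_matrix.N (m x) * graph_matrix.N (m x)) + k x + 1 \<and>
        decomposes (graph_matrix.size (m x)) F w (graph_matrix.\<Gamma> (m x) (k x) (adj x) False))" for x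
      using complete[of x False] sound[of x] graph_matrix.large_independent_if_sparse[OF gm, of x _ _ False] by blast
  qed
qed

lemma pt_num_graph_matrix:
  assumes gm: "\<And>x. graph_matrix (m x) (k x) (adj x)" and m: "pt_num (\<lambda>x \<sigma>. m x)" and k: "pt_num (\<lambda>x \<sigma>. k x)" and adj: "pt_test2 adj"
  shows "pt_num (\<lambda>x \<sigma>. graph_matrix.N (m x))" "pt_num (\<lambda>x \<sigma>. graph_matrix.D (m x))"
    "pt_num (\<lambda>x \<sigma>. graph_matrix.size (m x))"
    "pt_num2 (\<lambda>x. graph_matrix.entry (m x) (k x) (adj x) e)"
    "pt_num2 (\<lambda>x. graph_matrix.cut_entry (m x) (k x) (adj x) e)"
proof -
  show N: "pt_num (\<lambda>x \<sigma>. graph_matrix.N (m x))"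
    unfolding graph_matrix.N_def[OF gm] by (intro pt_intros m)
  show D: "pt_num (\<lambda>x \<sigma>. graph_matrix.D (m x))"
    unfolding graph_matrix.D_def[OF gm] by (intro pt_intros m N)
  show size: "pt_num (\<lambda>x \<sigma>. graph_matrix.size (m x))"
    unfolding graph_matrix.size_def[OF gm] by (intro pt_intros m N)
  \<comment> \<open>\<open>if_bool_eq_conj\<close> turns the Boolean conditional in
    \<open>conflict\<close> into implications, for which closure of tests is available.\<close>
  show entry: "pt_num2 (\<lambda>x. graph_matrix.entry (m x) (k x) (adj x) e)"
    unfolding graph_matrix.entry_def[OF gm] graph_matrix.residue_def[OF gm] graph_matrix.conflict_def[OF gm] if_bool_eq_conj
    by (intro pt_num2I pt_intros pt_test2D[OF adj] m k N; assumption)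
  show "pt_num2 (\<lambda>x. graph_matrix.cut_entry (m x) (k x) (adj x) e)"
    unfolding graph_matrix.cut_entry_def[OF gm]
    by (intro pt_num2I pt_intros pt_num2D[OF entry] size D; assumption)
qed

lemma NP_hardI:
  assumes "\<And>L. in_NP L \<Longrightarrow> \<exists>f I. pt_out (\<lambda>x \<sigma>. f x) \<and> (\<forall>x. I x \<in> P \<and> enc (I x) (f x) \<and> (x \<in> L \<longleftrightarrow> I x \<in> Y))"
  shows "NP_hard enc P Y"
  unfolding NP_hard_def
proof (intro allI impI)
  fix L assume "in_NP L"
  then obtain f I where f: "pt_out (\<lambda>x \<sigma>. f x)" and I: "\<forall>x. I x \<in> P \<and> enc (I x) (f x) \<and> (x \<in> L \<longleftrightarrow> I x \<in> Y)"
    using assms by blast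
  then show "\<exists>f. polytime_computable f \<and> (\<forall>x. \<exists>I\<in>P. enc I (f x) \<and> (x \<in> L \<longleftrightarrow> I \<in> Y))"
    using pt_out_polytime_computable[OF f] by blast
qed

theorem mainTheorem6:
  shows
    "NP_hard encodes_mat
       symmetric_rat_mats
       {\<Gamma>. real_mat \<Gamma> \<in> nCOR (dim_row \<Gamma>)}
     \<and>
     NP_hard encodes_nat_mat
       {(\<rho>, \<Gamma>). 1 \<le> \<rho> \<and> \<Gamma> \<in> symmetric_rat_mats \<and> real_mat \<Gamma> \<in> nCOR (dim_row \<Gamma>)}
       {(\<rho>, \<Gamma>). convex_combination_at_most \<rho> (dim_row \<Gamma>) (COR_generators (dim_row \<Gamma>)) (real_mat \<Gamma>)}
     \<and>
     NP_hard encodes_mat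
       symmetric_rat_mats
       {\<Gamma>. real_mat \<Gamma> \<in> nCUT (dim_row \<Gamma>)}
     \<and>
     NP_hard encodes_nat_mat
       {(\<rho>, \<Gamma>). 1 \<le> \<rho> \<and> \<Gamma> \<in> symmetric_rat_mats \<and> real_mat \<Gamma> \<in> nCUT (dim_row \<Gamma>)}
       {(\<rho>, \<Gamma>). convex_combination_at_most \<rho> (dim_row \<Gamma>) (CUT_generators (dim_row \<Gamma>)) (real_mat \<Gamma>)}"
proof (intro conjI; rule NP_hardI)
  fix L assume L: "in_NP L"
  obtain m k :: "bool list \<Rightarrow> nat" and adj :: "bool list \<Rightarrow> nat \<Rightarrow> nat \<Rightarrow> bool" where
    m: "pt_num (\<lambda>x \<sigma>. m x)" and k: "pt_num (\<lambda>x \<sigma>. k x)" and adj: "pt_test2 adj" and gm: "\<And>x. graph_matrix (m x) (k x) (adj x)"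
    and member: "\<And>x. x \<in> L \<longleftrightarrow> (\<exists>F w. decomposes (graph_matrix.size (m x)) F w (graph_matrix.\<Gamma> (m x) (k x) (adj x) True))"
    and sparse: "\<And>x. x \<in> L \<longleftrightarrow> (\<exists>F w. card F \<le> 2 * (graph_matrix.N (m x) * graph_matrix.N (m x)) + k x + 1 \<and>
        decomposes (graph_matrix.size (m x)) F w (graph_matrix.\<Gamma> (m x) (k x) (adj x) False))"
    using NP_sat_matrices[OF L] by metis
  define N D n a c where "N x = graph_matrix.N (m x)" and "D x = graph_matrix.D (m x)" and "n x = graph_matrix.size (m x)"
    and "a e x = graph_matrix.entry (m x) (k x) (adj x) e" and "c e x = graph_matrix.cut_entry (m x) (k x) (adj x) e" for x e
  \<comment> \<open>The bound admits two sets for every pair, the \<open>k\<close> colour classes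
    and the additional vertex alone.\<close>
  define \<rho> where "\<rho> x = 2 * (N x * N x) + k x + 1" for x
  note pt = pt_num_graph_matrix[OF gm m k adj, folded N_def D_def n_def a_def c_def]
  have \<rho>: "pt_num (\<lambda>x \<sigma>. \<rho> x)"
    unfolding \<rho>_def by (intro pt_intros pt k)
  have D_pos: "0 < D x" for x
    unfolding D_def using graph_matrix.D_pos[OF gm] .
  note member' = member[folded n_def] and sparse' = sparse[folded n_def N_def \<rho>_def]
  note sym = graph_matrix.symmetric_mats[OF gm, folded D_def n_def a_def c_def]
  note nCOR = graph_matrix.nCOR_iff[OF gm, folded D_def n_def a_def c_def]
  note nCUT = graph_matrix.nCUT_iff[OF gm, folded D_def n_def a_def c_def]
  note sCOR = graph_matrix.sparse_COR_iff[OF gm, folded D_def n_def a_def c_def]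
  note sCUT = graph_matrix.sparse_CUT_iff[OF gm, folded D_def n_def a_def c_def]
  have promise: "\<exists>F w. decomposes (n x) F w (graph_matrix.\<Gamma> (m x) (k x) (adj x) False)" for x
    unfolding n_def by (rule graph_matrix.decomposes_if_isolated[OF gm]) simp
  have enc: "encodes_nat_mat (r, frac_mat l b d) (encode_nat r @ matrix_bits l b d)" if "0 < d" for r l b d
    unfolding encodes_nat_mat_def using encodes_frac_mat[OF that] by blast
  show "\<exists>f I. pt_out (\<lambda>x \<sigma>. f x) \<and> (\<forall>x. I x \<in> symmetric_rat_mats \<and> encodes_mat (I x) (f x) \<and>
      (x \<in> L \<longleftrightarrow> I x \<in> {\<Gamma>. real_mat \<Gamma> \<in> nCOR (dim_row \<Gamma>)}))"
    by (intro exI[of _ "\<lambda>x. matrix_bits (n x) (a True x) (D x)"] exI[of _ "\<lambda>x. frac_mat (n x) (a True x) (D x)"]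
        conjI allI pt_out_matrix_bits pt sym encodes_frac_mat D_pos) (simp add: nCOR member')
  show "\<exists>f I. pt_out (\<lambda>x \<sigma>. f x) \<and> (\<forall>x. I x \<in> symmetric_rat_mats \<and> encodes_mat (I x) (f x) \<and>
      (x \<in> L \<longleftrightarrow> I x \<in> {\<Gamma>. real_mat \<Gamma> \<in> nCUT (dim_row \<Gamma>)}))"
    by (intro exI[of _ "\<lambda>x. matrix_bits (Suc (n x)) (c True x) (D x)"] exI[of _ "\<lambda>x. frac_mat (Suc (n x)) (c True x) (D x)"]
        conjI allI pt_out_matrix_bits pt pt_num_Suc sym encodes_frac_mat D_pos) (simp add: nCUT member')
  show "\<exists>f I. pt_out (\<lambda>x \<sigma>. f x) \<and> (\<forall>x. I x \<in> {(\<rho>, \<Gamma>). 1 \<le> \<rho> \<and> \<Gamma> \<in> symmetric_rat_mats \<and> real_mat \<Gamma> \<in> nCOR (dim_row \<Gamma>)} \<and>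
      encodes_nat_mat (I x) (f x) \<and> (x \<in> L \<longleftrightarrow> I x \<in> {(\<rho>, \<Gamma>). convex_combination_at_most \<rho> (dim_row \<Gamma>) (COR_generators (dim_row \<Gamma>)) (real_mat \<Gamma>)}))"
  proof (intro exI[of _ "\<lambda>x. encode_nat (\<rho> x) @ matrix_bits (n x) (a False x) (D x)"] exI[of _ "\<lambda>x. (\<rho> x, frac_mat (n x) (a False x) (D x))"]
        conjI allI pt_out_append pt_out_encode_nat pt_out_matrix_bits pt \<rho> enc D_pos)
    show "(\<rho> x, frac_mat (n x) (a False x) (D x)) \<in> {(\<rho>, \<Gamma>). 1 \<le> \<rho> \<and> \<Gamma> \<in> symmetric_rat_mats \<and> real_mat \<Gamma> \<in> nCOR (dim_row \<Gamma>)}" for x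
      using promise[of x] sym(1) by (simp add: nCOR \<rho>_def)
    show "x \<in> L \<longleftrightarrow> (\<rho> x, frac_mat (n x) (a False x) (D x)) \<in>
        {(\<rho>, \<Gamma>). convex_combination_at_most \<rho> (dim_row \<Gamma>) (COR_generators (dim_row \<Gamma>)) (real_mat \<Gamma>)}" for x
      by (simp add: sCOR sparse' \<rho>_def)
  qed
  show "\<exists>f I. pt_out (\<lambda>x \<sigma>. f x) \<and> (\<forall>x. I x \<in> {(\<rho>, \<Gamma>). 1 \<le> \<rho> \<and> \<Gamma> \<in> symmetric_rat_mats \<and> real_mat \<Gamma> \<in> nCUT (dim_row \<Gamma>)} \<and>
      encodes_nat_mat (I x) (f x) \<and> (x \<in> L \<longleftrightarrow> I x \<in> {(\<rho>, \<Gamma>). convex_combination_at_most \<rho> (dim_row \<Gamma>) (CUT_generators (dim_row \<Gamma>)) (real_mat \<Gamma>)}))"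
  proof (intro exI[of _ "\<lambda>x. encode_nat (\<rho> x) @ matrix_bits (Suc (n x)) (c False x) (D x)"] exI[of _ "\<lambda>x. (\<rho> x, frac_mat (Suc (n x)) (c False x) (D x))"]
        conjI allI pt_out_append pt_out_encode_nat pt_out_matrix_bits pt pt_num_Suc \<rho> enc D_pos)
    show "(\<rho> x, frac_mat (Suc (n x)) (c False x) (D x)) \<in> {(\<rho>, \<Gamma>). 1 \<le> \<rho> \<and> \<Gamma> \<in> symmetric_rat_mats \<and> real_mat \<Gamma> \<in> nCUT (dim_row \<Gamma>)}" for x
      using promise[of x] sym(2) by (simp add: nCUT \<rho>_def)
    show "x \<in> L \<longleftrightarrow> (\<rho> x, frac_mat (Suc (n x)) (c False x) (D x)) \<in>
        {(\<rho>, \<Gamma>). convex_combination_at_most \<rho> (dim_row \<Gamma>) (CUT_generators (dim_row \<Gamma>)) (real_mat \<Gamma>)}" for x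
      by (simp add: sCUT sparse' \<rho>_def)
  qed
qed

end
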